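(* Let $h:\mathbb{R}^2\to[0,1]$ be $\beta$-Hölder with $\inf_xh(x)>0$, $b=\sup_xh(x)<1$ and $b<\beta\le1$. Let $\alpha:\mathbb{R}^2\to(-\pi/2,\pi/2)$ be a continuously differentiable function which is $2\eta$-Hölder for some $\eta$ with $b<\eta\le1/2$. For $\delta>0$ let $X$ be the Locally Anisotropic Fractional Brownian Field (LAFBF) $$X(x)=\int_{\mathbb{R}^2}(e^{\mathrm{j}\langle x,\xi\rangle}-1)\frac{C(x,\xi)}{\|\xi\|^{h(x)+1}}\,\widehat{\mathbf{W}}(d\xi),$$ where $C\ge0$ is given by $$C(x,\xi)^2=\frac1{4\delta}\Big(\mathbf{1}_{[\alpha(x)-\delta,\alpha(x)+\delta]}(\arg\xi)+\mathbf{1}_{[\alpha(x)+\pi-\delta,\alpha(x)+\pi+\delta]}(\arg\xi)\Big).$$ Then at each point $x_0\in\mathbb{R}^2$, $X$ admits an approximate (up to $\delta^2$) local orientation vector given by $$\vec n=\begin{pmatrix}\cos\alpha(x_0)\\ \sin\alpha(x_0)\end{pmatrix}.$$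
   Context: $\mathrm{j}$ is the imaginary unit; $\arg$ is taken modulo $2\pi$; $\mathbb{S}^1$ is the unit circle of $\mathbb{R}^2$ with arc length $d\Theta$. A function $g$ is $s$-Hölder if $\|g(x)-g(y)\|\le\Lambda\|x-y\|^s$ for some constant $\Lambda$ and all $x,y$. $\widehat{\mathbf{W}}$ is the complex-valued Gaussian white noise on $\mathbb{R}^2$ (Fourier transform of real white noise): for $g\in L^2$ with $g(-\xi)=\overline{g(\xi)}$, $\int g\,d\widehat{\mathbf{W}}$ is real centered Gaussian (jointly Gaussian in $g$) with $\mathbb{E}\big[\int g_1d\widehat{\mathbf{W}}\overline{\int g_2d\widehat{\mathbf{W}}}\big]=\int g_1\overline{g_2}\,d\xi$. A random field $X$ is $H$-localizable at $x_0$ ($H\in(0,1)$) with tangent field the non-trivial random field $Y_{x_0}$ if $\{\rho^{-H}(X(x_0+\rho u)-X(x_0))\}_{u\in\mathbb{R}^2}$ converges in distribution (weak convergence of stochastic processes, continuous versions) to $\{Y_{x_0}(u)\}_u$ as $\rho\to0$. For an $H$-self-similar centered Gaussian field $Y$ with stationary increments and spectral density $f$, i.e. $\mathbb{E}[Y(x)Y(y)]=\int(e^{\mathrm{j}\langle x,\xi\rangle}-1)(e^{-\mathrm{j}\langle y,\xi\rangle}-1)f(\xi)\,d\xi$, one has $f(\xi)=\|\xi\|^{-2H-2}C_Y(\xi/\|\xi\|)$, with $C_Y$ the anisotropy function. The structure tensor of $Y$ is the $2\times2$ matrix $\mathbf{J}_Y$ with entries $\int_{\mathbb{S}^1}\Theta_{\ell_1}\Theta_{\ell_2}C_Y(\Theta)\,d\Theta$,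 and an orientation of $Y$ is any unit eigenvector of $\mathbf{J}_Y$ associated with its largest eigenvalue. The local structure tensor $\mathbf{J}_{x_0}$ and a local orientation of a localizable field at $x_0$ are the structure tensor and an orientation of its tangent field $Y_{x_0}$. For fields depending on $\delta>0$, a unit vector $\vec n$ (independent of $\delta$) is an approximate (up to $\delta^2$) local orientation at $x_0$ if there is a constant $c>0$ independent of $\delta$ such that $\mathbf{J}_{x_0}=c\,\vec n\,\vec n^{T}+O(\delta^2)$ as $\delta\to0$. *)

theory Defs
  imports "HOL-Probability.Probability" "HOL-Library.Landau_Symbols"
begin

type_synonym plane = "real^2"

(* The first alternative is the degenerate normal law of variance 0. *)
definition centered_gaussian :: "'a measure \<Rightarrow> ('a \<Rightarrow> real) \<Rightarrow> bool" where
  "centered_gaussian M Z \<longleftrightarrow> Z \<in> borel_measurable M \<and>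
     ((AE \<omega> in M. Z \<omega> = 0) \<or> (\<exists>\<sigma>>0. distributed M lborel Z (normal_density 0 \<sigma>)))"

definition jointly_centered_gaussian :: "'a measure \<Rightarrow> 'i set \<Rightarrow> ('i \<Rightarrow> 'a \<Rightarrow> real) \<Rightarrow> bool" where
  "jointly_centered_gaussian M I Z \<longleftrightarrow>
     (\<forall>J a. finite J \<and> J \<subseteq> I \<longrightarrow> centered_gaussian M (\<lambda>\<omega>. \<Sum>i\<in>J. a i * Z i \<omega>))"

definition hermitian_L2 :: "(plane \<Rightarrow> complex) set" where
  "hermitian_L2 = {g. g \<in> borel_measurable lborel \<and>
     integrable lborel (\<lambda>\<xi>. (cmod (g \<xi>))\<^sup>2) \<and> (\<forall>\<xi>. g (- \<xi>) = cnj (g \<xi>))}"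

(* The noise is represented by its Wiener integral: W g is the random variable
   obtained by integrating g against the Fourier transform of real white noise.
   It is real for Hermitian g; W is unconstrained on other arguments.  Linearity of W
   (almost surely) follows from the covariance identity. *)
definition complex_white_noise ::
  "'a measure \<Rightarrow> ((plane \<Rightarrow> complex) \<Rightarrow> 'a \<Rightarrow> real) \<Rightarrow> bool" where
  "complex_white_noise M W \<longleftrightarrow> prob_space M \<and>
     jointly_centered_gaussian M hermitian_L2 W \<and>
     (\<forall>g1\<in>hermitian_L2. \<forall>g2\<in>hermitian_L2.
        complex_of_real (\<integral>\<omega>. W g1 \<omega> * W g2 \<omega> \<partial>M) = (\<integral>\<xi>. g1 \<xi> * cnj (g2 \<xi>) \<partial>lborel))"

definition compact_open_topology :: "(plane \<Rightarrow> real) topology" where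
  "compact_open_topology =
     topology_generated_by {{f. continuous_on UNIV f \<and> f ` K \<subseteq> U} | K U. compact K \<and> open U}"

definition continuous_field :: "'a measure \<Rightarrow> (plane \<Rightarrow> 'a \<Rightarrow> real) \<Rightarrow> bool" where
  "continuous_field M X \<longleftrightarrow> (\<forall>x. X x \<in> borel_measurable M) \<and>
     (\<forall>\<omega>\<in>space M. continuous_on UNIV (\<lambda>x. X x \<omega>))"

definition continuous_version ::
  "'a measure \<Rightarrow> (plane \<Rightarrow> 'a \<Rightarrow> real) \<Rightarrow> (plane \<Rightarrow> 'a \<Rightarrow> real) \<Rightarrow> bool" where
  "continuous_version M X X' \<longleftrightarrow>
     continuous_field M X' \<and> (\<forall>x. AE \<omega> in M. X' x \<omega> = X x \<omega>)"

(* Weak convergence of the laws on C(R^2) with locally uniform convergence.  The Borel sets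
   of that space are generated by the evaluations, so the functionals below are measurable. *)
definition converges_weakly ::
  "'a measure \<Rightarrow> ('r \<Rightarrow> plane \<Rightarrow> 'a \<Rightarrow> real) \<Rightarrow> 'b measure \<Rightarrow> (plane \<Rightarrow> 'b \<Rightarrow> real) \<Rightarrow> 'r filter \<Rightarrow> bool"
  where
  "converges_weakly M Z N Y F \<longleftrightarrow>
     (\<forall>\<Phi>. continuous_map compact_open_topology euclideanreal \<Phi> \<and>
           (\<exists>B. \<forall>f\<in>topspace compact_open_topology. \<bar>\<Phi> f\<bar> \<le> B) \<longrightarrow>
        ((\<lambda>r. \<integral>\<omega>. \<Phi> (\<lambda>u. Z r u \<omega>) \<partial>M) \<longlongrightarrow> (\<integral>\<omega>. \<Phi> (\<lambda>u. Y u \<omega>) \<partial>N)) F)"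

definition nontrivial_field :: "'a measure \<Rightarrow> (plane \<Rightarrow> 'a \<Rightarrow> real) \<Rightarrow> bool" where
  "nontrivial_field M Y \<longleftrightarrow> \<not> (\<forall>x. AE \<omega> in M. Y x \<omega> = 0)"

definition localizable_at ::
  "'a measure \<Rightarrow> (plane \<Rightarrow> 'a \<Rightarrow> real) \<Rightarrow> real \<Rightarrow> plane \<Rightarrow> 'b measure \<Rightarrow> (plane \<Rightarrow> 'b \<Rightarrow> real) \<Rightarrow> bool"
  where
  "localizable_at M X H x0 N Y \<longleftrightarrow>
     0 < H \<and> H < 1 \<and> prob_space N \<and> continuous_field N Y \<and> nontrivial_field N Y \<and>
     (\<exists>X'. continuous_version M X X' \<and>
        converges_weakly M (\<lambda>\<rho> u \<omega>. \<rho> powr (- H) * (X' (x0 + \<rho> *\<^sub>R u) \<omega> - X' x0 \<omega>)) N Y (at_right 0))"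

definition same_fdd ::
  "'a measure \<Rightarrow> (plane \<Rightarrow> 'a \<Rightarrow> real) \<Rightarrow> 'b measure \<Rightarrow> (plane \<Rightarrow> 'b \<Rightarrow> real) \<Rightarrow> bool" where
  "same_fdd M X N Y \<longleftrightarrow>
     (\<forall>I. finite I \<longrightarrow>
        distr M (\<Pi>\<^sub>M x\<in>I. borel) (\<lambda>\<omega>. \<lambda>x\<in>I. X x \<omega>) =
        distr N (\<Pi>\<^sub>M x\<in>I. borel) (\<lambda>\<omega>. \<lambda>x\<in>I. Y x \<omega>))"

definition self_similar :: "'a measure \<Rightarrow> real \<Rightarrow> (plane \<Rightarrow> 'a \<Rightarrow> real) \<Rightarrow> bool" where
  "self_similar M H Y \<longleftrightarrow>
     (\<forall>c>0. same_fdd M (\<lambda>x. Y (c *\<^sub>R x)) M (\<lambda>x \<omega>. c powr H * Y x \<omega>))"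

definition stationary_increments :: "'a measure \<Rightarrow> (plane \<Rightarrow> 'a \<Rightarrow> real) \<Rightarrow> bool" where
  "stationary_increments M Y \<longleftrightarrow>
     (\<forall>z. same_fdd M (\<lambda>x \<omega>. Y (x + z) \<omega> - Y z \<omega>) M (\<lambda>x \<omega>. Y x \<omega> - Y 0 \<omega>))"

definition spectral_density ::
  "'a measure \<Rightarrow> (plane \<Rightarrow> 'a \<Rightarrow> real) \<Rightarrow> (plane \<Rightarrow> real) \<Rightarrow> bool" where
  "spectral_density M Y f \<longleftrightarrow> f \<in> borel_measurable lborel \<and> (\<forall>\<xi>. 0 \<le> f \<xi>) \<and>
     (\<forall>x y. let k = (\<lambda>\<xi>. (cis (x \<bullet> \<xi>) - 1) * (cis (- (y \<bullet> \<xi>)) - 1) * complex_of_real (f \<xi>))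
        in integrable lborel k \<and>
           complex_of_real (\<integral>\<omega>. Y x \<omega> * Y y \<omega> \<partial>M) = (\<integral>\<xi>. k \<xi> \<partial>lborel))"

definition unit_vec :: "real \<Rightarrow> plane" where
  "unit_vec t = vector [cos t, sin t]"

definition arc_length :: "plane measure" where
  "arc_length = distr (restrict_space lborel {0..<2 * pi}) borel unit_vec"

(* Only the values of C on the unit circle matter.  As the spectral density, C is
   determined up to null sets. *)
definition anisotropy_function ::
  "'a measure \<Rightarrow> real \<Rightarrow> (plane \<Rightarrow> 'a \<Rightarrow> real) \<Rightarrow> (plane \<Rightarrow> real) \<Rightarrow> bool" where
  "anisotropy_function M H Y C \<longleftrightarrow>
     C \<in> borel_measurable borel \<and> integrable arc_length C \<and>
     (\<exists>f. spectral_density M Y f \<and>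
        (AE \<xi> in lborel. f \<xi> = norm \<xi> powr (- 2 * H - 2) * C (\<xi> /\<^sub>R norm \<xi>)))"

(* A relation, since the anisotropy function is only determined almost everywhere;
   J itself is unique. *)
definition has_structure_tensor ::
  "'a measure \<Rightarrow> real \<Rightarrow> (plane \<Rightarrow> 'a \<Rightarrow> real) \<Rightarrow> real^2^2 \<Rightarrow> bool" where
  "has_structure_tensor M H Y J \<longleftrightarrow>
     jointly_centered_gaussian M UNIV Y \<and> self_similar M H Y \<and> stationary_increments M Y \<and>
     (\<exists>C. anisotropy_function M H Y C \<and>
        J = (\<chi> i j. \<integral>\<Theta>. \<Theta> $ i * \<Theta> $ j * C \<Theta> \<partial>arc_length))"

(* Only the law of the tangent field Y matters.  Since HOL cannot quantify over types,
   its probability space N is sought over the type underlying M. *)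
definition has_local_structure_tensor ::
  "'a measure \<Rightarrow> (plane \<Rightarrow> 'a \<Rightarrow> real) \<Rightarrow> plane \<Rightarrow> real^2^2 \<Rightarrow> bool" where
  "has_local_structure_tensor M X x0 J \<longleftrightarrow>
     (\<exists>H (N :: 'a measure) Y. localizable_at M X H x0 N Y \<and> has_structure_tensor N H Y J)"

definition approx_local_orientation ::
  "'a measure \<Rightarrow> (real \<Rightarrow> plane \<Rightarrow> 'a \<Rightarrow> real) \<Rightarrow> plane \<Rightarrow> plane \<Rightarrow> bool" where
  "approx_local_orientation M X x0 n \<longleftrightarrow> norm n = 1 \<and>
     (\<exists>J. (\<forall>\<delta>>0. has_local_structure_tensor M (X \<delta>) x0 (J \<delta>)) \<and>
        (\<exists>c>0. \<forall>i j. (\<lambda>\<delta>. J \<delta> $ i $ j - c * (n $ i * n $ j)) \<in> O[at_right 0](\<lambda>\<delta>. \<delta>\<^sup>2)))"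

definition holder :: "real \<Rightarrow> ('a::real_normed_vector \<Rightarrow> 'b::real_normed_vector) \<Rightarrow> bool" where
  "holder s g \<longleftrightarrow> (\<exists>\<Lambda>. \<forall>x y. norm (g x - g y) \<le> \<Lambda> * norm (x - y) powr s)"

definition C1 :: "(plane \<Rightarrow> real) \<Rightarrow> bool" where
  "C1 g \<longleftrightarrow> (\<exists>g'. (\<forall>x. (g has_derivative blinfun_apply (g' x)) (at x)) \<and> continuous_on UNIV g')"

(* is_Arg z t says that t is one of the arguments of z, so membership is modulo 2 pi.
   The value at xi = 0 is irrelevant, as the kernel below vanishes there. *)
definition arg_in :: "plane \<Rightarrow> real set \<Rightarrow> bool" where
  "arg_in \<xi> S \<longleftrightarrow> (\<exists>t\<in>S. is_Arg (Complex (\<xi> $ 1) (\<xi> $ 2)) t)"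

definition lafbf_C :: "(plane \<Rightarrow> real) \<Rightarrow> real \<Rightarrow> plane \<Rightarrow> plane \<Rightarrow> real" where
  "lafbf_C \<alpha> \<delta> x \<xi> = sqrt (1 / (4 * \<delta>) *
     (of_bool (arg_in \<xi> {\<alpha> x - \<delta>..\<alpha> x + \<delta>}) +
      of_bool (arg_in \<xi> {\<alpha> x + pi - \<delta>..\<alpha> x + pi + \<delta>})))"

definition lafbf ::
  "((plane \<Rightarrow> complex) \<Rightarrow> 'a \<Rightarrow> real) \<Rightarrow> (plane \<Rightarrow> real) \<Rightarrow> (plane \<Rightarrow> real) \<Rightarrow> real \<Rightarrow>
   plane \<Rightarrow> 'a \<Rightarrow> real" where
  "lafbf W h \<alpha> \<delta> x =
     W (\<lambda>\<xi>. (cis (x \<bullet> \<xi>) - 1) * complex_of_real (lafbf_C \<alpha> \<delta> x \<xi> / norm \<xi> powr (h x + 1)))"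

end

(* The tangent field at x0 is Y u = W (g u), g u = (cis (u . xi) - 1) C(x0, xi) / |xi|^(h x0 + 1), on the
   probability space of the noise itself.  After the substitution xi -> xi / rho and multiplication by a
   unimodular phase, neither of which changes covariances, the kernels of the increments
   rho^(-h x0) (X (x0 + rho u) - X x0) converge in L2 to g u: the error from the variation of h is controlled
   by beta > h x0, the error from the variation of alpha by eta > h x0, because the angular sectors on
   which C(x, .) and C(x0, .) differ have opening at most |alpha x - alpha x0|.  Gaussian moments give
   increment bounds uniform in rho, so chaining over dyadic grids upgrades this to locally uniform
   convergence in probability, hence to weak convergence without any tightness argument.
   The structure tensor of Y has the entries
   A + (B cos 2 alpha + D sin 2 alpha) sin (2 delta) / (2 delta), and the limit delta -> 0 gives n n^T. *)

theory Submission
  imports Defs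
begin

section \<open>Laws of Gaussian fields\<close>

text \<open>The two Hoelder conditions are asymmetric because the squared L2 distance of two kernels
  is quadratic in the change of \<open>h\<close> but, \<open>C\<close> being built from indicators,
  only linear in the change of \<alpha>. These terms must be o(\<rho>^(2 h(x0))); so \<alpha>
  carries the exponent \<open>2 * \<eta>\<close> where \<open>h\<close> carries \<beta>. The
  obstacle to bounds uniform in \<rho> is that the Hurst index moves with the point: the factor
  \<open>\<rho> powr (2 * h x - 2 * h x0)\<close> may exceed 1. It stays bounded because
  \<open>\<rho> powr \<beta> * ln (1 / \<rho>)\<close> does. On bounded sets all exponents are then
  lowered to \<open>2 * a\<close>, \<open>a\<close> being the infimum of \<open>h\<close>; Gaussian
  moments of high order make chaining work for any positive exponent. The noise is linear only
  almost surely and fields are given only up to versions. Laws are therefore compared through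
  covariances of kernels, and continuous functionals of a path are reached through its values on
  finite grids.\<close>

lemma cis_sum: "finite I \<Longrightarrow> cis (\<Sum>i\<in>I. f i) = (\<Prod>i\<in>I. cis (f i))"
  by (induction I rule: finite_induct) (auto simp: cis_mult[symmetric])

lemma borel_measurable_cis [measurable]: "cis \<in> borel_measurable borel"
  by (intro borel_measurable_continuous_onI continuous_intros)

text \<open>The case \<open>a = 0\<close>, \<open>t = 0\<close> gives equal masses, a shift of
  \<open>t\<close> by a quarter period turns cosines into sines, and after normalisation Levy's
  uniqueness theorem applies. The test functions are \<open>1 + cos\<close> because nonnegative
  factors can serve as densities in the multivariate case.\<close>

lemma finite_measure_eqI_cos:
  fixes m n :: "real measure"
  assumes "finite_measure m" "finite_measure n" and sm[simp, measurable_cong]: "sets m = sets borel"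
    and sn[simp, measurable_cong]: "sets n = sets borel"
    and eq: "\<And>a t. (\<integral>x. 1 + cos (a * x + t) \<partial>m) = (\<integral>x. 1 + cos (a * x + t) \<partial>n)"
  shows "m = n"
proof -
  interpret m: finite_measure m by fact
  interpret n: finite_measure n by fact
  have sp[simp]: "space m = UNIV" "space n = UNIV"
    using sets_eq_imp_space_eq[OF sm] sets_eq_imp_space_eq[OF sn] by auto
  define c where "c = measure m UNIV"
  have c: "measure n UNIV = c"
    using eq[of 0 0] by (simp add: c_def)
  have intm: "integrable m (\<lambda>x. cos (a * x + t))" "integrable m (\<lambda>x. sin (a * x + t))" for a t
    by (rule m.integrable_const_bound[where B=1]; simp)+
  have intn: "integrable n (\<lambda>x. cos (a * x + t))" "integrable n (\<lambda>x. sin (a * x + t))" for a t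
    by (rule n.integrable_const_bound[where B=1]; simp)+
  have cos_eq: "(\<integral>x. cos (a * x + t) \<partial>m) = (\<integral>x. cos (a * x + t) \<partial>n)" for a t
    using eq[of a t] by (simp add: intm intn c c_def[symmetric])
  have sin_eq: "(\<integral>x. sin (a * x + 0) \<partial>m) = (\<integral>x. sin (a * x + 0) \<partial>n)" for a
    using cos_eq[of a "- pi/2"] by (simp add: cos_diff)
  have cis_eq: "(\<integral>x. cis (a * x) \<partial>m) = (\<integral>x. cis (a * x) \<partial>n)" for a
  proof -
    have *: "integrable m (\<lambda>x. cis (a * x))" "integrable n (\<lambda>x. cis (a * x))"
      by (rule m.integrable_const_bound[where B=1] n.integrable_const_bound[where B=1]; simp add: borel_measurable_cis)+
    show ?thesis
      using cos_eq[of a 0] sin_eq[of a] integral_Re[OF *(1)] integral_Re[OF *(2)] integral_Im[OF *(1)] integral_Im[OF *(2)]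
      by (auto intro!: complex_eqI)
  qed
  show ?thesis
  proof (cases "c = 0")
    case True
    have "emeasure m A = 0" "emeasure n A = 0" for A
    proof -
      have "emeasure m UNIV = 0" "emeasure n UNIV = 0"
        using True c by (simp_all add: c_def m.emeasure_eq_measure n.emeasure_eq_measure)
      then show "emeasure m A = 0" "emeasure n A = 0"
        using emeasure_space[of m A] emeasure_space[of n A] by auto
    qed
    then show ?thesis by (intro measure_eqI) auto
  next
    case False
    then have c0: "c > 0" unfolding c_def using zero_less_measure_iff by blast
    define m' n' where "m' = density m (\<lambda>_. ennreal (1/c))" and "n' = density n (\<lambda>_. ennreal (1/c))"
    have "real_distribution m'" "real_distribution n'"
      unfolding real_distribution_def real_distribution_axioms_def m'_def n'_def
      using c0 c by (auto intro!: prob_spaceI simp: emeasure_density m.emeasure_eq_measure n.emeasure_eq_measure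
          ennreal_mult[symmetric] c_def)
    moreover have "char m' = char n'"
      unfolding char_def m'_def n'_def using c0
      using cis_eq by (auto simp: integral_density cis_conv_exp fun_eq_iff)
    ultimately have eq': "m' = n'" by (rule Levy_uniqueness)
    show ?thesis
    proof (rule measure_eqI)
      fix A assume A: "A \<in> sets m"
      have "emeasure m' A = emeasure n' A" by (simp add: eq')
      then have "ennreal (1/c) * emeasure m A = ennreal (1/c) * emeasure n A"
        using A by (simp add: m'_def n'_def emeasure_density nn_integral_cmult_indicator)
      then show "emeasure m A = emeasure n A" using c0
        by (simp add: ennreal_mult_cancel_left)
    qed simp
  qed
qed

text \<open>The trigonometric factors $1 + \cos(a_i x_i + t_i) \ge 0$ are replaced one coordinate at a time
  by indicators; each replacement is an instance of the one-dimensional uniqueness theorem.\<close>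

lemma measure_eqI_PiM_char:
  fixes I :: "'i set" and \<mu> \<nu> :: "('i \<Rightarrow> real) measure"
  assumes fin: "finite I" and "prob_space \<mu>" "prob_space \<nu>"
    and s\<mu>[simp, measurable_cong]: "sets \<mu> = sets (\<Pi>\<^sub>M i\<in>I. borel)"
    and s\<nu>[simp, measurable_cong]: "sets \<nu> = sets (\<Pi>\<^sub>M i\<in>I. borel)"
    and eq: "\<And>a. (\<integral>x. cis (\<Sum>i\<in>I. a i * x i) \<partial>\<mu>) = (\<integral>x. cis (\<Sum>i\<in>I. a i * x i) \<partial>\<nu>)"
  shows "\<mu> = \<nu>"
proof -
  interpret \<mu>: prob_space \<mu> by fact
  interpret \<nu>: prob_space \<nu> by fact
  \<comment> \<open>\<open>J\<close> holds the coordinates already converted to indicators,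
    \<open>K\<close> those that still carry a cosine factor.\<close>
  define G :: "'i set \<Rightarrow> ('i \<Rightarrow> real set) \<Rightarrow> ('i \<Rightarrow> real) \<Rightarrow> ('i \<Rightarrow> real) \<Rightarrow> 'i set \<Rightarrow> ('i \<Rightarrow> real) \<Rightarrow> real"
    where "G J A a t K x = (\<Prod>j\<in>J. indicator (A j) (x j)) * (\<Prod>i\<in>K. 1 + cos (a i * x i + t i))" for J A a t K x
  have G_nonneg: "0 \<le> G J A a t K x" for J A a t K x
    unfolding G_def by (auto intro!: mult_nonneg_nonneg prod_nonneg) (metis cos_ge_minus_one neg_le_iff_le le_add_same_cancel1 add.commute diff_ge_0_iff_ge minus_le_iff diff_minus_eq_add)
  have G_le: "G J A a t K x \<le> 2 ^ card K" for J A a t K x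
  proof -
    have "(\<Prod>j\<in>J. indicator (A j) (x j)) \<le> (1::real)"
      by (rule prod_le_1) (auto simp: indicator_def)
    moreover have "(\<Prod>i\<in>K. 1 + cos (a i * x i + t i)) \<le> (\<Prod>i\<in>K. 2)"
      by (rule prod_mono) (smt (verit) cos_ge_minus_one cos_le_one)
    moreover have "0 \<le> (\<Prod>i\<in>K. 1 + cos (a i * x i + t i))"
      by (rule prod_nonneg) (smt (verit) cos_ge_minus_one)
    ultimately have "G J A a t K x \<le> 1 * 2 ^ card K"
      unfolding G_def by (intro mult_mono) (auto simp: prod_nonneg)
    then show ?thesis by simp
  qed
  have G_meas: "G J A a t K \<in> borel_measurable (\<Pi>\<^sub>M i\<in>I. borel)" if "J \<subseteq> I" "K \<subseteq> I" "\<And>j. A j \<in> sets borel" for J A a t K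
    unfolding G_def using that by (auto intro!: borel_measurable_times borel_measurable_prod borel_measurable_add
      measurable_compose[OF measurable_component_singleton] borel_measurable_indicator)
  have main: "(\<integral>x. G J A a t (I - J) x \<partial>\<mu>) = (\<integral>x. G J A a t (I - J) x \<partial>\<nu>)"
    if "J \<subseteq> I" "\<And>j. A j \<in> sets borel" for J A a t
    using finite_subset[OF that(1) fin] that(1)
  proof (induction J arbitrary: a t rule: finite_induct)
    case empty
    \<comment> \<open>Since \<open>1 + cos y = 1 + cis y / 2 + cis (- y) / 2\<close>, the product is
      a finite combination of characters, indexed by functions \<open>g\<close> with values in
      \<open>{-1, 0, 1}\<close>.\<close>
    define c :: "int \<Rightarrow> complex" where "c s = (if s = 0 then 1 else 1/2)" for s
    define S :: "int set" where "S = {-1,0,1}"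
    define d where "d g = (\<Prod>i\<in>I. c (g i) * cis (of_int (g i) * t i))" for g
    have exp: "complex_of_real (G {} A a t I x) = (\<Sum>g\<in>PiE I (\<lambda>_. S). d g * cis (\<Sum>i\<in>I. (of_int (g i) * a i) * x i))" for x
    proof -
      have "complex_of_real (1 + cos y) = (\<Sum>s\<in>S. c s * cis (of_int s * y))" for y
        by (simp add: S_def c_def complex_eq_iff)
      then have "complex_of_real (G {} A a t I x) = (\<Prod>i\<in>I. \<Sum>s\<in>S. c s * cis (of_int s * (a i * x i + t i)))"
        by (simp add: G_def)
      also have "\<dots> = (\<Sum>g\<in>PiE I (\<lambda>_. S). \<Prod>i\<in>I. c (g i) * cis (of_int (g i) * (a i * x i + t i)))"
        by (rule prod_sum_PiE) (auto simp: fin S_def)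
      also have "\<dots> = (\<Sum>g\<in>PiE I (\<lambda>_. S). d g * cis (\<Sum>i\<in>I. (of_int (g i) * a i) * x i))"
        by (simp add: d_def cis_sum[OF fin] prod.distrib[symmetric] cis_mult algebra_simps)
      finally show ?thesis .
    qed
    have *: "integrable M (\<lambda>x. cis (\<Sum>i\<in>I. b i * x i))" if "prob_space M" "sets M = sets (\<Pi>\<^sub>M i\<in>I. borel)" for M b
    proof -
      interpret prob_space M by fact
      have [measurable_cong]: "sets M = sets (\<Pi>\<^sub>M i\<in>I. borel)" by fact
      have "(\<lambda>x. cis (\<Sum>i\<in>I. b i * x i)) \<in> borel_measurable M"
        by (intro borel_measurable_cis[THEN measurable_compose[rotated]] borel_measurable_sum) measurable
      then show ?thesis by (intro integrable_const_bound[where B=1]) auto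
    qed
    have "complex_of_real (\<integral>x. G {} A a t I x \<partial>\<mu>) = complex_of_real (\<integral>x. G {} A a t I x \<partial>\<nu>)"
      unfolding integral_complex_of_real[symmetric] exp
      by (subst (1 2) Bochner_Integration.integral_sum) (auto simp: * assms eq)
    then show ?case by simp
  next
    case (insert j J)
    define K where "K = I - insert j J"
    have K: "I - J = insert j K" "j \<notin> K" "finite K" "K \<subseteq> I" using insert fin by (auto simp: K_def)
    have j: "j \<in> I" and J: "J \<subseteq> I" using insert by auto
    define F where "F = G J A a t K"
    have F[measurable]: "F \<in> borel_measurable (\<Pi>\<^sub>M i\<in>I. borel)" unfolding F_def by (rule G_meas) (use J K that in auto)
    have F0: "0 \<le> F x" and F1: "F x \<le> 2 ^ card K" for x unfolding F_def by (rule G_nonneg G_le)+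
    have pj[measurable]: "(\<lambda>x. x j) \<in> borel_measurable (\<Pi>\<^sub>M i\<in>I. borel)"
      using j by simp
    \<comment> \<open>The product \<open>F\<close> of all other factors enters as a density;
      \<open>D M\<close> is the resulting one-dimensional measure in the coordinate
      \<open>j\<close>. The induction hypothesis tests it against \<open>1 + cos\<close>, and
      equality is then used on the indicator of \<open>A j\<close>.\<close>
    define D where "D M = distr (density M (\<lambda>x. ennreal (F x))) borel (\<lambda>x. x j)" for M
    have intD: "(\<integral>y. f y \<partial>D M) = (\<integral>x. F x * f (x j) \<partial>M)"
      if [measurable_cong]: "sets M = sets (\<Pi>\<^sub>M i\<in>I. borel)" and [measurable]: "f \<in> borel_measurable borel" for M and f :: "real \<Rightarrow> real"
      unfolding D_def by (subst integral_distr) (auto simp: integral_density F0)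
    have finD: "finite_measure (D M)" if "prob_space M" and [measurable_cong]: "sets M = sets (\<Pi>\<^sub>M i\<in>I. borel)" for M
    proof
      interpret prob_space M by fact
      have sp: "space M = space (\<Pi>\<^sub>M i\<in>I. borel)" using that(2) by (rule sets_eq_imp_space_eq)
      have "emeasure (D M) (space (D M)) = (\<integral>\<^sup>+x. ennreal (F x) \<partial>M)"
        unfolding D_def by (simp add: emeasure_distr emeasure_density cong: nn_integral_cong)
      also have "\<dots> \<le> (\<integral>\<^sup>+x. ennreal (2 ^ card K) \<partial>M)" by (intro nn_integral_mono ennreal_leI F1)
      also have "\<dots> < \<infinity>" by (simp add: emeasure_space_1)
      finally show "emeasure (D M) (space (D M)) \<noteq> \<infinity>" by simp
    qed
    have "D \<mu> = D \<nu>"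
    proof (rule finite_measure_eqI_cos)
      fix b s
      define a' t' where "a' = a(j := b)" and "t' = t(j := s)"
      have "F x * (1 + cos (b * x j + s)) = G J A a' t' (I - J) x" for x
        unfolding K F_def G_def a'_def t'_def using K by (subst prod.insert) (auto intro!: prod.cong)
      then show "(\<integral>x. 1 + cos (b * x + s) \<partial>D \<mu>) = (\<integral>x. 1 + cos (b * x + s) \<partial>D \<nu>)"
        by (simp add: intD insert.IH[OF J])
      show "finite_measure (D \<mu>)" "finite_measure (D \<nu>)" using finD[OF \<open>prob_space \<mu>\<close> s\<mu>] finD[OF \<open>prob_space \<nu>\<close> s\<nu>] by simp_all
    qed (simp_all add: D_def)
    moreover have "G (insert j J) A a t (I - insert j J) x = F x * indicator (A j) (x j)" for x
      using insert by (simp add: G_def F_def K_def)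
    ultimately show ?case
      using intD[of \<mu> "indicator (A j)"] intD[of \<nu> "indicator (A j)"] that(2)[of j] by simp
  qed
  show ?thesis
  proof (rule measure_eqI_PiM_finite[where I=I and M="\<lambda>_. borel" and A="\<lambda>_. \<Pi>\<^sub>E i\<in>I. UNIV"])
    fix A :: "'i \<Rightarrow> real set" assume A: "\<And>i. i \<in> I \<Longrightarrow> A i \<in> sets borel"
    define A' where "A' i = (if i \<in> I then A i else {})" for i
    have *: "G I A' undefined undefined (I - I) x = indicator (Pi\<^sub>E I A) x" if "x \<in> space (\<Pi>\<^sub>M i\<in>I. borel)" for x
    proof -
      have "G I A' undefined undefined (I - I) x = (\<Prod>j\<in>I. indicator (A j) (x j))"
        by (simp add: G_def A'_def)
      also have "\<dots> = indicator (Pi\<^sub>E I A) x"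
        using that fin by (auto simp: indicator_def space_PiM PiE_iff split: if_splits)
      finally show ?thesis .
    qed
    have mE: "Pi\<^sub>E I A \<in> sets (\<Pi>\<^sub>M i\<in>I. borel)" using A fin by (intro sets_PiM_I_finite) auto
    have sp: "space \<mu> = space (\<Pi>\<^sub>M i\<in>I. borel)" "space \<nu> = space (\<Pi>\<^sub>M i\<in>I. borel)" using sets_eq_imp_space_eq[OF s\<mu>] sets_eq_imp_space_eq[OF s\<nu>] by auto
    have "(\<integral>x. indicator (Pi\<^sub>E I A) x \<partial>\<mu>) = (\<integral>x. indicator (Pi\<^sub>E I A) x \<partial>\<nu> :: real)"
    proof -
      have "(\<integral>x. G I A' undefined undefined (I - I) x \<partial>\<mu>) = (\<integral>x. G I A' undefined undefined (I - I) x \<partial>\<nu>)"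
        using A by (intro main) (auto simp: A'_def)
      also have "(\<integral>x. G I A' undefined undefined (I - I) x \<partial>\<mu>) = (\<integral>x. indicator (Pi\<^sub>E I A) x \<partial>\<mu>)"
        using * sp by (intro Bochner_Integration.integral_cong) auto
      also have "(\<integral>x. G I A' undefined undefined (I - I) x \<partial>\<nu>) = (\<integral>x. indicator (Pi\<^sub>E I A) x \<partial>\<nu>)"
        using * sp by (intro Bochner_Integration.integral_cong) auto
      finally show ?thesis .
    qed
    then have "measure \<mu> (Pi\<^sub>E I A) = measure \<nu> (Pi\<^sub>E I A)"
      using mE by (simp add: sets.Int_space_eq2)
    then show "emeasure \<mu> (Pi\<^sub>E I A) = emeasure \<nu> (Pi\<^sub>E I A)"
      by (simp add: \<mu>.emeasure_eq_measure \<nu>.emeasure_eq_measure)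
  qed (use fin in \<open>auto intro!: prod_algebraI_finite simp: space_PiM\<close>)
qed

section \<open>Centred Gaussian variables: moments and laws\<close>

lemma centered_gaussian_cong_AE:
  assumes "centered_gaussian M Z" "AE \<omega> in M. Z' \<omega> = Z \<omega>" and [measurable]: "Z' \<in> borel_measurable M"
  shows "centered_gaussian M Z'"
proof -
  have [measurable]: "Z \<in> borel_measurable M" using assms(1) by (simp add: centered_gaussian_def)
  have "distr M lborel Z' = distr M lborel Z"
    using assms(2) by (intro distr_cong_AE) auto
  moreover have "(AE \<omega> in M. Z \<omega> = 0) \<longleftrightarrow> (AE \<omega> in M. Z' \<omega> = 0)"
    using assms(2) by (auto elim: AE_mp)
  ultimately show ?thesis
    using assms(1) by (auto simp: centered_gaussian_def distributed_def)
qed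

text \<open>The double factorial (2k-1)!!, the moment of order 2k of the standard normal
  law.\<close>

definition gaussian_moment_const :: "nat \<Rightarrow> real" where
  "gaussian_moment_const k = fact (2 * k) / (2 ^ k * fact k)"

lemma gaussian_moment_const_pos: "0 < gaussian_moment_const k"
  by (simp add: gaussian_moment_const_def)

context prob_space begin

lemma centered_gaussian_moment:
  assumes "centered_gaussian M Z"
  shows "integrable M (\<lambda>\<omega>. Z \<omega> ^ (2 * k))"
    and "expectation (\<lambda>\<omega>. Z \<omega> ^ (2 * k)) = gaussian_moment_const k * (expectation (\<lambda>\<omega>. (Z \<omega>)\<^sup>2)) ^ k"
proof -
  have [measurable]: "Z \<in> borel_measurable M" using assms by (simp add: centered_gaussian_def)
  have "integrable M (\<lambda>\<omega>. Z \<omega> ^ (2 * k)) \<and>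
    expectation (\<lambda>\<omega>. Z \<omega> ^ (2 * k)) = gaussian_moment_const k * (expectation (\<lambda>\<omega>. (Z \<omega>)\<^sup>2)) ^ k"
  proof (cases "AE \<omega> in M. Z \<omega> = 0")
    case True
    have *: "AE \<omega> in M. Z \<omega> ^ n = 0 ^ n" for n using True by auto
    have "expectation (\<lambda>\<omega>. Z \<omega> ^ n) = 0 ^ n" for n
      using integral_cong_AE[OF _ _ *[of n]] by (simp add: prob_space)
    moreover have "integrable M (\<lambda>\<omega>. Z \<omega> ^ n)" for n
      using integrable_cong_AE[OF _ _ *[of n]] by simp
    ultimately show ?thesis
      by (cases k) (auto simp: gaussian_moment_const_def prob_space simp del: power_Suc)
  next
    case False
    then obtain \<sigma> where \<sigma>: "\<sigma> > 0" and D: "distributed M lborel Z (normal_density 0 \<sigma>)"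
      using assms by (auto simp: centered_gaussian_def)
    have I: "integrable M (\<lambda>\<omega>. Z \<omega> ^ (2 * j))" for j
      using distributed_integrable[OF D, of "\<lambda>x. x ^ (2 * j)"] integrable.intros[OF normal_moment_even[OF \<sigma>, of 0 j]] by auto
    have E: "expectation (\<lambda>\<omega>. Z \<omega> ^ (2 * j)) = gaussian_moment_const j * (\<sigma>\<^sup>2) ^ j" for j
      using distributed_integral[OF D, of "\<lambda>x. x ^ (2 * j)"] integral_normal_moment_even[OF \<sigma>, of 0 j] \<sigma>
      by (auto simp: gaussian_moment_const_def field_simps power_divide)
    \<comment> \<open>The instance \<open>E[of 1]\<close> identifies \<open>\<sigma>\<^sup>2\<close>
      with the second moment.\<close>
    show ?thesis using I[of k] E[of k] E[of 1] by (simp add: gaussian_moment_const_def)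
  qed
  then show "integrable M (\<lambda>\<omega>. Z \<omega> ^ (2 * k))"
    and "expectation (\<lambda>\<omega>. Z \<omega> ^ (2 * k)) = gaussian_moment_const k * (expectation (\<lambda>\<omega>. (Z \<omega>)\<^sup>2)) ^ k" by auto
qed

lemma centered_gaussian_square_integrable:
  "centered_gaussian M Z \<Longrightarrow> integrable M (\<lambda>\<omega>. (Z \<omega>)\<^sup>2)"
  using centered_gaussian_moment(1)[of Z 1] by simp

text \<open>The second moment is 0 exactly in the degenerate alternative of
  \<open>centered_gaussian\<close>, and in the other one it determines \<sigma>.\<close>

lemma centered_gaussian_distr_eq:
  assumes Z: "centered_gaussian M Z" "centered_gaussian M Z'"
    and eq: "expectation (\<lambda>\<omega>. (Z \<omega>)\<^sup>2) = expectation (\<lambda>\<omega>. (Z' \<omega>)\<^sup>2)"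
  shows "distr M borel Z = distr M borel Z'"
proof -
  have *: "(expectation (\<lambda>\<omega>. (V \<omega>)\<^sup>2) = 0 \<and> distr M borel V = distr M borel (\<lambda>_. 0)) \<or>
       (\<exists>\<sigma>>0. expectation (\<lambda>\<omega>. (V \<omega>)\<^sup>2) = \<sigma>\<^sup>2 \<and> distr M borel V = density lborel (normal_density 0 \<sigma>))"
    if V: "centered_gaussian M V" for V
  proof (cases "AE \<omega> in M. V \<omega> = 0")
    case True
    have [measurable]: "V \<in> borel_measurable M" using V by (simp add: centered_gaussian_def)
    have "AE \<omega> in M. (V \<omega>)\<^sup>2 = 0" using True by auto
    then have "expectation (\<lambda>\<omega>. (V \<omega>)\<^sup>2) = 0" using integral_cong_AE[of "\<lambda>\<omega>. (V \<omega>)\<^sup>2" M "\<lambda>_. 0"] by simp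
    moreover have "distr M borel V = distr M borel (\<lambda>_. 0)"
      using True by (intro distr_cong_AE) auto
    ultimately show ?thesis by auto
  next
    case False
    then obtain \<sigma> where \<sigma>: "\<sigma> > 0" and D: "distributed M lborel V (normal_density 0 \<sigma>)"
      using V by (auto simp: centered_gaussian_def)
    have "expectation (\<lambda>\<omega>. (V \<omega>)\<^sup>2) = \<sigma>\<^sup>2"
      using normal_distributed_variance[OF \<sigma> D] normal_distributed_expectation[OF \<sigma> D] by simp
    moreover have "distr M borel V = density lborel (normal_density 0 \<sigma>)"
      using distributed_distr_eq_density[OF D] by (metis distr_cong sets_lborel)
    ultimately show ?thesis using \<sigma> by auto
  qed
  have "\<sigma> = \<tau>" if "\<sigma>\<^sup>2 = \<tau>\<^sup>2" "\<sigma> > 0" "\<tau> > 0" for \<sigma> \<tau> :: real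
    using that by (simp add: power2_eq_iff)
  then show ?thesis using *[OF Z(1)] *[OF Z(2)] eq by fastforce
qed

end

section \<open>The noise as an isometry on Hermitian kernels\<close>

definition noise_ip :: "(plane \<Rightarrow> complex) \<Rightarrow> (plane \<Rightarrow> complex) \<Rightarrow> real" where
  "noise_ip f g = (\<integral>\<xi>. Re (f \<xi> * cnj (g \<xi>)) \<partial>lborel)"

text \<open>By \<open>variance_diff\<close> this is the variance of \<open>W f - W g\<close>; every
  estimate on the fields passes through it.\<close>

definition sqdist :: "(plane \<Rightarrow> complex) \<Rightarrow> (plane \<Rightarrow> complex) \<Rightarrow> real" where
  "sqdist f g = (\<integral>\<xi>. (cmod (f \<xi> - g \<xi>))\<^sup>2 \<partial>lborel)"

lemma hermitian_L2_measurable: "g \<in> hermitian_L2 \<Longrightarrow> g \<in> borel_measurable borel"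
  by (simp add: hermitian_L2_def)

lemma hermitian_L2_integrable_mult:
  assumes "f \<in> hermitian_L2" "g \<in> hermitian_L2"
  shows "integrable lborel (\<lambda>\<xi>. f \<xi> * cnj (g \<xi>))"
proof (rule Bochner_Integration.integrable_bound)
  have [measurable]: "f \<in> borel_measurable borel" "g \<in> borel_measurable borel"
    using assms by (auto intro: hermitian_L2_measurable)
  show "integrable lborel (\<lambda>\<xi>. (cmod (f \<xi>))\<^sup>2 + (cmod (g \<xi>))\<^sup>2)"
    using assms by (auto simp: hermitian_L2_def)
  have "cmod a * cmod b \<le> (cmod a)\<^sup>2 + (cmod b)\<^sup>2" for a b
    using sum_squares_bound[of "cmod a" "cmod b"] mult_nonneg_nonneg[OF norm_ge_zero[of a] norm_ge_zero[of b]] by linarith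
  then show "AE \<xi> in lborel. norm (f \<xi> * cnj (g \<xi>)) \<le> norm ((cmod (f \<xi>))\<^sup>2 + (cmod (g \<xi>))\<^sup>2)"
    by (intro always_eventually) (auto simp: norm_mult)
  have "cnj \<in> borel_measurable borel" by (intro borel_measurable_continuous_onI continuous_intros)
  then show "(\<lambda>\<xi>. f \<xi> * cnj (g \<xi>)) \<in> borel_measurable lborel" by measurable
qed

text \<open>Real coefficients are essential: complex ones would destroy the Hermitian
  symmetry.\<close>

lemma hermitian_L2_lincomb:
  assumes "f \<in> hermitian_L2" "g \<in> hermitian_L2"
  shows "(\<lambda>\<xi>. complex_of_real c * f \<xi> + complex_of_real d * g \<xi>) \<in> hermitian_L2"
proof -
  have [measurable]: "f \<in> borel_measurable borel" "g \<in> borel_measurable borel"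
    using assms by (auto intro: hermitian_L2_measurable)
  have "integrable lborel (\<lambda>\<xi>. (cmod (complex_of_real c * f \<xi> + complex_of_real d * g \<xi>))\<^sup>2)"
  proof (rule Bochner_Integration.integrable_bound)
    show "integrable lborel (\<lambda>\<xi>. 2 * c\<^sup>2 * (cmod (f \<xi>))\<^sup>2 + 2 * d\<^sup>2 * (cmod (g \<xi>))\<^sup>2)"
      using assms by (auto simp: hermitian_L2_def)
    have "(cmod (complex_of_real c * a + complex_of_real d * b))\<^sup>2 \<le> 2 * c\<^sup>2 * (cmod a)\<^sup>2 + 2 * d\<^sup>2 * (cmod b)\<^sup>2" for a b
    proof -
      have "cmod (complex_of_real c * a + complex_of_real d * b) \<le> \<bar>c\<bar> * cmod a + \<bar>d\<bar> * cmod b"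
        by (rule norm_triangle_le) (simp add: norm_mult)
      then have "(cmod (complex_of_real c * a + complex_of_real d * b))\<^sup>2 \<le> (\<bar>c\<bar> * cmod a + \<bar>d\<bar> * cmod b)\<^sup>2"
        by (intro power_mono) auto
      also have "\<dots> \<le> 2 * (\<bar>c\<bar> * cmod a)\<^sup>2 + 2 * (\<bar>d\<bar> * cmod b)\<^sup>2"
        using sum_squares_bound[of "\<bar>c\<bar> * cmod a" "\<bar>d\<bar> * cmod b"] by (simp add: power2_sum)
      finally show ?thesis by (simp add: power_mult_distrib)
    qed
    then show "AE \<xi> in lborel. norm ((cmod (complex_of_real c * f \<xi> + complex_of_real d * g \<xi>))\<^sup>2)
       \<le> norm (2 * c\<^sup>2 * (cmod (f \<xi>))\<^sup>2 + 2 * d\<^sup>2 * (cmod (g \<xi>))\<^sup>2)"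
      by (intro always_eventually) (auto simp: abs_of_nonneg)
  qed measurable
  then show ?thesis using assms by (auto simp: hermitian_L2_def)
qed

locale white_noise = prob_space M for M :: "'a measure" +
  fixes W :: "(plane \<Rightarrow> complex) \<Rightarrow> 'a \<Rightarrow> real"
  assumes noise: "complex_white_noise M W"
begin

text \<open>Joint Gaussianity is stated for finite sets of kernels, whereas \<open>g\<close> may
  take one value at several indices; the coefficients of equal kernels are added up first.\<close>

lemma gaussian_sum:
  assumes I: "finite I" and g: "\<And>i. i \<in> I \<Longrightarrow> g i \<in> hermitian_L2"
  shows "centered_gaussian M (\<lambda>\<omega>. \<Sum>i\<in>I. c i * W (g i) \<omega>)"
proof -
  have "(\<Sum>i\<in>I. c i * W (g i) \<omega>) = (\<Sum>f\<in>g ` I. (\<Sum>i\<in>{i\<in>I. g i = f}. c i) * W f \<omega>)" for \<omega>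
    by (subst sum.image_gen[OF I, of _ g]) (auto simp: sum_distrib_right intro!: sum.cong)
  then show ?thesis
    using noise I g unfolding complex_white_noise_def jointly_centered_gaussian_def
    by (auto simp: image_subset_iff)
qed

lemma gaussian_W: "g \<in> hermitian_L2 \<Longrightarrow> centered_gaussian M (W g)"
  using gaussian_sum[of "{()}" "\<lambda>_. g" "\<lambda>_. 1"] by simp

lemma measurable_W: "g \<in> hermitian_L2 \<Longrightarrow> W g \<in> borel_measurable M"
  using gaussian_W by (auto simp: centered_gaussian_def)

lemma gaussian_W_diff:
  assumes "f \<in> hermitian_L2" "g \<in> hermitian_L2"
  shows "centered_gaussian M (\<lambda>\<omega>. W f \<omega> - W g \<omega>)"
  using gaussian_sum[of "{True, False}" "\<lambda>b. if b then f else g" "\<lambda>b. if b then 1 else -1"] assms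
  by simp

lemma integrable_W_mult:
  assumes "f \<in> hermitian_L2" "g \<in> hermitian_L2"
  shows "integrable M (\<lambda>\<omega>. W f \<omega> * W g \<omega>)"
proof (rule Bochner_Integration.integrable_bound)
  show "integrable M (\<lambda>\<omega>. (W f \<omega>)\<^sup>2 + (W g \<omega>)\<^sup>2)"
    using assms by (intro Bochner_Integration.integrable_add centered_gaussian_square_integrable gaussian_W)
  have "\<bar>x\<bar> * \<bar>y\<bar> \<le> x\<^sup>2 + y\<^sup>2" for x y :: real
    using sum_squares_bound[of "\<bar>x\<bar>" "\<bar>y\<bar>"] mult_nonneg_nonneg[OF abs_ge_zero[of x] abs_ge_zero[of y]]
    unfolding power2_abs by linarith
  then show "AE \<omega> in M. norm (W f \<omega> * W g \<omega>) \<le> norm ((W f \<omega>)\<^sup>2 + (W g \<omega>)\<^sup>2)"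
    by (intro always_eventually) (auto simp: abs_mult)
qed (use measurable_W assms in auto)

text \<open>For Hermitian kernels the points \<xi> and -\<xi> contribute conjugate values, so the
  complex inner product is already real and the \<open>Re\<close> in \<open>noise_ip\<close> loses
  nothing.\<close>

lemma covariance:
  assumes "f \<in> hermitian_L2" "g \<in> hermitian_L2"
  shows "expectation (\<lambda>\<omega>. W f \<omega> * W g \<omega>) = noise_ip f g"
proof -
  have "complex_of_real (expectation (\<lambda>\<omega>. W f \<omega> * W g \<omega>)) = (\<integral>\<xi>. f \<xi> * cnj (g \<xi>) \<partial>lborel)"
    using noise assms by (auto simp: complex_white_noise_def)
  then have "expectation (\<lambda>\<omega>. W f \<omega> * W g \<omega>) = Re (\<integral>\<xi>. f \<xi> * cnj (g \<xi>) \<partial>lborel)"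
    by (metis Re_complex_of_real)
  also have "\<dots> = noise_ip f g"
    unfolding noise_ip_def by (rule integral_Re[symmetric] ) (rule hermitian_L2_integrable_mult[OF assms])
  finally show ?thesis .
qed

lemma variance_sum:
  assumes I: "finite I" and g: "\<And>i. i \<in> I \<Longrightarrow> g i \<in> hermitian_L2"
  shows "expectation (\<lambda>\<omega>. (\<Sum>i\<in>I. c i * W (g i) \<omega>)\<^sup>2) = (\<Sum>i\<in>I. \<Sum>j\<in>I. c i * c j * noise_ip (g i) (g j))"
proof -
  have "(\<Sum>i\<in>I. c i * W (g i) \<omega>)\<^sup>2 = (\<Sum>i\<in>I. \<Sum>j\<in>I. c i * c j * (W (g i) \<omega> * W (g j) \<omega>))" for \<omega>
    by (simp add: power2_eq_square sum_product ac_simps)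
  then show ?thesis
    using g by (simp add: Bochner_Integration.integral_sum integrable_W_mult covariance)
qed

lemma variance_diff:
  assumes fg: "f \<in> hermitian_L2" "g \<in> hermitian_L2"
  shows "expectation (\<lambda>\<omega>. (W f \<omega> - W g \<omega>)\<^sup>2) = sqdist f g"
proof -
  have "expectation (\<lambda>\<omega>. (W f \<omega> - W g \<omega>)\<^sup>2) = noise_ip f f - noise_ip f g - noise_ip g f + noise_ip g g"
    using variance_sum[of "{True, False}" "\<lambda>b. if b then f else g" "\<lambda>b. if b then 1 else -1"] fg by simp
  also have "\<dots> = (\<integral>\<xi>. Re (f \<xi> * cnj (f \<xi>)) - Re (f \<xi> * cnj (g \<xi>)) - Re (g \<xi> * cnj (f \<xi>)) + Re (g \<xi> * cnj (g \<xi>)) \<partial>lborel)"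
    unfolding noise_ip_def
    by (subst Bochner_Integration.integral_add Bochner_Integration.integral_diff;
       (intro Bochner_Integration.integrable_diff integrable_Re hermitian_L2_integrable_mult fg)?)+ simp
  also have "\<dots> = sqdist f g"
    unfolding sqdist_def by (intro Bochner_Integration.integral_cong refl) (simp add: cmod_power2, simp add: power2_eq_square algebra_simps)
  finally show ?thesis .
qed

text \<open>The noise is given only by its Gaussian law and covariance, so linearity has to be
  recovered: the difference of the two sides has variance 0, by bilinearity of
  \<open>noise_ip\<close>.\<close>

lemma W_lincomb:
  assumes fg: "f \<in> hermitian_L2" "g \<in> hermitian_L2"
  shows "AE \<omega> in M. W (\<lambda>\<xi>. complex_of_real c * f \<xi> + complex_of_real d * g \<xi>) \<omega> = c * W f \<omega> + d * W g \<omega>"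
proof -
  define k where "k = (\<lambda>\<xi>. complex_of_real c * f \<xi> + complex_of_real d * g \<xi>)"
  have k: "k \<in> hermitian_L2" unfolding k_def by (rule hermitian_L2_lincomb[OF fg])
  define G where "G i = (if i = 0 then k else if i = 1 then f else g)" for i :: nat
  define C where "C i = (if i = 0 then -1 else if i = 1 then c else d)" for i :: nat
  have G: "G i \<in> hermitian_L2" for i using k fg by (auto simp: G_def)
  have ip: "noise_ip k e = c * noise_ip f e + d * noise_ip g e" "noise_ip e k = c * noise_ip e f + d * noise_ip e g"
    if "e \<in> hermitian_L2" for e
  proof -
    have "Re (k \<xi> * cnj (e \<xi>)) = c * Re (f \<xi> * cnj (e \<xi>)) + d * Re (g \<xi> * cnj (e \<xi>))"
       "Re (e \<xi> * cnj (k \<xi>)) = c * Re (e \<xi> * cnj (f \<xi>)) + d * Re (e \<xi> * cnj (g \<xi>))" for \<xi>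
      by (auto simp: k_def algebra_simps)
    moreover have "integrable lborel (\<lambda>\<xi>. Re (p \<xi> * cnj (q \<xi>)))" if "p \<in> hermitian_L2" "q \<in> hermitian_L2" for p q
      using that by (intro integrable_Re hermitian_L2_integrable_mult)
    ultimately show "noise_ip k e = c * noise_ip f e + d * noise_ip g e" "noise_ip e k = c * noise_ip e f + d * noise_ip e g"
      unfolding noise_ip_def using fg that by (simp_all only: Bochner_Integration.integral_add integral_mult_right_zero Bochner_Integration.integrable_mult_right)
  qed
  have "expectation (\<lambda>\<omega>. (\<Sum>i\<in>{..<3}. C i * W (G i) \<omega>)\<^sup>2) = 0"
    using G by (subst variance_sum) (simp_all add: numeral_3_eq_3 C_def G_def ip[OF k] ip[OF fg(1)] ip[OF fg(2)], simp add: algebra_simps)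
  moreover have "integrable M (\<lambda>\<omega>. (\<Sum>i\<in>{..<3}. C i * W (G i) \<omega>)\<^sup>2)"
    by (intro centered_gaussian_square_integrable gaussian_sum G) auto
  ultimately have "AE \<omega> in M. (\<Sum>i\<in>{..<3}. C i * W (G i) \<omega>)\<^sup>2 = 0"
    by (subst (asm) integral_nonneg_eq_0_iff_AE) auto
  then show ?thesis
    by (auto simp: numeral_3_eq_3 C_def G_def k_def elim!: AE_mp)
qed

text \<open>The Cramer-Wold argument: a linear combination of values is a centred Gaussian whose
  variance depends only on \<open>noise_ip\<close>, and the characteristic functions of these
  combinations determine the joint law. The fields match the kernels only almost surely at each
  point, which is what versions provide.\<close>

lemma noise_same_fdd:
  assumes g: "\<And>x. g x \<in> hermitian_L2" "\<And>x. g' x \<in> hermitian_L2"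
    and ip: "\<And>x y. noise_ip (g x) (g y) = noise_ip (g' x) (g' y)"
    and Z: "\<And>x. AE \<omega> in M. Z x \<omega> = W (g x) \<omega>" "\<And>x. AE \<omega> in M. Z' x \<omega> = W (g' x) \<omega>"
    and m: "\<And>x. Z x \<in> borel_measurable M" "\<And>x. Z' x \<in> borel_measurable M"
  shows "same_fdd M Z M Z'"
  unfolding same_fdd_def
proof (intro allI impI)
  fix I :: "plane set" assume I: "finite I"
  have [measurable]: "(\<lambda>\<omega>. \<lambda>x\<in>I. Z x \<omega>) \<in> measurable M (\<Pi>\<^sub>M i\<in>I. borel)" "(\<lambda>\<omega>. \<lambda>x\<in>I. Z' x \<omega>) \<in> measurable M (\<Pi>\<^sub>M i\<in>I. borel)"
    by (intro measurable_restrict m)+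
  show "distr M (\<Pi>\<^sub>M x\<in>I. borel) (\<lambda>\<omega>. \<lambda>x\<in>I. Z x \<omega>) = distr M (\<Pi>\<^sub>M x\<in>I. borel) (\<lambda>\<omega>. \<lambda>x\<in>I. Z' x \<omega>)"
  proof (rule measure_eqI_PiM_char[OF I])
    fix a
    have meas: "(\<lambda>x. cis (\<Sum>i\<in>I. a i * x i)) \<in> borel_measurable (\<Pi>\<^sub>M i\<in>I. borel)"
      by (intro borel_measurable_cis[THEN measurable_compose[rotated]] borel_measurable_sum) measurable
    have "(\<integral>x. cis (\<Sum>i\<in>I. a i * x i) \<partial>distr M (\<Pi>\<^sub>M x\<in>I. borel) (\<lambda>\<omega>. \<lambda>x\<in>I. V x \<omega>)) =
        (\<integral>y. cis y \<partial>distr M borel (\<lambda>\<omega>. \<Sum>i\<in>I. a i * W (k i) \<omega>))"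
      if V: "\<And>x. AE \<omega> in M. V x \<omega> = W (k x) \<omega>" "\<And>x. V x \<in> borel_measurable M" and k: "\<And>x. k x \<in> hermitian_L2" for V k
    proof -
      have [measurable]: "(\<lambda>\<omega>. \<lambda>x\<in>I. V x \<omega>) \<in> measurable M (\<Pi>\<^sub>M i\<in>I. borel)" by (intro measurable_restrict that)
      note [measurable] = V(2) measurable_W[OF k]
      have "AE \<omega> in M. \<forall>i\<in>I. V i \<omega> = W (k i) \<omega>"
        using I V by (intro AE_finite_allI) auto
      then have "AE \<omega> in M. cis (\<Sum>i\<in>I. a i * V i \<omega>) = cis (\<Sum>i\<in>I. a i * W (k i) \<omega>)"
        by (rule AE_mp) (auto intro!: AE_I2 arg_cong[where f=cis] sum.cong)
      then have "expectation (\<lambda>\<omega>. cis (\<Sum>i\<in>I. a i * V i \<omega>)) = expectation (\<lambda>\<omega>. cis (\<Sum>i\<in>I. a i * W (k i) \<omega>))"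
        by (intro integral_cong_AE) auto
      then show ?thesis
        using meas by (simp add: integral_distr cong: sum.cong)
    qed
    note eq1 = this[of Z g, OF Z(1) m(1) g(1)] this[of Z' g', OF Z(2) m(2) g(2)]
    have eq2: "distr M borel (\<lambda>\<omega>. \<Sum>i\<in>I. a i * W (g i) \<omega>) = distr M borel (\<lambda>\<omega>. \<Sum>i\<in>I. a i * W (g' i) \<omega>)"
      by (intro centered_gaussian_distr_eq gaussian_sum) (auto simp: I g variance_sum ip)
    show "(\<integral>x. cis (\<Sum>i\<in>I. a i * x i) \<partial>distr M (\<Pi>\<^sub>M x\<in>I. borel) (\<lambda>\<omega>. \<lambda>x\<in>I. Z x \<omega>)) =
      (\<integral>x. cis (\<Sum>i\<in>I. a i * x i) \<partial>distr M (\<Pi>\<^sub>M x\<in>I. borel) (\<lambda>\<omega>. \<lambda>x\<in>I. Z' x \<omega>))"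
      using eq1 eq2 by simp
  qed (auto intro!: prob_space_distr)
qed

end

section \<open>Interpolation on dyadic grids and continuous versions\<close>

definition tent :: "real \<Rightarrow> real" where
  "tent t = max 0 (1 - \<bar>t\<bar>)"

text \<open>With spacing 2^-n these indices fill the square of half-side 2^n, so mesh and range
  improve together and one sequence of grids serves the whole plane.\<close>

definition grid_box :: "nat \<Rightarrow> (int \<times> int) set" where
  "grid_box n = {- (4 ^ n)..4 ^ n} \<times> {- (4 ^ n)..4 ^ n}"

definition grid_pt :: "nat \<Rightarrow> int \<times> int \<Rightarrow> plane" where
  "grid_pt n a = vector [of_int (fst a) / 2 ^ n, of_int (snd a) / 2 ^ n]"

text \<open>The nodal functions of bilinear interpolation. By \<open>sum_grid_wt\<close> they add up
  to 1 on the open ball of radius 2^n, where the interpolated value is therefore a convex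
  combination of grid values.\<close>

definition grid_wt :: "nat \<Rightarrow> int \<times> int \<Rightarrow> plane \<Rightarrow> real" where
  "grid_wt n a x = tent (2 ^ n * x $ 1 - of_int (fst a)) * tent (2 ^ n * x $ 2 - of_int (snd a))"

definition interp :: "nat \<Rightarrow> (plane \<Rightarrow> real) \<Rightarrow> plane \<Rightarrow> real" where
  "interp n f x = (\<Sum>a\<in>grid_box n. f (grid_pt n a) * grid_wt n a x)"

lemma finite_grid_box [simp]: "finite (grid_box n)"
  by (simp add: grid_box_def)

lemma card_grid_box: "card (grid_box n) \<le> (4 ^ Suc n) ^ 2"
proof -
  have "card (grid_box n) = (2 * 4 ^ n + 1) ^ 2"
    by (simp add: grid_box_def card_cartesian_product power2_eq_square nat_add_distrib nat_mult_distrib nat_power_eq)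
  also have "\<dots> \<le> (4 ^ Suc n) ^ 2"
    using one_le_power[of "4::nat" n] by (intro power_mono) (auto simp del: one_le_power)
  finally show ?thesis .
qed

lemma sum_tent:
  assumes "\<bar>y\<bar> < of_int N"
  shows "(\<Sum>i\<in>{- N..N}. tent (y - of_int i)) = 1"
proof -
  define k where "k = \<lfloor>y\<rfloor>"
  have k: "of_int k \<le> y" "y < of_int k + 1" unfolding k_def by linarith+
  \<comment> \<open>The strict bound on \<open>y\<close> keeps \<open>k + 1\<close>, the upper of
    the two nodes around \<open>y\<close>, inside the range.\<close>
  have kN: "k \<in> {- N..N}" "k + 1 \<in> {- N..N}" using assms unfolding k_def by (auto simp: le_floor_iff floor_less_iff) linarith+
  have "(\<Sum>i\<in>{- N..N}. tent (y - of_int i)) = (\<Sum>i\<in>{k, k+1}. tent (y - of_int i))"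
  proof (rule sum.mono_neutral_right)
    show "\<forall>i\<in>{- N..N} - {k, k + 1}. tent (y - real_of_int i) = 0"
    proof
      fix i assume "i \<in> {- N..N} - {k, k + 1}"
      then have "i \<le> k - 1 \<or> i \<ge> k + 2" by auto
      then have "of_int i \<le> (of_int k - 1 :: real) \<or> of_int i \<ge> (of_int k + 2 :: real)" by linarith
      then show "tent (y - of_int i) = 0" using k by (auto simp: tent_def)
    qed
  qed (use kN in auto)
  also have "\<dots> = 1" using k by (simp add: tent_def)
  finally show ?thesis .
qed

lemma tent_nonneg [simp]: "0 \<le> tent t"
  by (simp add: tent_def)

lemma grid_wt_nonneg [simp]: "0 \<le> grid_wt n a x"
  by (simp add: grid_wt_def)

lemma sum_grid_wt:
  assumes "norm x < 2 ^ n"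
  shows "(\<Sum>a\<in>grid_box n. grid_wt n a x) = 1"
proof -
  have "\<bar>2 ^ n * x $ i\<bar> < of_int (4 ^ n)" for i
  proof -
    have "\<bar>2 ^ n * x $ i\<bar> = 2 ^ n * \<bar>x $ i\<bar>" by (simp add: abs_mult)
    also have "\<dots> < 2 ^ n * 2 ^ n" using component_le_norm_cart[of x i] assms by simp
    finally show ?thesis by (simp add: power_mult_distrib[symmetric])
  qed
  then have "(\<Sum>i\<in>{- (4 ^ n)..4 ^ n}. tent (2 ^ n * x $ k - of_int i)) = 1" for k
    by (intro sum_tent)
  moreover have "(\<Sum>a\<in>A \<times> A. F (fst a) * G (snd a)) = (\<Sum>i\<in>A. F i) * (\<Sum>j\<in>A. G j)" for A and F G :: "int \<Rightarrow> real"
    by (simp add: sum_product sum.cartesian_product case_prod_unfold)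
  moreover note this[where F="\<lambda>i. tent (2 ^ n * x $ 1 - of_int i)" and G="\<lambda>i. tent (2 ^ n * x $ 2 - of_int i)"]
  ultimately show ?thesis
    by (simp add: grid_box_def grid_wt_def)
qed

lemma norm_plane_le: "norm (x :: plane) \<le> \<bar>x $ 1\<bar> + \<bar>x $ 2\<bar>"
  using norm_le_l1_cart[of x] by (simp add: sum_2)

lemma grid_wt_near:
  assumes "grid_wt n a x \<noteq> 0"
  shows "norm (grid_pt n a - x) \<le> 2 / 2 ^ n"
proof -
  have "\<bar>2 ^ n * x $ 1 - of_int (fst a)\<bar> < 1" "\<bar>2 ^ n * x $ 2 - of_int (snd a)\<bar> < 1"
    using assms by (auto simp: grid_wt_def tent_def max_def split: if_splits)
  moreover have "grid_pt n a $ 1 - x $ 1 = - (2 ^ n * x $ 1 - of_int (fst a)) / 2 ^ n"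
     "grid_pt n a $ 2 - x $ 2 = - (2 ^ n * x $ 2 - of_int (snd a)) / 2 ^ n"
    by (auto simp: grid_pt_def field_simps)
  ultimately have "\<bar>grid_pt n a $ 1 - x $ 1\<bar> \<le> 1 / 2 ^ n" "\<bar>grid_pt n a $ 2 - x $ 2\<bar> \<le> 1 / 2 ^ n"
    by (simp_all only: abs_divide abs_minus_cancel) (auto simp: divide_right_mono)
  then show ?thesis
    using norm_plane_le[of "grid_pt n a - x"] by simp
qed

text \<open>A convex combination of values within \<open>D\<close> of \<open>c\<close> is within
  \<open>D\<close> of \<open>c\<close>, and only the nodes near \<open>x\<close> have nonzero
  weight.\<close>

lemma interp_near:
  assumes x: "norm x < 2 ^ n"
    and f: "\<And>a. a \<in> grid_box n \<Longrightarrow> norm (grid_pt n a - x) \<le> 2 / 2 ^ n \<Longrightarrow> \<bar>f (grid_pt n a) - c\<bar> \<le> D"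
  shows "\<bar>interp n f x - c\<bar> \<le> D"
proof -
  have "interp n f x - c = (\<Sum>a\<in>grid_box n. (f (grid_pt n a) - c) * grid_wt n a x)"
    by (simp add: interp_def left_diff_distrib sum_subtractf sum_distrib_left[symmetric] sum_grid_wt[OF x])
  also have "\<bar>\<dots>\<bar> \<le> (\<Sum>a\<in>grid_box n. D * grid_wt n a x)"
  proof (rule order_trans[OF sum_abs sum_mono])
    fix a assume "a \<in> grid_box n"
    then show "\<bar>(f (grid_pt n a) - c) * grid_wt n a x\<bar> \<le> D * grid_wt n a x"
      using f[of a] grid_wt_near[of n a x] by (cases "grid_wt n a x = 0") (auto simp: abs_mult intro!: mult_right_mono)
  qed
  also have "\<dots> = D" by (simp add: sum_distrib_left[symmetric] sum_grid_wt[OF x])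
  finally show ?thesis .
qed

lemma continuous_on_interp: "continuous_on S (interp n f)"
  unfolding interp_def grid_wt_def tent_def max_def[symmetric]
  by (intro continuous_intros)

lemma measurable_interp:
  assumes "\<And>u. Z u \<in> borel_measurable M"
  shows "(\<lambda>\<omega>. interp n (\<lambda>u. Z u \<omega>) x) \<in> borel_measurable M"
  unfolding interp_def by (intro borel_measurable_sum borel_measurable_times assms borel_measurable_const)

lemma nat_less_two_power: "real m < 2 ^ m"
  using less_exp[of m] by (metis of_nat_less_iff of_nat_numeral of_nat_power)

lemma uniform_limit_interp:
  assumes f: "continuous_on UNIV f"
  shows "uniform_limit (cball 0 (real m)) (\<lambda>n. interp n f) f sequentially"
proof (rule uniform_limitI)
  fix e :: real assume e: "e > 0"
  \<comment> \<open>The margin 2 leaves room for the nodes that influence the value at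
    \<open>x\<close>, which are at distance at most 2 / 2^n. The same margin appears in
    \<open>grid_pairs\<close>.\<close>
  have "uniformly_continuous_on (cball 0 (real m + 2)) f"
    by (intro compact_uniformly_continuous continuous_on_subset[OF f]) auto
  then obtain d where d: "d > 0" "\<And>x y. norm x \<le> real m + 2 \<Longrightarrow> norm y \<le> real m + 2 \<Longrightarrow> dist y x < d \<Longrightarrow> dist (f y) (f x) < e / 2"
    using e unfolding uniformly_continuous_on_def by (metis half_gt_zero mem_cball_0)
  have "(\<lambda>n. 2 / 2 ^ n :: real) \<longlonglongrightarrow> 0"
    using tendsto_mult[OF tendsto_const[of 2] LIMSEQ_power_zero[of "1/2 :: real"]] by (simp add: power_one_over)
  then have "\<forall>\<^sub>F n in sequentially. 2 / 2 ^ n < d"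
    using d(1) order_tendstoD(2) by blast
  then show "\<forall>\<^sub>F n in sequentially. \<forall>x\<in>cball 0 (real m). dist (interp n f x) (f x) < e"
    using eventually_ge_at_top[of m]
  proof eventually_elim
    case (elim n)
    have "(2::real) ^ m \<le> 2 ^ n" using elim by (intro power_increasing) auto
    then have mn: "real m < 2 ^ n" using nat_less_two_power[of m] by linarith
    have "2 / 2 ^ n \<le> (2::real)" by (simp add: field_simps)
    show ?case
    proof
      fix x :: plane assume x: "x \<in> cball 0 (real m)"
      have "\<bar>interp n f x - f x\<bar> \<le> e / 2"
      proof (rule interp_near)
        fix a assume a: "norm (grid_pt n a - x) \<le> 2 / 2 ^ n"
        have "norm (grid_pt n a) \<le> real m + 2"
          using norm_triangle_sub[of "grid_pt n a" x] x a \<open>2 / 2 ^ n \<le> (2::real)\<close> by auto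
        then have "dist (f (grid_pt n a)) (f x) < e / 2"
          using x a elim by (intro d(2)) (auto simp: dist_norm)
        then show "\<bar>f (grid_pt n a) - f x\<bar> \<le> e / 2" by (simp add: dist_real_def)
      qed (use x mn in \<open>simp del: of_nat_less_numeral_power_cancel_iff\<close>)
      then show "dist (interp n f x) (f x) < e" using e by (simp add: dist_real_def)
    qed
  qed
qed

text \<open>Pairs of nodes of successive levels that can influence the interpolated value at a
  common point of the ball of radius \<open>m\<close>: both are within 2 / 2^n of that point, hence
  the bound 4 / 2^n.\<close>

definition grid_pairs :: "nat \<Rightarrow> nat \<Rightarrow> ((int \<times> int) \<times> (int \<times> int)) set" where
  "grid_pairs m n = {(a, b). a \<in> grid_box (Suc n) \<and> b \<in> grid_box n \<and> norm (grid_pt (Suc n) a) \<le> real m + 2 \<and>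
     norm (grid_pt n b) \<le> real m + 2 \<and> norm (grid_pt (Suc n) a - grid_pt n b) \<le> 4 / 2 ^ n}"

lemma grid_pairs_subset: "grid_pairs m n \<subseteq> grid_box (Suc n) \<times> grid_box n"
  by (auto simp: grid_pairs_def)

lemma finite_grid_pairs [simp]: "finite (grid_pairs m n)"
  by (rule finite_subset[OF grid_pairs_subset]) simp

text \<open>All pairs are counted, near or not, which gives (4^n)^4 = 256^n up to a constant. The
  waste is harmless because the order of the moment in \<open>chain_step\<close> can be taken
  large.\<close>

lemma card_grid_pairs: "real (card (grid_pairs m n)) \<le> 65536 * 256 ^ n"
proof -
  have "card (grid_pairs m n) \<le> card (grid_box (Suc n) \<times> grid_box n)"
    by (intro card_mono grid_pairs_subset) simp
  also have "\<dots> \<le> (4 ^ Suc (Suc n)) ^ 2 * (4 ^ Suc n) ^ 2"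
    unfolding card_cartesian_product by (intro mult_mono card_grid_box) auto
  also have "\<dots> \<le> 65536 * 256 ^ n"
  proof -
    define y :: nat where "y = 4 ^ n"
    have "(256::nat) ^ n = y * y * y * y" by (simp add: y_def power_mult_distrib[symmetric])
    moreover have "(4 ^ Suc (Suc n)) ^ 2 * (4 ^ Suc n) ^ 2 = 4096 * (y * y * y * y)"
      by (simp add: y_def[symmetric] power2_eq_square)
    ultimately show ?thesis by simp
  qed
  finally have "card (grid_pairs m n) \<le> 65536 * 256 ^ n" .
  then have "real (card (grid_pairs m n)) \<le> real (65536 * 256 ^ n)" by (simp only: of_nat_le_iff)
  then show ?thesis by simp
qed

text \<open>Two applications of \<open>interp_near\<close>, one per level, compare the two convex
  combinations pair by pair.\<close>

lemma interp_Suc_diff: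
  assumes mn: "m \<le> n" and x: "norm x \<le> real m"
    and f: "\<And>a b. (a, b) \<in> grid_pairs m n \<Longrightarrow> \<bar>f (grid_pt (Suc n) a) - f (grid_pt n b)\<bar> \<le> D"
  shows "\<bar>interp (Suc n) f x - interp n f x\<bar> \<le> D"
proof -
  have "(2::real) ^ m \<le> 2 ^ n" using mn by (intro power_increasing) auto
  then have n: "norm x < 2 ^ n" using nat_less_two_power[of m] x by linarith
  have n': "norm x < 2 ^ Suc n" using n zero_le_power[of "2::real" n] by (simp only: power_Suc) linarith
  have two: "2 / 2 ^ n \<le> (2::real)" "2 / 2 ^ Suc n \<le> 2 / (2::real) ^ n" by (auto simp: field_simps)
  have "\<bar>interp n f x - interp (Suc n) f x\<bar> \<le> D"
  proof (rule interp_near[OF n])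
    fix b assume b: "b \<in> grid_box n" "norm (grid_pt n b - x) \<le> 2 / 2 ^ n"
    have "\<bar>interp (Suc n) f x - f (grid_pt n b)\<bar> \<le> D"
    proof (rule interp_near[OF n'])
      fix a assume a: "a \<in> grid_box (Suc n)" "norm (grid_pt (Suc n) a - x) \<le> 2 / 2 ^ Suc n"
      have a': "norm (grid_pt (Suc n) a - x) \<le> 2 / 2 ^ n" using a(2) two(2) by linarith
      have "norm (grid_pt (Suc n) a) \<le> real m + 2" "norm (grid_pt n b) \<le> real m + 2"
        using norm_triangle_sub[of "grid_pt (Suc n) a" x] norm_triangle_sub[of "grid_pt n b" x] x a' b(2) two(1) by linarith+
      moreover have "norm (grid_pt (Suc n) a - grid_pt n b) \<le> 4 / 2 ^ n"
        using norm_triangle_ineq4[of "grid_pt (Suc n) a - x" "grid_pt n b - x"] a' b(2) by simp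
      ultimately show "\<bar>f (grid_pt (Suc n) a) - f (grid_pt n b)\<bar> \<le> D"
        using a(1) b(1) by (intro f) (auto simp: grid_pairs_def)
    qed
    then show "\<bar>f (grid_pt n b) - interp (Suc n) f x\<bar> \<le> D" by linarith
  qed
  then show ?thesis by linarith
qed

section \<open>Chaining for fields with Gaussian increments\<close>

definition gaussian_increments ::
  "'a measure \<Rightarrow> (plane \<Rightarrow> 'a \<Rightarrow> real) \<Rightarrow> real \<Rightarrow> real \<Rightarrow> real \<Rightarrow> bool" where
  "gaussian_increments M Z \<gamma> K r \<longleftrightarrow> (\<forall>u. Z u \<in> borel_measurable M) \<and>
     (\<forall>u v. centered_gaussian M (\<lambda>\<omega>. Z u \<omega> - Z v \<omega>)) \<and>
     (\<forall>u v. norm u \<le> r \<longrightarrow> norm v \<le> r \<longrightarrow>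
        (\<integral>\<omega>. (Z u \<omega> - Z v \<omega>)\<^sup>2 \<partial>M) \<le> K * norm (u - v) powr (2 * \<gamma>))"

text \<open>Its power \<open>n\<close> is the threshold 2^(-\<gamma> n / 2) for differences at level
  \<open>n\<close>. Their standard deviation is of order 2^(-\<gamma> n): half of the exponent is
  spent on summability, the other half is left for the moments.\<close>

definition chain_ratio :: "real \<Rightarrow> real" where
  "chain_ratio \<gamma> = 2 powr (- \<gamma> / 2)"

text \<open>There are about 2^(8n) pairs, and a difference divided by the threshold has standard
  deviation of order 2^(-\<gamma> n / 2). Its moment of order 2k yields 2^(8n - \<gamma> k n) in
  total, and \<gamma> k \<ge> 9 leaves 2^-n.\<close>

definition chain_exponent :: "real \<Rightarrow> nat" where
  "chain_exponent \<gamma> = nat \<lceil>9 / \<gamma>\<rceil>"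

text \<open>Bounds the expected uniform distance of the interpolants at levels \<open>n\<close> and
  \<open>n + 1\<close> on a ball: the threshold plus the expected excess over it.\<close>

definition chain_bound :: "real \<Rightarrow> real \<Rightarrow> nat \<Rightarrow> real" where
  "chain_bound \<gamma> K n = chain_ratio \<gamma> ^ n + 65536 * gaussian_moment_const (chain_exponent \<gamma>) *
      (K * 4 powr (2 * \<gamma>)) ^ chain_exponent \<gamma> * (1 / 2) ^ n"

lemma chain_ratio: "0 < \<gamma> \<Longrightarrow> 0 < chain_ratio \<gamma>" "0 < \<gamma> \<Longrightarrow> chain_ratio \<gamma> < 1"
  by (auto simp: chain_ratio_def powr_less_one)

lemma chain_exponent:
  assumes "0 < \<gamma>"
  shows "9 \<le> \<gamma> * real (chain_exponent \<gamma>)" "0 < chain_exponent \<gamma>"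
proof -
  have "9 / \<gamma> \<le> real (chain_exponent \<gamma>)" unfolding chain_exponent_def by linarith
  then show "9 \<le> \<gamma> * real (chain_exponent \<gamma>)" using assms by (simp add: field_simps)
  then show "0 < chain_exponent \<gamma>" by (cases "chain_exponent \<gamma>") auto
qed

lemma chain_bound_nonneg: "0 < \<gamma> \<Longrightarrow> 0 \<le> K \<Longrightarrow> 0 \<le> chain_bound \<gamma> K n"
  using chain_ratio[of \<gamma>] gaussian_moment_const_pos[of "chain_exponent \<gamma>"]
  by (auto simp: chain_bound_def intro!: add_nonneg_nonneg mult_nonneg_nonneg)

lemma summable_chain_bound: "0 < \<gamma> \<Longrightarrow> summable (chain_bound \<gamma> K)"
  unfolding chain_bound_def using chain_ratio[of \<gamma>]
  by (intro summable_add summable_mult summable_geometric) auto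

context prob_space begin

text \<open>The maximum over all pairs is dominated, through
  \<open>\<bar>t\<bar> \<le> 1 + t ^ (2 * k)\<close> with \<open>t\<close> the difference divided by
  the threshold \<open>l\<close>, by a sum of even powers. That sum is measurable and independent of
  \<open>x\<close>, and its expectation consists of Gaussian moments.\<close>

lemma chain_step:
  assumes Z: "gaussian_increments M Z \<gamma> K (real m + 2)" and \<gamma>: "0 < \<gamma>" and K: "0 \<le> K" and mn: "m \<le> n"
  shows "\<exists>\<Delta>. \<Delta> \<in> borel_measurable M \<and> (\<forall>\<omega>. 0 \<le> \<Delta> \<omega>) \<and>
     (\<integral>\<^sup>+\<omega>. ennreal (\<Delta> \<omega>) \<partial>M) \<le> ennreal (chain_bound \<gamma> K n) \<and>
     (\<forall>\<omega> x. norm x \<le> real m \<longrightarrow>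
        \<bar>interp (Suc n) (\<lambda>u. Z u \<omega>) x - interp n (\<lambda>u. Z u \<omega>) x\<bar> \<le> \<Delta> \<omega>)"
proof -
  define k where "k = chain_exponent \<gamma>"
  have k: "9 \<le> \<gamma> * real k" "0 < k" using chain_exponent[OF \<gamma>] by (auto simp: k_def)
  define l where "l = chain_ratio \<gamma> ^ n"
  have l: "l > 0" using chain_ratio[OF \<gamma>] by (simp add: l_def)
  define T where "T p \<omega> = Z (grid_pt (Suc n) (fst p)) \<omega> - Z (grid_pt n (snd p)) \<omega>" for p \<omega>
  have T: "centered_gaussian M (T p)" for p using Z unfolding gaussian_increments_def T_def by auto
  have T2: "expectation (\<lambda>\<omega>. (T p \<omega>)\<^sup>2) \<le> K * (4 / 2 ^ n) powr (2 * \<gamma>)" if "p \<in> grid_pairs m n" for p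
  proof -
    have "expectation (\<lambda>\<omega>. (T p \<omega>)\<^sup>2) \<le> K * norm (grid_pt (Suc n) (fst p) - grid_pt n (snd p)) powr (2 * \<gamma>)"
      using Z that by (auto simp: gaussian_increments_def T_def grid_pairs_def)
    also have "\<dots> \<le> K * (4 / 2 ^ n) powr (2 * \<gamma>)"
      using that \<gamma> K by (intro mult_left_mono powr_mono2) (auto simp: grid_pairs_def)
    finally show ?thesis .
  qed
  define \<Delta> where "\<Delta> \<omega> = l + (\<Sum>p\<in>grid_pairs m n. l / l ^ (2 * k) * T p \<omega> ^ (2 * k))" for \<omega>
  have even_nonneg: "0 \<le> (t::real) ^ (2 * k)" for t by (simp add: zero_le_even_power)
  have nonneg: "0 \<le> \<Delta> \<omega>" for \<omega>
    unfolding \<Delta>_def using l even_nonneg by (intro add_nonneg_nonneg sum_nonneg mult_nonneg_nonneg) auto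
  have bnd: "\<bar>interp (Suc n) (\<lambda>u. Z u \<omega>) x - interp n (\<lambda>u. Z u \<omega>) x\<bar> \<le> \<Delta> \<omega>" if "norm x \<le> real m" for \<omega> x
  proof (rule interp_Suc_diff[OF mn that])
    fix a b assume ab: "(a, b) \<in> grid_pairs m n"
    have "\<bar>t\<bar> \<le> 1 + t ^ (2 * k)" for t :: real
    proof (cases "\<bar>t\<bar> \<le> 1")
      case False
      then have "\<bar>t\<bar> ^ 1 \<le> \<bar>t\<bar> ^ (2 * k)" using k by (intro power_increasing) auto
      then show ?thesis by (simp add: power_even_abs)
    qed (use even_nonneg[of t] in linarith)
    from this[of "T (a, b) \<omega> / l"] have "\<bar>T (a, b) \<omega>\<bar> \<le> l + l / l ^ (2 * k) * T (a, b) \<omega> ^ (2 * k)"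
      using l by (simp add: abs_divide field_simps power_divide)
    also have "\<dots> \<le> \<Delta> \<omega>"
      unfolding \<Delta>_def using ab l even_nonneg
      by (intro add_left_mono member_le_sum[where f="\<lambda>p. l / l ^ (2 * k) * T p \<omega> ^ (2 * k)"]) (auto intro!: mult_nonneg_nonneg)
    finally show "\<bar>Z (grid_pt (Suc n) a) \<omega> - Z (grid_pt n b) \<omega>\<bar> \<le> \<Delta> \<omega>"
      by (simp add: T_def)
  qed
  have int: "integrable M (\<lambda>\<omega>. T p \<omega> ^ (2 * k))" for p
    by (rule centered_gaussian_moment(1)[OF T])
  have int\<Delta>: "integrable M \<Delta>"
    unfolding \<Delta>_def by (intro Bochner_Integration.integrable_add Bochner_Integration.integrable_sum integrable_mult_right int) auto
  define C where "C = gaussian_moment_const k"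
  have C: "C > 0" unfolding C_def by (rule gaussian_moment_const_pos)
  have "expectation \<Delta> = l + (\<Sum>p\<in>grid_pairs m n. l / l ^ (2 * k) * expectation (\<lambda>\<omega>. T p \<omega> ^ (2 * k)))"
    unfolding \<Delta>_def using int by (simp add: Bochner_Integration.integral_sum prob_space)
  also have "\<dots> \<le> l + (\<Sum>p\<in>grid_pairs m n. l / l ^ (2 * k) * (C * (K * (4 / 2 ^ n) powr (2 * \<gamma>)) ^ k))"
  proof (intro add_left_mono sum_mono mult_left_mono)
    fix p assume "p \<in> grid_pairs m n"
    then have "(expectation (\<lambda>\<omega>. (T p \<omega>)\<^sup>2)) ^ k \<le> (K * (4 / 2 ^ n) powr (2 * \<gamma>)) ^ k"
      by (intro power_mono T2) auto
    then show "expectation (\<lambda>\<omega>. T p \<omega> ^ (2 * k)) \<le> C * (K * (4 / 2 ^ n) powr (2 * \<gamma>)) ^ k"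
      using C by (simp add: centered_gaussian_moment(2)[OF T] C_def)
  qed (use l in auto)
  also have "\<dots> = l + real (card (grid_pairs m n)) * (l / l ^ (2 * k) * (C * (K * (4 / 2 ^ n) powr (2 * \<gamma>)) ^ k))"
    by simp
  also have "\<dots> \<le> l + (65536 * 256 ^ n) * (l / l ^ (2 * k) * (C * (K * (4 / 2 ^ n) powr (2 * \<gamma>)) ^ k))"
    using l C K by (intro add_left_mono mult_right_mono card_grid_pairs mult_nonneg_nonneg) auto
  also have "\<dots> = l + 65536 * C * (K * 4 powr (2 * \<gamma>)) ^ k * (256 ^ n * (l / l ^ (2 * k) * ((1 / 2 ^ n) powr (2 * \<gamma>)) ^ k))"
    by (simp add: powr_divide power_mult_distrib power_divide)
  also have "\<dots> \<le> l + 65536 * C * (K * 4 powr (2 * \<gamma>)) ^ k * (1 / 2) ^ n"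
  proof (intro add_left_mono mult_left_mono)
    have l_powr: "l = 2 powr (- \<gamma> / 2 * real n)"
      by (simp add: l_def chain_ratio_def powr_powr flip: powr_realpow)
    \<comment> \<open>The four exponents of 2 are, in this order, those of the number of pairs, of
      \<open>l\<close>, of \<open>1 / l ^ (2 * k)\<close> and of the increment variance to the power
      \<open>k\<close>.\<close>
    have "256 ^ n * (l / l ^ (2 * k) * ((1 / 2 ^ n) powr (2 * \<gamma>)) ^ k)
        = 2 powr (8 * real n + (- \<gamma> / 2 * real n) - (- \<gamma> / 2 * real n) * real (2 * k) + (- (2 * \<gamma> * real n)) * real k)"
    proof -
      have "(256::real) ^ n = (2 powr 8) ^ n" by simp
      also have "\<dots> = 2 powr (8 * real n)" by (subst powr_power) (auto simp: mult.commute)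
      finally have a: "(256::real) ^ n = 2 powr (8 * real n)" .
      have b: "l ^ (2 * k) = 2 powr ((- \<gamma> / 2 * real n) * real (2 * k))"
        unfolding l_powr by (simp add: powr_powr flip: powr_realpow)
      have "(1 / 2 ^ n :: real) = 2 powr (- real n)"
        by (simp add: powr_minus powr_realpow field_simps)
      then have c: "((1 / 2 ^ n :: real) powr (2 * \<gamma>)) ^ k = 2 powr ((- (2 * \<gamma> * real n)) * real k)"
        by (simp add: powr_powr mult.commute mult.left_commute flip: powr_realpow)
      show ?thesis unfolding a b c powr_add powr_diff by (subst l_powr) (simp add: field_simps)
    qed
    also have "\<dots> \<le> 2 powr (- real n)"
    proof (rule powr_mono)
      have "9 * real n \<le> \<gamma> * real k * real n" using k(1) by (intro mult_right_mono) auto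
      moreover have "0 \<le> \<gamma> * real n" using \<gamma> by simp
      ultimately show "8 * real n + (- \<gamma> / 2 * real n) - (- \<gamma> / 2 * real n) * real (2 * k) + (- (2 * \<gamma> * real n)) * real k \<le> - real n"
        by (simp add: algebra_simps)
    qed simp
    also have "\<dots> = (1 / 2) ^ n" by (simp add: powr_minus powr_realpow field_simps)
    finally show "256 ^ n * (l / l ^ (2 * k) * ((1 / 2 ^ n) powr (2 * \<gamma>)) ^ k) \<le> (1 / 2) ^ n" .
  qed (use C K in auto)
  also have "\<dots> = chain_bound \<gamma> K n" by (simp add: chain_bound_def l_def C_def k_def)
  finally have "expectation \<Delta> \<le> chain_bound \<gamma> K n" .
  then have "(\<integral>\<^sup>+\<omega>. ennreal (\<Delta> \<omega>) \<partial>M) \<le> ennreal (chain_bound \<gamma> K n)"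
    using nonneg int\<Delta> by (simp add: nn_integral_eq_integral ennreal_leI)
  then show ?thesis using nonneg bnd int\<Delta> by blast
qed

text \<open>Telescopes \<open>chain_step\<close> from level \<open>n\<close> on. The bound on the
  integral depends on the field only through \<gamma> and \<open>K\<close>, so one level
  \<open>n\<close> serves a whole family of fields. \<open>D\<close> takes extended values because
  the series may diverge on a null set.\<close>

lemma chain_tail:
  assumes Z: "gaussian_increments M Z \<gamma> K (real m + 2)" and \<gamma>: "0 < \<gamma>" and K: "0 \<le> K" and mn: "m \<le> n"
    and cont: "\<And>\<omega>. \<omega> \<in> space M \<Longrightarrow> continuous_on UNIV (\<lambda>u. Z u \<omega>)"
  shows "\<exists>D. D \<in> borel_measurable M \<and> (\<integral>\<^sup>+\<omega>. D \<omega> \<partial>M) \<le> ennreal (\<Sum>j. chain_bound \<gamma> K (j + n)) \<and>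
     (\<forall>\<omega>\<in>space M. \<forall>x. norm x \<le> real m \<longrightarrow> ennreal \<bar>Z x \<omega> - interp n (\<lambda>u. Z u \<omega>) x\<bar> \<le> D \<omega>)"
proof -
  have "\<forall>j. \<exists>\<Delta>. \<Delta> \<in> borel_measurable M \<and> (\<forall>\<omega>. 0 \<le> \<Delta> \<omega>) \<and>
     (\<integral>\<^sup>+\<omega>. ennreal (\<Delta> \<omega>) \<partial>M) \<le> ennreal (chain_bound \<gamma> K (j + n)) \<and>
     (\<forall>\<omega> x. norm x \<le> real m \<longrightarrow>
        \<bar>interp (Suc (j + n)) (\<lambda>u. Z u \<omega>) x - interp (j + n) (\<lambda>u. Z u \<omega>) x\<bar> \<le> \<Delta> \<omega>)"
    using mn by (intro allI chain_step[OF Z \<gamma> K]) auto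
  then obtain \<Delta> where \<Delta>[measurable]: "\<And>j. \<Delta> j \<in> borel_measurable M" and \<Delta>0: "\<And>j \<omega>. 0 \<le> \<Delta> j \<omega>"
    and \<Delta>1: "\<And>j. (\<integral>\<^sup>+\<omega>. ennreal (\<Delta> j \<omega>) \<partial>M) \<le> ennreal (chain_bound \<gamma> K (j + n))"
    and \<Delta>2: "\<And>j \<omega> x. norm x \<le> real m \<Longrightarrow>
        \<bar>interp (Suc (j + n)) (\<lambda>u. Z u \<omega>) x - interp (j + n) (\<lambda>u. Z u \<omega>) x\<bar> \<le> \<Delta> j \<omega>"
    by metis
  define D where "D \<omega> = (\<Sum>j. ennreal (\<Delta> j \<omega>))" for \<omega>
  have "(\<integral>\<^sup>+\<omega>. D \<omega> \<partial>M) = (\<Sum>j. \<integral>\<^sup>+\<omega>. ennreal (\<Delta> j \<omega>) \<partial>M)"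
    unfolding D_def by (rule nn_integral_suminf) simp
  also have "\<dots> \<le> (\<Sum>j. ennreal (chain_bound \<gamma> K (j + n)))"
    by (intro suminf_le \<Delta>1 summableI)
  also have "\<dots> = ennreal (\<Sum>j. chain_bound \<gamma> K (j + n))"
    by (intro suminf_ennreal2 chain_bound_nonneg \<gamma> K summable_ignore_initial_segment summable_chain_bound)
  finally have 1: "(\<integral>\<^sup>+\<omega>. D \<omega> \<partial>M) \<le> ennreal (\<Sum>j. chain_bound \<gamma> K (j + n))" .
  have 2: "ennreal \<bar>Z x \<omega> - interp n (\<lambda>u. Z u \<omega>) x\<bar> \<le> D \<omega>" if \<omega>: "\<omega> \<in> space M" and x: "norm x \<le> real m" for \<omega> x
  proof (rule tendsto_le)
    let ?f = "\<lambda>u. Z u \<omega>"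
    have "(\<lambda>j. interp j ?f x) \<longlonglongrightarrow> ?f x"
      using x by (intro tendsto_uniform_limitI[OF uniform_limit_interp[OF cont[OF \<omega>], of m]]) simp
    then have "(\<lambda>j. interp (j + n) ?f x) \<longlonglongrightarrow> ?f x" by (rule LIMSEQ_ignore_initial_segment)
    then show "(\<lambda>j. ennreal \<bar>interp (j + n) ?f x - interp n ?f x\<bar>) \<longlonglongrightarrow> ennreal \<bar>Z x \<omega> - interp n ?f x\<bar>"
      by (intro tendsto_intros)
    have "ennreal \<bar>interp (j + n) ?f x - interp n ?f x\<bar> \<le> (\<Sum>i<j. ennreal (\<Delta> i \<omega>))" for j
    proof (induction j)
      case (Suc j)
      have "ennreal \<bar>interp (Suc j + n) ?f x - interp n ?f x\<bar> \<le> ennreal (\<bar>interp (j + n) ?f x - interp n ?f x\<bar> + \<Delta> j \<omega>)"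
        using \<Delta>2[OF x, of j \<omega>] by (intro ennreal_leI) simp
      also have "\<dots> = ennreal \<bar>interp (j + n) ?f x - interp n ?f x\<bar> + ennreal (\<Delta> j \<omega>)"
        using \<Delta>0 by (intro ennreal_plus) auto
      also have "\<dots> \<le> (\<Sum>i<Suc j. ennreal (\<Delta> i \<omega>))" using Suc by (simp add: add_right_mono)
      finally show ?case .
    qed simp
    moreover have "(\<Sum>i<j. ennreal (\<Delta> i \<omega>)) \<le> D \<omega>" for j
      unfolding D_def by (intro sum_le_suminf summableI) auto
    ultimately show "\<forall>\<^sub>F j in sequentially. ennreal \<bar>interp (j + n) ?f x - interp n ?f x\<bar> \<le> D \<omega>"
      by (intro always_eventually allI) (meson order_trans)
  qed auto
  have "D \<in> borel_measurable M" unfolding D_def by simp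
  then show ?thesis using 1 2 by blast
qed

text \<open>Jensen's inequality for the square, the weights at \<open>x\<close> being a probability
  vector; only nodes close to \<open>x\<close> contribute.\<close>

lemma interp_L2_conv:
  assumes Z: "gaussian_increments M Z \<gamma> K (norm x + 2)" and \<gamma>: "0 < \<gamma>" and K: "0 \<le> K" and n: "norm x < 2 ^ n"
  shows "(\<integral>\<^sup>+\<omega>. ennreal ((interp n (\<lambda>u. Z u \<omega>) x - Z x \<omega>)\<^sup>2) \<partial>M) \<le> ennreal (K * (2 / 2 ^ n) powr (2 * \<gamma>))"
proof -
  define B where "B = {a \<in> grid_box n. grid_wt n a x \<noteq> 0}"
  have B: "finite B" "B \<subseteq> grid_box n" unfolding B_def by auto
  have sumB: "(\<Sum>a\<in>B. grid_wt n a x) = 1"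
    unfolding sum_grid_wt[OF n, symmetric] B_def by (intro sum.mono_neutral_left) auto
  have "ennreal ((interp n (\<lambda>u. Z u \<omega>) x - Z x \<omega>)\<^sup>2) \<le> (\<Sum>a\<in>B. ennreal (grid_wt n a x * (Z (grid_pt n a) \<omega> - Z x \<omega>)\<^sup>2))" for \<omega>
  proof -
    have "interp n (\<lambda>u. Z u \<omega>) x = (\<Sum>a\<in>B. grid_wt n a x * Z (grid_pt n a) \<omega>)"
      unfolding interp_def B_def by (intro sum.mono_neutral_cong_right) auto
    then have "interp n (\<lambda>u. Z u \<omega>) x - Z x \<omega> = (\<Sum>a\<in>B. grid_wt n a x *\<^sub>R (Z (grid_pt n a) \<omega> - Z x \<omega>))"
      by (simp add: right_diff_distrib sum_subtractf sum_distrib_right[symmetric] sumB)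
    moreover have "(\<Sum>a\<in>B. grid_wt n a x *\<^sub>R (Z (grid_pt n a) \<omega> - Z x \<omega>))\<^sup>2 \<le> (\<Sum>a\<in>B. grid_wt n a x * (Z (grid_pt n a) \<omega> - Z x \<omega>)\<^sup>2)"
      by (rule convex_on_sum[OF B(1) _ convex_power2]) (use sumB in auto)
    ultimately show ?thesis by (simp add: sum_ennreal ennreal_leI)
  qed
  then have "(\<integral>\<^sup>+\<omega>. ennreal ((interp n (\<lambda>u. Z u \<omega>) x - Z x \<omega>)\<^sup>2) \<partial>M) \<le>
      (\<integral>\<^sup>+\<omega>. (\<Sum>a\<in>B. ennreal (grid_wt n a x * (Z (grid_pt n a) \<omega> - Z x \<omega>)\<^sup>2)) \<partial>M)"
    by (rule nn_integral_mono)
  also have "\<dots> = (\<Sum>a\<in>B. \<integral>\<^sup>+\<omega>. ennreal (grid_wt n a x * (Z (grid_pt n a) \<omega> - Z x \<omega>)\<^sup>2) \<partial>M)"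
  proof -
    have [measurable]: "\<And>u. Z u \<in> borel_measurable M" using Z by (simp add: gaussian_increments_def)
    show ?thesis by (intro nn_integral_sum) measurable
  qed
  also have "\<dots> \<le> (\<Sum>a\<in>B. ennreal (grid_wt n a x * (K * (2 / 2 ^ n) powr (2 * \<gamma>))))"
  proof (rule sum_mono)
    fix a assume a: "a \<in> B"
    have g: "centered_gaussian M (\<lambda>\<omega>. Z (grid_pt n a) \<omega> - Z x \<omega>)" using Z by (auto simp: gaussian_increments_def)
    have near: "norm (grid_pt n a - x) \<le> 2 / 2 ^ n" using a by (intro grid_wt_near) (auto simp: B_def)
    have "2 / 2 ^ n \<le> (2::real)" by (simp add: field_simps)
    then have "norm (grid_pt n a) \<le> norm x + 2" using near norm_triangle_sub[of "grid_pt n a" x] by linarith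
    then have "expectation (\<lambda>\<omega>. (Z (grid_pt n a) \<omega> - Z x \<omega>)\<^sup>2) \<le> K * norm (grid_pt n a - x) powr (2 * \<gamma>)"
      using Z by (auto simp: gaussian_increments_def)
    also have "\<dots> \<le> K * (2 / 2 ^ n) powr (2 * \<gamma>)"
      using near \<gamma> K by (intro mult_left_mono powr_mono2) auto
    finally show "(\<integral>\<^sup>+\<omega>. ennreal (grid_wt n a x * (Z (grid_pt n a) \<omega> - Z x \<omega>)\<^sup>2) \<partial>M) \<le> ennreal (grid_wt n a x * (K * (2 / 2 ^ n) powr (2 * \<gamma>)))"
      using centered_gaussian_square_integrable[OF g]
      by (subst nn_integral_eq_integral) (auto intro!: ennreal_leI mult_left_mono)
  qed
  also have "\<dots> = ennreal (K * (2 / 2 ^ n) powr (2 * \<gamma>))"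
    using K by (subst sum_ennreal) (auto simp: sum_distrib_right[symmetric] sumB)
  finally show ?thesis .
qed

text \<open>Kolmogorov's continuity theorem. By chaining the interpolants converge locally uniformly
  almost surely; that the limit is a version of \<open>Z\<close> follows from Fatou's lemma and
  \<open>interp_L2_conv\<close>.\<close>

lemma continuous_version_exists:
  assumes Z: "\<And>m. \<exists>K\<ge>0. gaussian_increments M Z \<gamma> K (real m)" and \<gamma>: "0 < \<gamma>"
  shows "\<exists>Z'. continuous_version M Z Z'"
proof -
  have Zm[measurable]: "Z u \<in> borel_measurable M" for u using Z[of 0] by (auto simp: gaussian_increments_def)
  have "\<exists>K. 0 \<le> K \<and> gaussian_increments M Z \<gamma> K (real m + 2)" for m
    using Z[of "m + 2"] by (auto simp: add_ac)
  then obtain K where K: "\<And>m. 0 \<le> K m" "\<And>m. gaussian_increments M Z \<gamma> (K m) (real m + 2)" by metis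
  have "\<forall>m j. \<exists>\<Delta>. \<Delta> \<in> borel_measurable M \<and> (\<forall>\<omega>. 0 \<le> \<Delta> \<omega>) \<and>
     (\<integral>\<^sup>+\<omega>. ennreal (\<Delta> \<omega>) \<partial>M) \<le> ennreal (chain_bound \<gamma> (K m) (j + m)) \<and>
     (\<forall>\<omega> x. norm x \<le> real m \<longrightarrow>
        \<bar>interp (Suc (j + m)) (\<lambda>u. Z u \<omega>) x - interp (j + m) (\<lambda>u. Z u \<omega>) x\<bar> \<le> \<Delta> \<omega>)"
    by (intro allI chain_step[OF K(2) \<gamma> K(1)]) auto
  then obtain \<Delta> where \<Delta>[measurable]: "\<And>m j. \<Delta> m j \<in> borel_measurable M" and \<Delta>0: "\<And>m j \<omega>. 0 \<le> \<Delta> m j \<omega>"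
    and \<Delta>1: "\<And>m j. (\<integral>\<^sup>+\<omega>. ennreal (\<Delta> m j \<omega>) \<partial>M) \<le> ennreal (chain_bound \<gamma> (K m) (j + m))"
    and \<Delta>2: "\<And>m j \<omega> x. norm x \<le> real m \<Longrightarrow>
        \<bar>interp (Suc (j + m)) (\<lambda>u. Z u \<omega>) x - interp (j + m) (\<lambda>u. Z u \<omega>) x\<bar> \<le> \<Delta> m j \<omega>"
    by metis
  \<comment> \<open>The exceptional points are removed for all radii \<open>m\<close> at once, so
    that a single null set is discarded.\<close>
  define A where "A = {\<omega>\<in>space M. \<forall>m. (\<Sum>j. ennreal (\<Delta> m j \<omega>)) < \<infinity>}"
  have [measurable]: "A \<in> sets M" unfolding A_def by measurable
  have "AE \<omega> in M. (\<Sum>j. ennreal (\<Delta> m j \<omega>)) \<noteq> \<infinity>" for m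
  proof (rule nn_integral_PInf_AE)
    have "(\<integral>\<^sup>+\<omega>. (\<Sum>j. ennreal (\<Delta> m j \<omega>)) \<partial>M) = (\<Sum>j. \<integral>\<^sup>+\<omega>. ennreal (\<Delta> m j \<omega>) \<partial>M)"
      by (rule nn_integral_suminf) simp
    also have "\<dots> \<le> (\<Sum>j. ennreal (chain_bound \<gamma> (K m) (j + m)))"
      by (intro suminf_le \<Delta>1 summableI)
    also have "\<dots> = ennreal (\<Sum>j. chain_bound \<gamma> (K m) (j + m))"
      by (intro suminf_ennreal2 chain_bound_nonneg \<gamma> K summable_ignore_initial_segment summable_chain_bound)
    finally show "(\<integral>\<^sup>+\<omega>. (\<Sum>j. ennreal (\<Delta> m j \<omega>)) \<partial>M) \<noteq> \<infinity>"
      by (metis ennreal_less_top infinity_ennreal_def leD)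
  qed measurable
  then have AE_A: "AE \<omega> in M. \<omega> \<in> A"
    unfolding A_def by (auto simp: AE_all_countable less_top)
  \<comment> \<open>The value 0 off \<open>A\<close> makes every path continuous. A pointwise limit
    does not refer to \<open>m\<close>, so the uniform limits on the different balls fit
    together.\<close>
  define Z' where "Z' u \<omega> = (if \<omega> \<in> A then lim (\<lambda>n. interp n (\<lambda>u. Z u \<omega>) u) else 0)" for u \<omega>
  have unif: "uniform_limit (cball 0 (real m)) (\<lambda>n. interp n (\<lambda>u. Z u \<omega>)) (\<lambda>u. Z' u \<omega>) sequentially" if \<omega>: "\<omega> \<in> A" for m \<omega>
  proof -
    let ?P = "\<lambda>n. interp n (\<lambda>u. Z u \<omega>)"
    have "summable (\<lambda>j. \<Delta> m j \<omega>)"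
    proof (rule summable_suminf_not_top)
      have "(\<Sum>j. ennreal (\<Delta> m j \<omega>)) < \<infinity>" using \<omega> unfolding A_def by blast
      then show "(\<Sum>j. ennreal (\<Delta> m j \<omega>)) \<noteq> top" by simp
    qed (rule \<Delta>0)
    then have "uniform_limit (cball 0 (real m)) (\<lambda>n x. \<Sum>j<n. ?P (Suc (j + m)) x - ?P (j + m) x)
      (\<lambda>x. \<Sum>j. ?P (Suc (j + m)) x - ?P (j + m) x) sequentially"
      using \<Delta>2[of _ m _ \<omega>] by (intro Weierstrass_m_test[of _ _ "\<lambda>j. \<Delta> m j \<omega>"]) auto
    moreover have "(\<Sum>j<n. ?P (Suc (j + m)) x - ?P (j + m) x) = ?P (n + m) x - ?P m x" for n x
      using sum_lessThan_telescope[of "\<lambda>j. ?P (j + m) x" n] by simp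
    ultimately have "uniform_limit (cball 0 (real m)) (\<lambda>n x. ?P (n + m) x - ?P m x)
      (\<lambda>x. \<Sum>j. ?P (Suc (j + m)) x - ?P (j + m) x) sequentially" by simp
    from uniform_limit_add[OF this uniform_limit_const[where c="?P m"]]
    have u: "uniform_limit (cball 0 (real m)) (\<lambda>n x. ?P (n + m) x)
      (\<lambda>x. (\<Sum>j. ?P (Suc (j + m)) x - ?P (j + m) x) + ?P m x) sequentially" (is "uniform_limit _ _ ?L _") by simp
    have u': "uniform_limit (cball 0 (real m)) ?P ?L sequentially"
    proof (rule uniform_limitI)
      fix e :: real assume "e > 0"
      from uniform_limitD[OF u this]
      show "\<forall>\<^sub>F n in sequentially. \<forall>x\<in>cball 0 (real m). dist (?P n x) (?L x) < e"
        by (rule eventually_sequentially_seg[THEN iffD1])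
    qed
    have "?L x = Z' x \<omega>" if "x \<in> cball 0 (real m)" for x
      using tendsto_uniform_limitI[OF u' that] \<omega> by (simp add: Z'_def limI)
    then show ?thesis using uniform_limit_cong'[of "cball 0 (real m)" ?P ?P ?L "\<lambda>u. Z' u \<omega>"] u' by simp
  qed
  have ptw: "(\<lambda>n. interp n (\<lambda>u. Z u \<omega>) x) \<longlonglongrightarrow> Z' x \<omega>" if "\<omega> \<in> A" for x \<omega>
  proof -
    obtain m where "norm x \<le> real m" using real_arch_simple by blast
    then show ?thesis by (intro tendsto_uniform_limitI[OF unif[OF that, of m]]) simp
  qed
  have Z'm[measurable]: "Z' x \<in> borel_measurable M" for x
  proof -
    have [measurable]: "(\<lambda>\<omega>. interp n (\<lambda>u. Z u \<omega>) x) \<in> borel_measurable M" for n by (intro measurable_interp Zm)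
    show ?thesis unfolding Z'_def by measurable
  qed
  have cont: "continuous_on UNIV (\<lambda>u. Z' u \<omega>)" for \<omega>
  proof (cases "\<omega> \<in> A")
    case True
    have "continuous_on (cball 0 (real m)) (\<lambda>u. Z' u \<omega>)" for m
      by (rule uniform_limit_theorem[OF _ unif[OF True]]) (auto intro!: always_eventually continuous_on_interp)
    then have "continuous_on (ball 0 (real m)) (\<lambda>u. Z' u \<omega>)" for m
      using continuous_on_subset ball_subset_cball by blast
    then have "continuous_on (\<Union>m. ball 0 (real m)) (\<lambda>u. Z' u \<omega>)"
      by (intro continuous_on_open_UN) auto
    moreover have "(\<Union>m. ball 0 (real m)) = (UNIV :: plane set)"
      by (auto simp: reals_Archimedean2)
    ultimately show ?thesis by simp
  qed (simp add: Z'_def)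
  have "AE \<omega> in M. Z' x \<omega> = Z x \<omega>" for x
  proof -
    obtain m where m: "norm x + 2 \<le> real m" using real_arch_simple by blast
    obtain K' where K': "0 \<le> K'" "gaussian_increments M Z \<gamma> K' (real m)" using Z by blast
    then have gi: "gaussian_increments M Z \<gamma> K' (norm x + 2)" using m unfolding gaussian_increments_def by force
    define v where "v n = (\<lambda>\<omega>. ennreal ((interp n (\<lambda>u. Z u \<omega>) x - Z x \<omega>)\<^sup>2))" for n
    have [measurable]: "(\<lambda>\<omega>. interp n (\<lambda>u. Z u \<omega>) x) \<in> borel_measurable M" for n by (intro measurable_interp Zm)
    have vm[measurable]: "v n \<in> borel_measurable M" for n unfolding v_def by measurable
    have "(\<integral>\<^sup>+\<omega>. ennreal ((Z' x \<omega> - Z x \<omega>)\<^sup>2) \<partial>M) = (\<integral>\<^sup>+\<omega>. liminf (\<lambda>n. v n \<omega>) \<partial>M)"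
    proof (rule nn_integral_cong_AE)
      show "AE \<omega> in M. ennreal ((Z' x \<omega> - Z x \<omega>)\<^sup>2) = liminf (\<lambda>n. v n \<omega>)"
        using AE_A
      proof (rule AE_mp, intro AE_I2 impI)
        fix \<omega> assume "\<omega> \<in> A"
        then have "(\<lambda>n. v n \<omega>) \<longlonglongrightarrow> ennreal ((Z' x \<omega> - Z x \<omega>)\<^sup>2)"
          unfolding v_def by (intro tendsto_intros ptw)
        then show "ennreal ((Z' x \<omega> - Z x \<omega>)\<^sup>2) = liminf (\<lambda>n. v n \<omega>)"
          by (simp add: lim_imp_Liminf)
      qed
    qed
    also have "\<dots> \<le> liminf (\<lambda>n. \<integral>\<^sup>+\<omega>. v n \<omega> \<partial>M)"
      by (rule nn_integral_liminf) (rule vm)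
    also have "\<dots> = 0"
    proof -
      have "(\<lambda>n. K' * (2 / 2 ^ n) powr (2 * \<gamma>)) \<longlonglongrightarrow> 0"
      proof -
        have "(\<lambda>n. 2 / 2 ^ n :: real) \<longlonglongrightarrow> 0"
          using tendsto_mult[OF tendsto_const[of 2] LIMSEQ_power_zero[of "1/2 :: real"]] by (simp add: power_one_over)
        then have "(\<lambda>n. (2 / 2 ^ n :: real) powr (2 * \<gamma>)) \<longlonglongrightarrow> 0"
          using \<gamma> by (intro tendsto_zero_powrI[where b="2 * \<gamma>"]) auto
        then show ?thesis using tendsto_mult_right_zero by blast
      qed
      then have lim0: "(\<lambda>n. ennreal (K' * (2 / 2 ^ n) powr (2 * \<gamma>))) \<longlonglongrightarrow> ennreal 0"
        by (intro tendsto_intros)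
      have upper: "\<forall>\<^sub>F n in sequentially. (\<integral>\<^sup>+\<omega>. v n \<omega> \<partial>M) \<le> ennreal (K' * (2 / 2 ^ n) powr (2 * \<gamma>))"
        using eventually_ge_at_top[of m]
      proof eventually_elim
        case (elim n)
        have "(2::real) ^ m \<le> 2 ^ n" using elim by (intro power_increasing) auto
        then have "norm x < 2 ^ n" using nat_less_two_power[of m] m by linarith
        then show ?case unfolding v_def by (rule interp_L2_conv[OF gi \<gamma> K'(1)])
      qed
      have lower: "\<forall>\<^sub>F n in sequentially. 0 \<le> (\<integral>\<^sup>+\<omega>. v n \<omega> \<partial>M)" by simp
      show ?thesis
        by (intro lim_imp_Liminf tendsto_sandwich[OF lower upper tendsto_const lim0[unfolded ennreal_0]]) simp
    qed
    finally have *: "(\<integral>\<^sup>+\<omega>. ennreal ((Z' x \<omega> - Z x \<omega>)\<^sup>2) \<partial>M) = 0" by simp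
    have "(\<lambda>\<omega>. ennreal ((Z' x \<omega> - Z x \<omega>)\<^sup>2)) \<in> borel_measurable M" by measurable
    from nn_integral_0_iff_AE[OF this] * have "AE \<omega> in M. ennreal ((Z' x \<omega> - Z x \<omega>)\<^sup>2) = 0" by blast
    then show ?thesis by eventually_elim (simp add: ennreal_eq_0_iff)
  qed
  then show ?thesis using cont Z'm unfolding continuous_version_def continuous_field_def by blast
qed

end

section \<open>Weak convergence in the compact-open topology\<close>

text \<open>The generating set with \<open>K\<close> and \<open>U\<close> both empty contains every
  continuous function.\<close>

lemma topspace_compact_open: "topspace compact_open_topology = {f. continuous_on UNIV f}"
proof -
  have "f \<in> topspace compact_open_topology" if "continuous_on UNIV f" for f
    unfolding compact_open_topology_def topology_generated_by_topspace
    by (rule UnionI[of "{f. continuous_on UNIV f \<and> f ` {} \<subseteq> {}}"]) (use that in blast)+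
  then show ?thesis
    unfolding compact_open_topology_def topology_generated_by_topspace by blast
qed

text \<open>Induction on the generation of \<open>U\<close> reduces the claim to a basic set. There
  the compact image of \<open>K\<close> under \<open>f\<close> keeps a positive distance
  \<open>e\<close> from the complement of the open set, and \<open>K\<close> lies in some ball on
  which convergence is uniform.\<close>

lemma compact_open_eventually:
  assumes U: "openin compact_open_topology U" and fU: "f \<in> U"
    and fs: "\<And>n. continuous_on UNIV (fs n)"
    and lim: "\<And>m. uniform_limit (cball 0 (real m)) fs f F"
  shows "\<forall>\<^sub>F n in F. fs n \<in> U"
proof -
  have "generate_topology_on {{f. continuous_on UNIV f \<and> f ` K \<subseteq> U} | K U. compact K \<and> open (U :: real set)} U"
    using U unfolding compact_open_topology_def openin_topology_generated_by_iff .
  then show ?thesis using fU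
  proof (induction rule: generate_topology_on.induct)
    case (Int a b)
    then show ?case by (auto intro: eventually_conj)
  next
    case (UN K)
    then obtain k where "k \<in> K" "f \<in> k" by blast
    with UN.IH[of k] have "\<forall>\<^sub>F n in F. fs n \<in> k" by blast
    then show ?case by eventually_elim (use \<open>k \<in> K\<close> in blast)
  next
    case (Basis s)
    then obtain K V where s: "s = {f. continuous_on UNIV f \<and> f ` K \<subseteq> V}" and K: "compact K" and V: "open V" by blast
    have fc: "continuous_on UNIV f" "f ` K \<subseteq> V" using Basis s by auto
    have "compact (f ` K)" using K fc(1) by (intro compact_continuous_image continuous_on_subset[OF fc(1)]) auto
    then obtain e where e: "e > 0" "(\<Union>x\<in>f ` K. ball x e) \<subseteq> V"
      using compact_subset_open_imp_ball_epsilon_subset[OF _ V fc(2)] by metis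
    obtain r where r: "\<And>x. x \<in> K \<Longrightarrow> norm x \<le> r" using compact_imp_bounded[OF K] by (auto simp: bounded_iff)
    obtain m where m: "r \<le> real m" using real_arch_simple by blast
    have "\<forall>\<^sub>F n in F. \<forall>x\<in>cball 0 (real m). dist (fs n x) (f x) < e"
      by (rule uniform_limitD[OF lim e(1)])
    then show ?case
    proof eventually_elim
      case (elim n)
      have "fs n x \<in> V" if "x \<in> K" for x
      proof -
        have "dist (fs n x) (f x) < e" using elim r[OF that] m by auto
        then have "fs n x \<in> ball (f x) e" by (simp add: dist_commute)
        then show ?thesis using e(2) that by blast
      qed
      then show ?case using fs[of n] by (auto simp: s)
    qed
  qed auto
qed

lemma compact_open_tendsto:
  assumes \<Phi>: "continuous_map compact_open_topology euclideanreal \<Phi>"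
    and f: "continuous_on UNIV f" and fs: "\<And>n. continuous_on UNIV (fs n)"
    and lim: "\<And>m. uniform_limit (cball 0 (real m)) fs f F"
  shows "((\<lambda>n. \<Phi> (fs n)) \<longlongrightarrow> \<Phi> f) F"
proof (rule topological_tendstoI)
  fix V :: "real set" assume V: "open V" "\<Phi> f \<in> V"
  define U where "U = {g \<in> topspace compact_open_topology. \<Phi> g \<in> V}"
  have "openin compact_open_topology U"
    unfolding U_def using \<Phi> V by (intro openin_continuous_map_preimage) auto
  moreover have "f \<in> U" using V f by (simp add: U_def topspace_compact_open)
  ultimately have "\<forall>\<^sub>F n in F. fs n \<in> U" using fs lim by (intro compact_open_eventually)
  then show "\<forall>\<^sub>F n in F. \<Phi> (fs n) \<in> V" by eventually_elim (simp add: U_def)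
qed

text \<open>\<open>interp\<close> as a function of the vector of grid values. Indexing by the whole
  type makes the vectors range over a product space, where continuity implies Borel
  measurability.\<close>

definition grid_fun :: "nat \<Rightarrow> (int \<times> int \<Rightarrow> real) \<Rightarrow> plane \<Rightarrow> real" where
  "grid_fun n v x = (\<Sum>a\<in>grid_box n. v a * grid_wt n a x)"

lemma interp_grid_fun: "interp n f = grid_fun n (\<lambda>a. f (grid_pt n a))"
  by (simp add: interp_def grid_fun_def fun_eq_iff)

lemma continuous_on_grid_fun: "continuous_on S (grid_fun n v)"
  unfolding grid_fun_def grid_wt_def tent_def
  by (intro continuous_intros)

lemma grid_wt_le_1: "grid_wt n a x \<le> 1"
  unfolding grid_wt_def by (intro mult_le_one) (auto simp: tent_def)

text \<open>Only finitely many coordinates of \<open>v\<close> enter, so coordinatewise convergence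
  makes the interpolants converge uniformly, and the functional is continuous in
  \<open>v\<close>.\<close>

lemma measurable_functional_grid_fun:
  assumes \<Phi>: "continuous_map compact_open_topology euclideanreal \<Phi>"
  shows "(\<lambda>v. \<Phi> (grid_fun n v)) \<in> borel_measurable borel"
proof (rule borel_measurable_continuous_onI)
  show "continuous_on UNIV (\<lambda>v. \<Phi> (grid_fun n v))"
    unfolding continuous_on_sequentially
  proof (intro allI ballI impI)
    fix s :: "nat \<Rightarrow> int \<times> int \<Rightarrow> real" and v
    assume "(\<forall>k. s k \<in> UNIV) \<and> s \<longlonglongrightarrow> v"
    then have sv: "(\<lambda>k. s k a) \<longlonglongrightarrow> v a" for a
      using continuous_on_tendsto_compose[OF continuous_on_product_coordinates[of a], of s v sequentially] by simp
    have "(\<lambda>k. \<Phi> (grid_fun n (s k))) \<longlonglongrightarrow> \<Phi> (grid_fun n v)"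
    proof (rule compact_open_tendsto[OF \<Phi> continuous_on_grid_fun continuous_on_grid_fun])
      fix m
      have z: "(\<lambda>k. \<Sum>a\<in>grid_box n. \<bar>s k a - v a\<bar>) \<longlonglongrightarrow> 0"
        by (intro tendsto_null_sum tendsto_rabs_zero LIM_zero sv)
      show "uniform_limit (cball 0 (real m)) (\<lambda>k. grid_fun n (s k)) (grid_fun n v) sequentially"
      proof (rule uniform_limitI)
        fix e :: real assume "e > 0"
        then have "\<forall>\<^sub>F k in sequentially. (\<Sum>a\<in>grid_box n. \<bar>s k a - v a\<bar>) < e"
          using z by (intro order_tendstoD(2)[OF z])
        then show "\<forall>\<^sub>F k in sequentially. \<forall>x\<in>cball 0 (real m). dist (grid_fun n (s k) x) (grid_fun n v x) < e"
        proof eventually_elim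
          case (elim k)
          have "dist (grid_fun n (s k) x) (grid_fun n v x) \<le> (\<Sum>a\<in>grid_box n. \<bar>s k a - v a\<bar>)" for x
          proof -
            have "dist (grid_fun n (s k) x) (grid_fun n v x) = \<bar>\<Sum>a\<in>grid_box n. (s k a - v a) * grid_wt n a x\<bar>"
              by (simp add: dist_real_def grid_fun_def sum_subtractf left_diff_distrib)
            also have "\<dots> \<le> (\<Sum>a\<in>grid_box n. \<bar>s k a - v a\<bar>)"
              by (rule order_trans[OF sum_abs sum_mono]) (simp add: abs_mult mult_left_le grid_wt_le_1)
            finally show ?thesis .
          qed
          then show ?case using elim order_le_less_trans by blast
        qed
      qed
    qed
    then show "((\<lambda>v. \<Phi> (grid_fun n v)) \<circ> s) \<longlonglongrightarrow> \<Phi> (grid_fun n v)" by (simp add: o_def)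
  qed
qed

lemma measurable_functional_interp:
  assumes \<Phi>: "continuous_map compact_open_topology euclideanreal \<Phi>"
    and Z: "\<And>u. Z u \<in> borel_measurable M"
  shows "(\<lambda>\<omega>. \<Phi> (interp n (\<lambda>u. Z u \<omega>))) \<in> borel_measurable M"
proof -
  have "(\<lambda>\<omega> a. Z (grid_pt n a) \<omega>) \<in> borel_measurable M"
    by (intro measurable_coordinatewise_then_product Z)
  from measurable_compose[OF this measurable_functional_grid_fun[OF \<Phi>]]
  show ?thesis unfolding interp_grid_fun .
qed

lemma functional_interp_tendsto:
  assumes \<Phi>: "continuous_map compact_open_topology euclideanreal \<Phi>"
    and f: "continuous_on UNIV f"
  shows "(\<lambda>n. \<Phi> (interp n f)) \<longlonglongrightarrow> \<Phi> f"
  by (rule compact_open_tendsto[OF \<Phi> f continuous_on_interp uniform_limit_interp[OF f]])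

text \<open>The functional of a path is the limit of its values at the interpolants, and each of
  these is a Borel function of finitely many values of the field.\<close>

lemma measurable_functional:
  assumes \<Phi>: "continuous_map compact_open_topology euclideanreal \<Phi>"
    and Z: "continuous_field M Z"
  shows "(\<lambda>\<omega>. \<Phi> (\<lambda>u. Z u \<omega>)) \<in> borel_measurable M"
proof (rule borel_measurable_LIMSEQ_real)
  show "(\<lambda>n. \<Phi> (interp n (\<lambda>u. Z u \<omega>))) \<longlonglongrightarrow> \<Phi> (\<lambda>u. Z u \<omega>)" if "\<omega> \<in> space M" for \<omega>
    using Z that by (intro functional_interp_tendsto[OF \<Phi>]) (auto simp: continuous_field_def)
  show "(\<lambda>\<omega>. \<Phi> (interp n (\<lambda>u. Z u \<omega>))) \<in> borel_measurable M" for n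
    using Z by (intro measurable_functional_interp[OF \<Phi>]) (auto simp: continuous_field_def)
qed

lemma functional_expectation_interp_tendsto:
  assumes "prob_space M" and \<Phi>: "continuous_map compact_open_topology euclideanreal \<Phi>"
    and B: "\<And>f. f \<in> topspace compact_open_topology \<Longrightarrow> \<bar>\<Phi> f\<bar> \<le> B"
    and Z: "continuous_field M Z"
  shows "(\<lambda>n. \<integral>\<omega>. \<Phi> (interp n (\<lambda>u. Z u \<omega>)) \<partial>M) \<longlonglongrightarrow> (\<integral>\<omega>. \<Phi> (\<lambda>u. Z u \<omega>) \<partial>M)"
proof (rule integral_dominated_convergence[where w="\<lambda>_. B"])
  interpret prob_space M by fact
  show "integrable M (\<lambda>_. B)" by simp
  show "(\<lambda>\<omega>. \<Phi> (\<lambda>u. Z u \<omega>)) \<in> borel_measurable M" by (rule measurable_functional[OF \<Phi> Z])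
  show "(\<lambda>\<omega>. \<Phi> (interp n (\<lambda>u. Z u \<omega>))) \<in> borel_measurable M" for n
    using Z by (intro measurable_functional_interp[OF \<Phi>]) (auto simp: continuous_field_def)
  show "AE \<omega> in M. (\<lambda>n. \<Phi> (interp n (\<lambda>u. Z u \<omega>))) \<longlonglongrightarrow> \<Phi> (\<lambda>u. Z u \<omega>)"
    using Z by (intro AE_I2 functional_interp_tendsto[OF \<Phi>]) (auto simp: continuous_field_def)
  show "AE \<omega> in M. norm (\<Phi> (interp n (\<lambda>u. Z u \<omega>))) \<le> B" for n
    using B by (intro AE_I2) (simp add: topspace_compact_open continuous_on_interp)
qed

text \<open>The expectation at an interpolant depends only on a finite-dimensional law; refining the
  grids carries the equality over to the fields. This is what permits replacing a field by a coupled
  one.\<close>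

lemma same_fdd_functional:
  assumes M: "prob_space M" and N: "prob_space N"
    and \<Phi>: "continuous_map compact_open_topology euclideanreal \<Phi>"
    and B: "\<And>f. f \<in> topspace compact_open_topology \<Longrightarrow> \<bar>\<Phi> f\<bar> \<le> B"
    and Z: "continuous_field M Z" "continuous_field N Z'" and same: "same_fdd M Z N Z'"
  shows "(\<integral>\<omega>. \<Phi> (\<lambda>u. Z u \<omega>) \<partial>M) = (\<integral>\<omega>. \<Phi> (\<lambda>u. Z' u \<omega>) \<partial>N)"
proof (rule LIMSEQ_unique)
  show "(\<lambda>n. \<integral>\<omega>. \<Phi> (interp n (\<lambda>u. Z u \<omega>)) \<partial>M) \<longlonglongrightarrow> (\<integral>\<omega>. \<Phi> (\<lambda>u. Z u \<omega>) \<partial>M)"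
    by (rule functional_expectation_interp_tendsto[OF M \<Phi> B Z(1)])
  have "(\<integral>\<omega>. \<Phi> (interp n (\<lambda>u. Z u \<omega>)) \<partial>M) = (\<integral>\<omega>. \<Phi> (interp n (\<lambda>u. Z' u \<omega>)) \<partial>N)" for n
  proof -
    define G where "G = grid_pt n ` grid_box n"
    have G: "finite G" by (simp add: G_def)
    \<comment> \<open>The value 0 outside the grid makes \<open>F\<close> a function of the
      coordinates in \<open>G\<close> alone, as the finite product space requires.\<close>
    define F where "F v = \<Phi> (grid_fun n (\<lambda>a. if a \<in> grid_box n then v (grid_pt n a) else 0))" for v
    have "(\<lambda>v a. if a \<in> grid_box n then v (grid_pt n a) else 0) \<in> borel_measurable (\<Pi>\<^sub>M x\<in>G. (borel :: real measure))"
    proof (rule measurable_coordinatewise_then_product)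
      fix a
      show "(\<lambda>v. if a \<in> grid_box n then v (grid_pt n a) else 0) \<in> borel_measurable (\<Pi>\<^sub>M x\<in>G. (borel :: real measure))"
        by (cases "a \<in> grid_box n") (auto simp: G_def)
    qed
    from measurable_compose[OF this measurable_functional_grid_fun[OF \<Phi>]]
    have F: "F \<in> borel_measurable (\<Pi>\<^sub>M x\<in>G. (borel :: real measure))" unfolding F_def .
    have *: "(\<integral>\<omega>. \<Phi> (interp n (\<lambda>u. V u \<omega>)) \<partial>K) = (\<integral>v. F v \<partial>distr K (\<Pi>\<^sub>M x\<in>G. borel) (\<lambda>\<omega>. \<lambda>x\<in>G. V x \<omega>))"
      if V: "continuous_field K V" for K :: "'k measure" and V
    proof -
      have "(\<lambda>\<omega>. \<lambda>x\<in>G. V x \<omega>) \<in> measurable K (\<Pi>\<^sub>M x\<in>G. borel)"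
        using V by (intro measurable_restrict) (auto simp: continuous_field_def)
      then have "(\<integral>v. F v \<partial>distr K (\<Pi>\<^sub>M x\<in>G. borel) (\<lambda>\<omega>. \<lambda>x\<in>G. V x \<omega>)) = (\<integral>\<omega>. F (\<lambda>x\<in>G. V x \<omega>) \<partial>K)"
        by (rule integral_distr[OF _ F])
      moreover have "grid_fun n (\<lambda>a. if a \<in> grid_box n then (\<lambda>x\<in>G. V x \<omega>) (grid_pt n a) else 0) = interp n (\<lambda>u. V u \<omega>)" for \<omega>
        unfolding interp_grid_fun grid_fun_def by (intro ext sum.cong) (auto simp: G_def)
      ultimately show ?thesis by (simp add: F_def)
    qed
    show ?thesis
      using same G unfolding *[OF Z(1)] *[OF Z(2)] same_fdd_def by simp
  qed
  then show "(\<lambda>n. \<integral>\<omega>. \<Phi> (interp n (\<lambda>u. Z u \<omega>)) \<partial>M) \<longlonglongrightarrow> (\<integral>\<omega>. \<Phi> (\<lambda>u. Z' u \<omega>) \<partial>N)"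
    using functional_expectation_interp_tendsto[OF N \<Phi> B Z(2)] by simp
qed

text \<open>The weak limit is obtained from a coupling: \<^term>\<open>Zt r\<close> has the law of \<^term>\<open>Z r\<close> and is close to
  \<^term>\<open>Y\<close> in probability.  If the expectations of some functional did not converge, one could
  choose \<^term>\<open>r\<close> violating convergence with an error at most \<open>2^-k\<close> on the ball of radius \<open>k\<close>,
  and the Borel--Cantelli argument would give almost sure convergence.\<close>

lemma converges_weakly_coupling:
  assumes M: "prob_space M" and Y: "continuous_field M Y"
    and Z: "\<forall>\<^sub>F r in F. continuous_field M (Z r) \<and> continuous_field M (Zt r) \<and> same_fdd M (Z r) M (Zt r)"
    and close: "\<And>m e. 0 < e \<Longrightarrow> \<forall>\<^sub>F r in F. \<exists>D. D \<in> borel_measurable M \<and> (\<integral>\<^sup>+\<omega>. D \<omega> \<partial>M) \<le> ennreal e \<and>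
        (\<forall>\<omega>\<in>space M. \<forall>x. norm x \<le> real m \<longrightarrow> ennreal \<bar>Zt r x \<omega> - Y x \<omega>\<bar> \<le> D \<omega>)"
  shows "converges_weakly M Z M Y F"
  unfolding converges_weakly_def
proof (intro allI impI, elim conjE exE)
  interpret prob_space M by fact
  fix \<Phi> B assume \<Phi>: "continuous_map compact_open_topology euclideanreal \<Phi>"
    and B: "\<forall>f\<in>topspace compact_open_topology. \<bar>\<Phi> f\<bar> \<le> B"
  have B': "\<And>f. f \<in> topspace compact_open_topology \<Longrightarrow> \<bar>\<Phi> f\<bar> \<le> B" using B by blast
  show "((\<lambda>r. \<integral>\<omega>. \<Phi> (\<lambda>u. Z r u \<omega>) \<partial>M) \<longlongrightarrow> (\<integral>\<omega>. \<Phi> (\<lambda>u. Y u \<omega>) \<partial>M)) F"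
  proof (rule ccontr)
    assume "\<not> ?thesis"
    then obtain e where e: "e > 0" and "\<not> (\<forall>\<^sub>F r in F. dist (\<integral>\<omega>. \<Phi> (\<lambda>u. Z r u \<omega>) \<partial>M) (\<integral>\<omega>. \<Phi> (\<lambda>u. Y u \<omega>) \<partial>M) < e)"
      unfolding tendsto_iff by blast
    then have fr: "\<exists>\<^sub>F r in F. \<not> dist (\<integral>\<omega>. \<Phi> (\<lambda>u. Z r u \<omega>) \<partial>M) (\<integral>\<omega>. \<Phi> (\<lambda>u. Y u \<omega>) \<partial>M) < e"
      by (simp add: not_eventually)
    have "\<exists>r. \<not> dist (\<integral>\<omega>. \<Phi> (\<lambda>u. Z r u \<omega>) \<partial>M) (\<integral>\<omega>. \<Phi> (\<lambda>u. Y u \<omega>) \<partial>M) < e \<and>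
       continuous_field M (Z r) \<and> continuous_field M (Zt r) \<and> same_fdd M (Z r) M (Zt r) \<and>
       (\<exists>D. D \<in> borel_measurable M \<and> (\<integral>\<^sup>+\<omega>. D \<omega> \<partial>M) \<le> ennreal ((1/2) ^ k) \<and>
        (\<forall>\<omega>\<in>space M. \<forall>x. norm x \<le> real k \<longrightarrow> ennreal \<bar>Zt r x \<omega> - Y x \<omega>\<bar> \<le> D \<omega>))" for k
      using frequently_ex[OF frequently_eventually_frequently[OF fr eventually_conj[OF Z close[of "(1/2)^k" k]]]] by auto
    then obtain r D where r: "\<And>k. \<not> dist (\<integral>\<omega>. \<Phi> (\<lambda>u. Z (r k) u \<omega>) \<partial>M) (\<integral>\<omega>. \<Phi> (\<lambda>u. Y u \<omega>) \<partial>M) < e"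
       "\<And>k. continuous_field M (Z (r k))" "\<And>k. continuous_field M (Zt (r k))" "\<And>k. same_fdd M (Z (r k)) M (Zt (r k))"
      and D[measurable]: "\<And>k. D k \<in> borel_measurable M" and D1: "\<And>k. (\<integral>\<^sup>+\<omega>. D k \<omega> \<partial>M) \<le> ennreal ((1/2) ^ k)"
      and D2: "\<And>k \<omega> x. \<omega> \<in> space M \<Longrightarrow> norm x \<le> real k \<Longrightarrow> ennreal \<bar>Zt (r k) x \<omega> - Y x \<omega>\<bar> \<le> D k \<omega>"
      by metis
    have "AE \<omega> in M. (\<Sum>k. D k \<omega>) \<noteq> \<infinity>"
    proof (rule nn_integral_PInf_AE)
      have "(\<integral>\<^sup>+\<omega>. (\<Sum>k. D k \<omega>) \<partial>M) = (\<Sum>k. \<integral>\<^sup>+\<omega>. D k \<omega> \<partial>M)" by (rule nn_integral_suminf) simp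
      also have "\<dots> \<le> (\<Sum>k. ennreal ((1/2) ^ k))" by (intro suminf_le D1 summableI)
      also have "\<dots> = ennreal (\<Sum>k. (1/2) ^ k)" by (intro suminf_ennreal2 summable_geometric) auto
      finally show "(\<integral>\<^sup>+\<omega>. (\<Sum>k. D k \<omega>) \<partial>M) \<noteq> \<infinity>" by (metis ennreal_less_top infinity_ennreal_def leD)
    qed measurable
    then have conv: "AE \<omega> in M. (\<lambda>k. \<Phi> (\<lambda>u. Zt (r k) u \<omega>)) \<longlonglongrightarrow> \<Phi> (\<lambda>u. Y u \<omega>)"
    proof (rule AE_mp, intro AE_I2 impI)
      fix \<omega> assume \<omega>: "\<omega> \<in> space M" and fin: "(\<Sum>k. D k \<omega>) \<noteq> \<infinity>"
      have "D k \<omega> < top" for k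
        using fin sum_le_suminf[of "\<lambda>k. D k \<omega>" "{k}"] by (auto simp: less_top top_unique)
      then have D': "ennreal (enn2real (D k \<omega>)) = D k \<omega>" for k by simp
      have "summable (\<lambda>k. enn2real (D k \<omega>))"
        using fin by (intro summable_suminf_not_top) (auto simp: D')
      then have D0: "(\<lambda>k. enn2real (D k \<omega>)) \<longlonglongrightarrow> 0" by (rule summable_LIMSEQ_zero)
      show "(\<lambda>k. \<Phi> (\<lambda>u. Zt (r k) u \<omega>)) \<longlonglongrightarrow> \<Phi> (\<lambda>u. Y u \<omega>)"
      proof (rule compact_open_tendsto[OF \<Phi>])
        fix m
        show "uniform_limit (cball 0 (real m)) (\<lambda>k u. Zt (r k) u \<omega>) (\<lambda>u. Y u \<omega>) sequentially"
        proof (rule uniform_limitI)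
          fix d :: real assume "d > 0"
          then have "\<forall>\<^sub>F k in sequentially. enn2real (D k \<omega>) < d" by (rule order_tendstoD(2)[OF D0])
          then show "\<forall>\<^sub>F k in sequentially. \<forall>x\<in>cball 0 (real m). dist (Zt (r k) x \<omega>) (Y x \<omega>) < d"
            using eventually_ge_at_top[of m]
          proof eventually_elim
            case (elim k)
            show ?case
            proof
              fix x :: plane assume "x \<in> cball 0 (real m)"
              then have "ennreal \<bar>Zt (r k) x \<omega> - Y x \<omega>\<bar> \<le> ennreal (enn2real (D k \<omega>))"
                unfolding D' using elim \<omega> by (intro D2) auto
              then show "dist (Zt (r k) x \<omega>) (Y x \<omega>) < d" using elim by (simp add: dist_real_def)
            qed
          qed
        qed
      qed (use Y r(3) \<omega> in \<open>auto simp: continuous_field_def\<close>)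
    qed
    have "(\<lambda>k. \<integral>\<omega>. \<Phi> (\<lambda>u. Zt (r k) u \<omega>) \<partial>M) \<longlonglongrightarrow> (\<integral>\<omega>. \<Phi> (\<lambda>u. Y u \<omega>) \<partial>M)"
    proof (rule integral_dominated_convergence[where w="\<lambda>_. B"])
      show "AE \<omega> in M. norm (\<Phi> (\<lambda>u. Zt (r k) u \<omega>)) \<le> B" for k
        using B r(3) by (intro AE_I2) (auto simp: topspace_compact_open continuous_field_def)
    qed (use conv measurable_functional[OF \<Phi>] Y r(3) in auto)
    moreover have "(\<integral>\<omega>. \<Phi> (\<lambda>u. Z (r k) u \<omega>) \<partial>M) = (\<integral>\<omega>. \<Phi> (\<lambda>u. Zt (r k) u \<omega>) \<partial>M)" for k
      by (rule same_fdd_functional[OF M M \<Phi> B' r(2,3,4)])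
    ultimately have "(\<lambda>k. \<integral>\<omega>. \<Phi> (\<lambda>u. Z (r k) u \<omega>) \<partial>M) \<longlonglongrightarrow> (\<integral>\<omega>. \<Phi> (\<lambda>u. Y u \<omega>) \<partial>M)" by simp
    from tendstoD[OF this e] show False using r(1) by (auto dest: eventually_happens)
  qed
qed

section \<open>Cones, sectors and kernel estimates\<close>

lemma lborel_plane_scale:
  fixes c :: real
  assumes "c > 0"
  shows "(lborel :: plane measure) = density (distr lborel borel (\<lambda>x. c *\<^sub>R x)) (\<lambda>_. ennreal (c\<^sup>2))"
  using lborel_affine[of c "0 :: plane"] assms by simp

lemma nn_integral_plane_scale:
  fixes f :: "plane \<Rightarrow> ennreal"
  assumes [measurable]: "f \<in> borel_measurable borel" and c: "c > 0"
  shows "(\<integral>\<^sup>+\<xi>. f \<xi> \<partial>lborel) = ennreal (c\<^sup>2) * (\<integral>\<^sup>+\<xi>. f (c *\<^sub>R \<xi>) \<partial>lborel)"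
  by (subst lborel_plane_scale[OF c]) (simp add: nn_integral_density nn_integral_distr nn_integral_cmult)

lemma integral_plane_scale:
  fixes f :: "plane \<Rightarrow> real"
  assumes [measurable]: "f \<in> borel_measurable borel" and c: "c > 0"
  shows "(\<integral>\<xi>. f \<xi> \<partial>lborel) = c\<^sup>2 * (\<integral>\<xi>. f (c *\<^sub>R \<xi>) \<partial>lborel)"
  by (subst lborel_plane_scale[OF c]) (simp add: integral_density integral_distr)

lemma integrable_plane_scale:
  fixes f :: "plane \<Rightarrow> real"
  assumes [measurable]: "f \<in> borel_measurable borel" and c: "c > 0" and f: "integrable lborel f"
  shows "integrable lborel (\<lambda>\<xi>. f (c *\<^sub>R \<xi>))"
proof -
  have "integrable (density (distr lborel borel (\<lambda>x. c *\<^sub>R x)) (\<lambda>_. ennreal (c\<^sup>2))) f"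
    using f by (subst lborel_plane_scale[OF c, symmetric])
  then show ?thesis using c by (simp add: integrable_density integrable_distr_eq)
qed

definition scaling_cone :: "plane set \<Rightarrow> bool" where
  "scaling_cone S \<longleftrightarrow> (\<forall>c>0. \<forall>\<xi>. c *\<^sub>R \<xi> \<in> S \<longleftrightarrow> \<xi> \<in> S)"

lemma emeasure_cone_cball:
  assumes S[measurable]: "S \<in> sets borel" and cone: "scaling_cone S" and R: "R > 0"
  shows "emeasure lborel (S \<inter> cball 0 R) = ennreal (R\<^sup>2) * emeasure lborel (S \<inter> cball 0 1)"
proof -
  have [measurable]: "S \<inter> cball 0 R \<in> sets borel" by (intro sets.Int S borel_closed closed_cball)
  have "emeasure lborel (S \<inter> cball 0 R) = (\<integral>\<^sup>+\<xi>. indicator (S \<inter> cball 0 R) \<xi> \<partial>lborel)"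
    by simp
  also have "\<dots> = ennreal (R\<^sup>2) * (\<integral>\<^sup>+\<xi>. indicator (S \<inter> cball 0 R) (R *\<^sub>R \<xi>) \<partial>lborel)"
    by (rule nn_integral_plane_scale) (use R in auto)
  also have "(\<lambda>\<xi>. indicator (S \<inter> cball 0 R) (R *\<^sub>R \<xi>) :: ennreal) = indicator (S \<inter> cball 0 1)"
    using R cone by (auto simp: fun_eq_iff indicator_def scaling_cone_def mult_le_cancel_left1)
  finally show ?thesis by simp
qed

text \<open>One majorant for the squared radial factors of all kernels: in the plane t^(\<kappa> -
  2) is integrable at 0 and t^(-\<kappa> - 2) at infinity.\<close>

definition radial_weight :: "real \<Rightarrow> real \<Rightarrow> real" where
  "radial_weight \<kappa> t = (if t \<le> 1 then t powr (\<kappa> - 2) else t powr (- \<kappa> - 2))"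

lemma radial_weight_nonneg [simp]: "0 \<le> radial_weight \<kappa> t"
  by (simp add: radial_weight_def)

lemma measurable_radial_weight [measurable]: "radial_weight \<kappa> \<in> borel_measurable borel"
  unfolding radial_weight_def by measurable

lemma dyadic_above:
  fixes t :: real
  assumes "1 \<le> t"
  obtains n where "2 ^ n \<le> t" "t \<le> 2 ^ Suc n"
proof -
  define n where "n = nat \<lfloor>log 2 t\<rfloor>"
  have "0 \<le> log 2 t" using assms by simp
  then have n: "real n \<le> log 2 t" "log 2 t \<le> real n + 1" unfolding n_def by linarith+
  have "2 powr real n \<le> t" using n(1) assms by (simp add: le_log_iff)
  moreover have "t \<le> 2 powr (real n + 1)" using n(2) assms by (simp add: log_le_iff)
  ultimately have "2 ^ n \<le> t" "t \<le> 2 ^ Suc n"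
    using powr_realpow[of 2 n] powr_realpow[of 2 "Suc n"] by (auto simp: add.commute)
  then show ?thesis by (rule that)
qed

lemma term_le_suminf_ennreal: "(f n :: ennreal) \<le> (\<Sum>n. f n)"
  using sum_le_suminf[OF summableI, of "{n}" f] by simp

text \<open>A single term suffices, that of the dyadic shell containing \<open>t\<close>. The
  indicators are those of whole balls because the area of a cone inside a ball scales
  exactly.\<close>

lemma radial_weight_le_suminf:
  assumes \<kappa>: "0 < \<kappa>" "\<kappa> \<le> 1" and t: "t \<ge> 0"
  shows "ennreal (radial_weight \<kappa> t) \<le> (\<Sum>n. ennreal ((2 ^ Suc n) powr (2 - \<kappa>)) * indicator {..1 / 2 ^ n} t) +
       (\<Sum>n. ennreal ((2 ^ n) powr (- \<kappa> - 2)) * indicator {..2 ^ Suc n} t)"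
    (is "_ \<le> (\<Sum>n. ?a n) + (\<Sum>n. ?b n)")
proof (cases "t = 0 \<or> t > 1")
  case True
  show ?thesis
  proof (cases "t = 0")
    case False
    then have t1: "t > 1" using True by simp
    then obtain n where n: "2 ^ n \<le> t" "t \<le> 2 ^ Suc n" using dyadic_above[of t] by auto
    have "t powr (- \<kappa> - 2) \<le> (2 ^ n) powr (- \<kappa> - 2)"
      using n \<kappa> by (intro powr_mono2') auto
    then have "ennreal (radial_weight \<kappa> t) \<le> ?b n"
      using n(2) t1 by (auto simp: radial_weight_def intro!: ennreal_leI)
    also have "\<dots> \<le> (\<Sum>n. ?b n)" by (rule term_le_suminf_ennreal[of ?b])
    finally show ?thesis by (simp add: add_increasing)
  \<comment> \<open>At \<open>t = 0\<close> the weight is 0, since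
    \<open>0 powr x = 0\<close>.\<close>
  qed (simp add: radial_weight_def)
next
  case False
  then have t01: "0 < t" "t \<le> 1" using t by auto
  then obtain n where n: "2 ^ n \<le> 1 / t" "1 / t \<le> 2 ^ Suc n" using dyadic_above[of "1 / t"] by auto
  have tn: "t \<le> 1 / 2 ^ n" "1 / 2 ^ Suc n \<le> t" using n t01 by (simp_all add: field_simps)
  have "t powr (\<kappa> - 2) \<le> (1 / 2 ^ Suc n) powr (\<kappa> - 2)"
    using tn \<kappa> by (intro powr_mono2') auto
  also have "\<dots> = (2 ^ Suc n) powr (2 - \<kappa>)"
    by (simp only: powr_divide powr_minus_divide[symmetric] powr_one_eq_one minus_diff_eq zero_le_one zero_le_power zero_le_numeral)
  finally have "ennreal (radial_weight \<kappa> t) \<le> ?a n"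
    using tn(1) t01 by (auto simp: radial_weight_def intro!: ennreal_leI)
  also have "\<dots> \<le> (\<Sum>n. ?a n)" by (rule term_le_suminf_ennreal[of ?a])
  finally show ?thesis by (simp add: add_increasing2)
qed

text \<open>The sum of a geometric series with ratio 2^-\<kappa> and first term 8: 4 from the shells
  inside the unit disk and 4 from those outside.\<close>

definition cone_const :: "real \<Rightarrow> real" where
  "cone_const \<kappa> = 8 / (1 - 2 powr (- \<kappa>))"

lemma cone_const_pos: "0 < \<kappa> \<Longrightarrow> 0 < cone_const \<kappa>"
  by (simp add: cone_const_def powr_less_one)

text \<open>A substitute for polar coordinates: a cone has R^2 times as much area in the disk of
  radius R as in the unit disk, so the dyadic majorant sums to a geometric series.\<close>

lemma radial_weight_cone:
  assumes \<kappa>: "0 < \<kappa>" "\<kappa> \<le> 1" and S[measurable]: "S \<in> sets borel" and cone: "scaling_cone S"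
  shows "(\<integral>\<^sup>+\<xi>. ennreal (radial_weight \<kappa> (norm \<xi>)) * indicator S \<xi> \<partial>lborel)
     \<le> ennreal (cone_const \<kappa>) * emeasure lborel (S \<inter> cball 0 1)"
proof -
  define E where "E = emeasure lborel (S \<inter> cball 0 1)"
  have Sm[measurable]: "S \<inter> cball 0 R \<in> sets borel" for R by (intro sets.Int S borel_closed closed_cball)
  define x where "x = 2 powr (- \<kappa>)"
  have x: "0 < x" "x < 1" using \<kappa> by (auto simp: x_def powr_less_one)
  define a b :: "nat \<Rightarrow> real" where "a n = (2 ^ Suc n) powr (2 - \<kappa>)" and "b n = (2 ^ n) powr (- \<kappa> - 2)" for n
  \<comment> \<open>Each product is the weight at the worse end of a shell times the area factor of
    the ball enclosing it.\<close>
  have ab: "a n * (1 / 2 ^ n)\<^sup>2 \<le> 4 * x ^ n" "b n * (2 ^ Suc n)\<^sup>2 = 4 * x ^ n" for n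
  proof -
    define y :: real where "y = 2 ^ n"
    have y: "y > 0" by (simp add: y_def)
    have xy: "x ^ n = y powr (- \<kappa>)" by (simp add: x_def y_def powr_powr mult.commute flip: powr_realpow)
    have "a n = 2 powr (2 - \<kappa>) * y powr (2 - \<kappa>)" using y by (simp add: a_def y_def powr_mult)
    also have "\<dots> \<le> 4 * y powr (2 - \<kappa>)"
    proof (rule mult_right_mono)
      have "2 powr (2 - \<kappa>) \<le> 2 powr (2::real)" using \<kappa> by (intro powr_mono) auto
      then show "2 powr (2 - \<kappa>) \<le> (4::real)" by simp
    qed simp
    also have "y powr (2 - \<kappa>) = y\<^sup>2 * y powr (- \<kappa>)" using y powr_add[of y 2 "- \<kappa>"] by simp
    finally show "a n * (1 / 2 ^ n)\<^sup>2 \<le> 4 * x ^ n" using y unfolding xy y_def[symmetric]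
      by (simp add: field_simps power2_eq_square)
    have "b n = y powr (- \<kappa>) / y\<^sup>2" using y powr_diff[of y "- \<kappa>" 2] by (simp add: b_def y_def[symmetric])
    then show "b n * (2 ^ Suc n)\<^sup>2 = 4 * x ^ n" using y unfolding xy power_Suc y_def[symmetric]
      by (simp add: field_simps power2_eq_square)
  qed
  have "(\<integral>\<^sup>+\<xi>. ennreal (radial_weight \<kappa> (norm \<xi>)) * indicator S \<xi> \<partial>lborel) \<le>
     (\<integral>\<^sup>+\<xi>. (\<Sum>n. ennreal (a n) * indicator (S \<inter> cball 0 (1 / 2 ^ n)) \<xi>) + (\<Sum>n. ennreal (b n) * indicator (S \<inter> cball 0 (2 ^ Suc n)) \<xi>) \<partial>lborel)"
  proof (rule nn_integral_mono)
    fix \<xi> :: plane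
    show "ennreal (radial_weight \<kappa> (norm \<xi>)) * indicator S \<xi> \<le>
      (\<Sum>n. ennreal (a n) * indicator (S \<inter> cball 0 (1 / 2 ^ n)) \<xi>) + (\<Sum>n. ennreal (b n) * indicator (S \<inter> cball 0 (2 ^ Suc n)) \<xi>)"
    proof (cases "\<xi> \<in> S")
      case True
      have "indicator (S \<inter> cball 0 r) \<xi> = (indicator {..r} (norm \<xi>) :: ennreal)" for r
        using True by (simp add: indicator_def)
      then show ?thesis using radial_weight_le_suminf[OF \<kappa>, of "norm \<xi>"] True by (simp add: a_def b_def)
    qed simp
  qed
  also have "\<dots> = (\<Sum>n. ennreal (a n) * emeasure lborel (S \<inter> cball 0 (1 / 2 ^ n))) + (\<Sum>n. ennreal (b n) * emeasure lborel (S \<inter> cball 0 (2 ^ Suc n)))"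
    by (subst nn_integral_add) (simp_all add: nn_integral_suminf nn_integral_cmult_indicator del: power_Suc)
  also have "\<dots> = (\<Sum>n. ennreal (a n * (1 / 2 ^ n)\<^sup>2) * E) + (\<Sum>n. ennreal (b n * (2 ^ Suc n)\<^sup>2) * E)"
  proof -
    have "ennreal (a n) * emeasure lborel (S \<inter> cball 0 (1 / 2 ^ n)) = ennreal (a n * (1 / 2 ^ n)\<^sup>2) * E" for n
      using emeasure_cone_cball[OF S cone, of "1 / 2 ^ n"]
      by (simp only: E_def ennreal_mult'' zero_le_power2 mult.assoc) simp
    moreover have "ennreal (b n) * emeasure lborel (S \<inter> cball 0 (2 ^ Suc n)) = ennreal (b n * (2 ^ Suc n)\<^sup>2) * E" for n
      using emeasure_cone_cball[OF S cone, of "2 ^ Suc n"]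
      by (simp only: E_def ennreal_mult'' zero_le_power2 mult.assoc) simp
    ultimately show ?thesis by simp
  qed
  also have "\<dots> \<le> (\<Sum>n. ennreal (4 * x ^ n) * E) + (\<Sum>n. ennreal (4 * x ^ n) * E)"
    by (intro add_mono suminf_le summableI mult_right_mono ennreal_leI) (auto simp: ab simp del: power_Suc)
  also have "\<dots> = ennreal (\<Sum>n. 8 * x ^ n) * E"
  proof -
    have "(\<Sum>n. ennreal (4 * x ^ n) * E) = ennreal (\<Sum>n. 4 * x ^ n) * E"
      using x by (subst ennreal_suminf_multc, subst suminf_ennreal2) (auto intro!: summable_mult summable_geometric)
    moreover have "(\<Sum>n. 8 * x ^ n) = (\<Sum>n. 4 * x ^ n) + (\<Sum>n. 4 * x ^ n)"
      using x by (subst suminf_add) (auto intro!: summable_mult summable_geometric)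
    moreover have "0 \<le> (\<Sum>n. 4 * x ^ n)" using x by (intro suminf_nonneg summable_mult summable_geometric) auto
    ultimately show ?thesis by (simp only: distrib_right ennreal_plus)
  qed
  also have "(\<Sum>n. 8 * x ^ n) = cone_const \<kappa>"
    using x by (simp add: suminf_mult summable_geometric suminf_geometric cone_const_def x_def)
  finally show ?thesis unfolding E_def .
qed

section \<open>Directions and sectors\<close>

lemma unit_vec_nth [simp]: "unit_vec t $ 1 = cos t" "unit_vec t $ 2 = sin t"
  by (simp_all add: unit_vec_def)

lemma unit_vec_axis: "unit_vec t = cos t *\<^sub>R axis 1 1 + sin t *\<^sub>R axis 2 1"
  by (simp add: vec_eq_iff forall_2 axis_def)

lemma norm_plane: "norm (x :: plane) = sqrt ((x $ 1)\<^sup>2 + (x $ 2)\<^sup>2)"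
  by (simp add: norm_vec_def L2_set_def sum_2)

lemma norm_unit_vec [simp]: "norm (unit_vec t) = 1"
  by (simp add: norm_plane)

lemma plane_eq_iff: "(x :: plane) = y \<longleftrightarrow> x $ 1 = y $ 1 \<and> x $ 2 = y $ 2"
  by (simp add: vec_eq_iff forall_2)

text \<open>For \<open>\<xi> = 0\<close> the equation on the right holds for every \<open>t\<close>:
  the origin belongs to every sector with a nonempty range of angles.\<close>

lemma arg_in_iff: "arg_in \<xi> S \<longleftrightarrow> (\<exists>t\<in>S. \<xi> = norm \<xi> *\<^sub>R unit_vec t)"
proof -
  have "cmod (Complex (\<xi> $ 1) (\<xi> $ 2)) = norm \<xi>" by (simp add: cmod_def norm_plane)
  then show ?thesis
    by (auto simp: arg_in_def is_Arg_def plane_eq_iff complex_eq_iff Re_exp Im_exp)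
qed

lemma norm_unit_vec_diff: "norm (unit_vec s - unit_vec t) \<le> \<bar>s - t\<bar>"
proof -
  have "(norm (unit_vec s - unit_vec t))\<^sup>2 = (cos s - cos t)\<^sup>2 + (sin s - sin t)\<^sup>2"
    by (simp add: norm_plane)
  also have "\<dots> = (norm (cis s - cis t))\<^sup>2" by (simp add: cmod_power2)
  also have "cis s - cis t = cis t * (cis (s - t) - 1)" by (simp add: right_diff_distrib cis_mult)
  also have "norm \<dots> = 2 * \<bar>sin ((s - t) / 2)\<bar>"
    using dist_exp_i_1[of "s - t"] by (simp add: norm_mult cis_conv_exp)
  also have "(2 * \<bar>sin ((s - t) / 2)\<bar>)\<^sup>2 \<le> \<bar>s - t\<bar>\<^sup>2"
    using abs_sin_x_le_abs_x[of "(s - t) / 2"] by (intro power_mono) auto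
  finally show ?thesis by (rule power2_le_imp_le) simp
qed

definition sector :: "real \<Rightarrow> real \<Rightarrow> plane set" where
  "sector t \<theta> = {\<xi>. arg_in \<xi> {t - \<theta>..t + \<theta>}}"

text \<open>The set is the projection, along the compact interval of angles, of a closed set of
  pairs. This avoids the discontinuity of the principal argument.\<close>

lemma closed_arg_in: "closed {\<xi>. arg_in \<xi> {p..q}}"
proof -
  have c: "continuous_on UNIV (\<lambda>z :: real \<times> plane. unit_vec (fst z))"
    unfolding unit_vec_axis by (intro continuous_intros)
  have "{\<xi>. arg_in \<xi> {p..q}} = {\<xi>. \<exists>t. t \<in> {p..q} \<and> (t, \<xi>) \<in> {z. snd z = norm (snd z) *\<^sub>R unit_vec (fst z)}}"
    by (auto simp: arg_in_iff)
  also have "closed \<dots>"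
    by (intro closed_compact_projection closed_Collect_eq continuous_intros c) auto
  finally show ?thesis .
qed

lemma sets_arg_in [measurable]: "{\<xi>. arg_in \<xi> {p..q}} \<in> sets borel"
  by (intro borel_closed closed_arg_in)

lemma arg_in_scale: "c > 0 \<Longrightarrow> arg_in (c *\<^sub>R \<xi>) S \<longleftrightarrow> arg_in \<xi> S"
  by (simp add: arg_in_iff flip: scaleR_scaleR)

lemma scaling_cone_sector: "scaling_cone (sector t \<theta>)"
  by (simp add: scaling_cone_def sector_def arg_in_scale)

lemma sets_sector [measurable]: "sector t \<theta> \<in> sets borel"
  unfolding sector_def by (rule sets_arg_in)

definition disk_area :: real where
  "disk_area = unit_ball_vol 2"

lemma disk_area_nonneg: "0 \<le> disk_area"
  by (simp add: disk_area_def)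

lemma emeasure_disk: "r \<ge> 0 \<Longrightarrow> emeasure lborel (cball (c :: plane) r) = ennreal (disk_area * r\<^sup>2)"
  by (simp add: emeasure_cball disk_area_def)

text \<open>A thin sector is covered by about $1/\theta$ disks of radius $2\theta$ centred on its axis.\<close>

lemma sector_area:
  assumes \<theta>: "\<theta> > 0"
  shows "emeasure lborel (sector t \<theta> \<inter> cball 0 1) \<le> ennreal (12 * disk_area * \<theta>)"
proof (cases "\<theta> \<le> 1")
  case False
  have "emeasure lborel (sector t \<theta> \<inter> cball 0 1) \<le> emeasure lborel (cball (0::plane) 1)"
    by (intro emeasure_mono) auto
  also have "\<dots> = ennreal disk_area" by (simp add: emeasure_disk)
  also have "\<dots> \<le> ennreal (12 * disk_area * \<theta>)"
    using False disk_area_nonneg mult_mono[of 1 "12 * \<theta>" disk_area disk_area] by (intro ennreal_leI) (simp add: mult_ac)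
  finally show ?thesis .
next
  case True
  define N where "N = nat \<lceil>1 / \<theta>\<rceil>"
  have "0 \<le> 1 / \<theta>" using \<theta> by simp
  then have N: "1 / \<theta> \<le> real N" "real N \<le> 1 / \<theta> + 1" unfolding N_def by linarith+
  have N0: "real N > 0" using N(1) \<theta> by (smt (verit) divide_pos_pos)
  have N1: "1 / real N \<le> \<theta>" using N(1) N0 \<theta> by (simp add: field_simps)
  have sub: "sector t \<theta> \<inter> cball 0 1 \<subseteq> (\<Union>j\<in>{..N}. cball ((real j / real N) *\<^sub>R unit_vec t) (2 * \<theta>))"
  proof
    fix \<xi> assume "\<xi> \<in> sector t \<theta> \<inter> cball 0 1"
    then obtain s where s: "\<bar>s - t\<bar> \<le> \<theta>" "\<xi> = norm \<xi> *\<^sub>R unit_vec s" and n: "norm \<xi> \<le> 1"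
      by (auto simp: sector_def arg_in_iff abs_le_iff) (metis atLeastAtMost_iff diff_le_eq le_diff_eq add.commute)
    define r where "r = norm \<xi>"
    define j where "j = nat \<lfloor>r * real N\<rfloor>"
    have r: "0 \<le> r" "r \<le> 1" using n by (auto simp: r_def)
    have rN: "0 \<le> r * real N" "r * real N \<le> real N" using r N0 by (auto simp: mult_left_le_one_le)
    then have j: "real j \<le> r * real N" "r * real N \<le> real j + 1" unfolding j_def by linarith+
    then have "real j \<le> real N" using rN by linarith
    then have "j \<in> {..N}" by simp
    have "\<bar>r - real j / real N\<bar> \<le> 1 / real N"
    proof -
      have "r - real j / real N = (r * real N - real j) / real N" using N0 by (simp add: field_simps)
      moreover have "\<bar>r * real N - real j\<bar> \<le> 1" using j by linarith
      ultimately show ?thesis using N0 by (simp add: divide_right_mono)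
    qed
    then have rj: "\<bar>r - real j / real N\<bar> \<le> \<theta>" using N1 by linarith
    \<comment> \<open>Of the radius \<open>2 * \<theta>\<close>, one \<theta> pays for the angle and
      the other for the position along the axis, where the centres are \<open>1 / N\<close>
      apart.\<close>
    have "norm (\<xi> - (real j / real N) *\<^sub>R unit_vec t) = norm (r *\<^sub>R (unit_vec s - unit_vec t) + (r - real j / real N) *\<^sub>R unit_vec t)"
      by (subst s(2)) (simp add: r_def[symmetric] algebra_simps)
    also have "\<dots> \<le> r * norm (unit_vec s - unit_vec t) + \<bar>r - real j / real N\<bar>"
      using r by (intro norm_triangle_le) simp
    also have "\<dots> \<le> 1 * \<theta> + \<theta>"
      using r s(1) norm_unit_vec_diff[of s t] rj by (intro add_mono mult_mono) auto
    finally have "\<xi> \<in> cball ((real j / real N) *\<^sub>R unit_vec t) (2 * \<theta>)" by (simp add: dist_norm norm_minus_commute)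
    then show "\<xi> \<in> (\<Union>j\<in>{..N}. cball ((real j / real N) *\<^sub>R unit_vec t) (2 * \<theta>))" using \<open>j \<in> {..N}\<close> by blast
  qed
  have "emeasure lborel (sector t \<theta> \<inter> cball 0 1) \<le> emeasure lborel (\<Union>j\<in>{..N}. cball ((real j / real N) *\<^sub>R unit_vec t) (2 * \<theta>))"
    by (rule emeasure_mono[OF sub]) auto
  also have "\<dots> \<le> (\<Sum>j\<in>{..N}. emeasure lborel (cball ((real j / real N) *\<^sub>R unit_vec t) (2 * \<theta>)))"
    by (intro emeasure_subadditive_finite) auto
  also have "\<dots> = (\<Sum>j\<in>{..N}. ennreal (disk_area * (2 * \<theta>)\<^sup>2))"
    using \<theta> by (intro sum.cong refl emeasure_disk) auto
  also have "\<dots> = ennreal ((real N + 1) * (disk_area * (2 * \<theta>)\<^sup>2))"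
    using disk_area_nonneg by (subst sum_ennreal) (auto simp: add.commute)
  also have "\<dots> \<le> ennreal (12 * disk_area * \<theta>)"
  proof (rule ennreal_leI)
    \<comment> \<open>The constant 12 is 3 times 4: each of the \<open>N + 1\<close> disks has area
      \<open>4 * disk_area * \<theta>\<^sup>2\<close>, and \<open>(N + 1) * \<theta>\<close> is at
      most 3.\<close>
    have "(real N + 1) * \<theta> \<le> (1 / \<theta> + 2) * \<theta>" using N(2) \<theta> by (intro mult_right_mono) auto
    also have "\<dots> \<le> 3" using \<theta> True by (simp add: field_simps)
    finally have "((real N + 1) * \<theta>) * (disk_area * 4 * \<theta>) \<le> 3 * (disk_area * 4 * \<theta>)"
      using \<theta> disk_area_nonneg by (intro mult_right_mono) auto
    then show "(real N + 1) * (disk_area * (2 * \<theta>)\<^sup>2) \<le> 12 * disk_area * \<theta>"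
      by (simp add: power2_eq_square mult_ac)
  qed
  finally show ?thesis .
qed

text \<open>A common constant: it bounds the integral of the weight over a sector per unit of
  half-opening, and also the integral over the whole plane.\<close>

definition weight_total :: "real \<Rightarrow> real" where
  "weight_total \<kappa> = cone_const \<kappa> * 12 * disk_area"

lemma weight_total_nonneg: "0 < \<kappa> \<Longrightarrow> 0 \<le> weight_total \<kappa>"
  using cone_const_pos[of \<kappa>] disk_area_nonneg by (simp add: weight_total_def)

text \<open>The bound is linear in \<theta>; this is why a change of \<alpha> enters the squared
  distance of kernels to the first power.\<close>

lemma radial_weight_sector:
  assumes \<kappa>: "0 < \<kappa>" "\<kappa> \<le> 1" and \<theta>: "\<theta> > 0"
  shows "(\<integral>\<^sup>+\<xi>. ennreal (radial_weight \<kappa> (norm \<xi>)) * indicator (sector t \<theta>) \<xi> \<partial>lborel) \<le> ennreal (weight_total \<kappa> * \<theta>)"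
proof -
  have "(\<integral>\<^sup>+\<xi>. ennreal (radial_weight \<kappa> (norm \<xi>)) * indicator (sector t \<theta>) \<xi> \<partial>lborel)
     \<le> ennreal (cone_const \<kappa>) * emeasure lborel (sector t \<theta> \<inter> cball 0 1)"
    by (rule radial_weight_cone[OF \<kappa> sets_sector scaling_cone_sector])
  also have "\<dots> \<le> ennreal (cone_const \<kappa>) * ennreal (12 * disk_area * \<theta>)"
    by (intro mult_left_mono sector_area \<theta>) auto
  also have "\<dots> = ennreal (weight_total \<kappa> * \<theta>)"
    using cone_const_pos[OF \<kappa>(1)] disk_area_nonneg \<theta>
    by (simp add: weight_total_def mult.assoc flip: ennreal_mult)
  finally show ?thesis .
qed

lemma radial_weight_plane:
  assumes \<kappa>: "0 < \<kappa>" "\<kappa> \<le> 1"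
  shows "(\<integral>\<^sup>+\<xi>. ennreal (radial_weight \<kappa> (norm (\<xi>::plane))) \<partial>lborel) \<le> ennreal (weight_total \<kappa>)"
proof -
  have "(\<integral>\<^sup>+\<xi>. ennreal (radial_weight \<kappa> (norm (\<xi>::plane))) \<partial>lborel) \<le> ennreal (cone_const \<kappa>) * emeasure lborel (UNIV \<inter> cball (0::plane) 1)"
    using radial_weight_cone[OF \<kappa>, of UNIV] by (simp add: scaling_cone_def)
  also have "\<dots> = ennreal (cone_const \<kappa> * disk_area)"
    using cone_const_pos[OF \<kappa>(1)] disk_area_nonneg by (simp add: emeasure_disk flip: ennreal_mult)
  also have "\<dots> \<le> ennreal (weight_total \<kappa>)"
    using cone_const_pos[OF \<kappa>(1)] disk_area_nonneg by (intro ennreal_leI) (simp add: weight_total_def)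
  finally show ?thesis .
qed

section \<open>Pointwise bounds for amplitudes and oscillating factors\<close>

lemma radial_weight_bound:
  assumes \<kappa>: "0 < \<kappa>" "\<kappa> \<le> a" "\<kappa> \<le> 1 - b" and h: "a \<le> h" "h \<le> b" and t: "0 < t"
  shows "min 1 (t\<^sup>2) * (t powr (- (h + 1)))\<^sup>2 \<le> radial_weight \<kappa> t"
proof -
  have sq: "(t powr (- (h + 1)))\<^sup>2 = t powr (- 2 * h - 2)"
    using t by (simp add: power2_eq_square flip: powr_add)
  show ?thesis
  proof (cases "t \<le> 1")
    case True
    have "t\<^sup>2 * t powr (- 2 * h - 2) = t powr (- 2 * h)" using t powr_add[of t 2 "- 2 * h - 2"] by simp
    also have "\<dots> \<le> t powr (\<kappa> - 2)" using True t \<kappa> h by (intro powr_mono') auto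
    finally show ?thesis using True t unfolding sq by (simp add: radial_weight_def power_le_one)
  next
    case False
    then have "t powr (- 2 * h - 2) \<le> t powr (- \<kappa> - 2)" using \<kappa> h by (intro powr_mono) auto
    moreover have "min 1 (t\<^sup>2) = 1" using False by (simp add: min_absorb1 one_le_power)
    ultimately show ?thesis using False unfolding sq by (simp add: radial_weight_def)
  qed
qed

text \<open>The mean value inequality for \<open>exp\<close> costs a factor \<open>ln t\<close>,
  whose square is absorbed by \<open>t powr (- \<kappa>)\<close> below 1 and by
  \<open>t powr \<kappa>\<close> above 1, at the price \<open>4 / \<kappa>\<^sup>2\<close>. There is
  room for this because Hurst indices between \<kappa> and 1 - \<kappa> leave
  \<open>2 * \<kappa>\<close> in the exponent, of which \<open>radial_weight\<close> keeps only
  \<kappa>.\<close>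

lemma radial_weight_bound_diff:
  assumes \<kappa>: "0 < \<kappa>" "\<kappa> \<le> a" "\<kappa> \<le> 1 - b" and h: "a \<le> h" "h \<le> b" "a \<le> h'" "h' \<le> b" and t: "0 < t"
  shows "min 1 (t\<^sup>2) * (t powr (- (h + 1)) - t powr (- (h' + 1)))\<^sup>2 \<le> 4 / \<kappa>\<^sup>2 * (h - h')\<^sup>2 * radial_weight \<kappa> t"
proof -
  define m where "m = max (t powr (- (h + 1))) (t powr (- (h' + 1)))"
  have exp_diff: "\<bar>exp u - exp v\<bar> \<le> \<bar>u - v\<bar> * max (exp u) (exp v)" for u v :: real
  proof -
    have *: "exp u - exp v \<le> (u - v) * exp u" if "v \<le> u" for u v :: real
    proof -
      have "1 - (u - v) \<le> exp (- (u - v))" using exp_ge_add_one_self[of "v - u"] by (simp add: algebra_simps)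
      then have "(1 - (u - v)) * exp u \<le> exp (- (u - v)) * exp u" by (intro mult_right_mono) auto
      also have "\<dots> = exp v" by (simp flip: exp_add)
      finally show ?thesis by (simp add: algebra_simps)
    qed
    show ?thesis using *[of v u] *[of u v] by (cases "v \<le> u") (auto simp: max_def abs_if)
  qed
  have "\<bar>t powr (- (h + 1)) - t powr (- (h' + 1))\<bar> \<le> \<bar>(- (h + 1)) * ln t - (- (h' + 1)) * ln t\<bar> * m"
    unfolding m_def using exp_diff t by (simp add: powr_def)
  also have "(- (h + 1)) * ln t - (- (h' + 1)) * ln t = (h' - h) * ln t" by (simp add: algebra_simps)
  also have "\<bar>(h' - h) * ln t\<bar> * m = \<bar>h - h'\<bar> * \<bar>ln t\<bar> * m" by (simp add: abs_mult abs_minus_commute)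
  finally have "(t powr (- (h + 1)) - t powr (- (h' + 1)))\<^sup>2 \<le> (\<bar>h - h'\<bar> * \<bar>ln t\<bar> * m)\<^sup>2"
    by (metis abs_ge_zero power2_abs power_mono)
  also have "\<dots> = (h - h')\<^sup>2 * (ln t)\<^sup>2 * m\<^sup>2" by (simp add: power_mult_distrib)
  finally have 1: "(t powr (- (h + 1)) - t powr (- (h' + 1)))\<^sup>2 \<le> (h - h')\<^sup>2 * (ln t)\<^sup>2 * m\<^sup>2" .
  have m0: "m \<ge> 0" by (simp add: m_def le_max_iff_disj)
  have 2: "min 1 (t\<^sup>2) * ((ln t)\<^sup>2 * m\<^sup>2) \<le> 4 / \<kappa>\<^sup>2 * radial_weight \<kappa> t"
  proof (cases "t \<le> 1")
    case True
    have "t powr (- (h + 1)) \<le> t powr (\<kappa> - 2)" "t powr (- (h' + 1)) \<le> t powr (\<kappa> - 2)"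
      using True t \<kappa> h by (auto intro!: powr_mono')
    then have "m \<le> t powr (\<kappa> - 2)" by (simp add: m_def)
    then have "m\<^sup>2 \<le> (t powr (\<kappa> - 2))\<^sup>2" using m0 by (intro power_mono) auto
    also have "\<dots> = t powr (2 * \<kappa> - 4)" using t by (simp add: power2_eq_square flip: powr_add)
    finally have m2: "m\<^sup>2 \<le> t powr (2 * \<kappa> - 4)" .
    have "- ln t = ln (1 / t)" using t by (simp add: ln_div)
    also have "\<dots> \<le> (1 / t) powr (\<kappa> / 2) / (\<kappa> / 2)" using True t \<kappa> by (intro ln_powr_bound) auto
    also have "(1 / t) powr (\<kappa> / 2) = t powr (- \<kappa> / 2)" using t by (simp add: powr_divide powr_minus_divide)
    finally have "- ln t \<le> 2 / \<kappa> * t powr (- \<kappa> / 2)" by (simp add: mult.commute)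
    then have "(- ln t)\<^sup>2 \<le> (2 / \<kappa> * t powr (- \<kappa> / 2))\<^sup>2" using True t by (intro power_mono) auto
    also have "\<dots> = 4 / \<kappa>\<^sup>2 * t powr (- \<kappa>)" using t by (simp add: power_mult_distrib power_divide) (simp add: power2_eq_square flip: powr_add)
    finally have l2: "(ln t)\<^sup>2 \<le> 4 / \<kappa>\<^sup>2 * t powr (- \<kappa>)" by simp
    have "t\<^sup>2 * ((ln t)\<^sup>2 * m\<^sup>2) \<le> t powr 2 * ((4 / \<kappa>\<^sup>2 * t powr (- \<kappa>)) * t powr (2 * \<kappa> - 4))"
      using l2 m2 t by (intro mult_mono) auto
    also have "\<dots> = 4 / \<kappa>\<^sup>2 * t powr (2 + (- \<kappa>) + (2 * \<kappa> - 4))" unfolding powr_add by simp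
    finally show ?thesis using True t by (simp add: radial_weight_def power_le_one)
  next
    case False
    have "t powr (- (h + 1)) \<le> t powr (- \<kappa> - 1)" "t powr (- (h' + 1)) \<le> t powr (- \<kappa> - 1)"
      using False \<kappa> h by (auto intro!: powr_mono)
    then have "m \<le> t powr (- \<kappa> - 1)" by (simp add: m_def)
    then have "m\<^sup>2 \<le> (t powr (- \<kappa> - 1))\<^sup>2" using m0 by (intro power_mono) auto
    also have "\<dots> = t powr (- 2 * \<kappa> - 2)" using t by (simp add: power2_eq_square flip: powr_add)
    finally have m2: "m\<^sup>2 \<le> t powr (- 2 * \<kappa> - 2)" .
    have "ln t \<le> t powr (\<kappa> / 2) / (\<kappa> / 2)" using False t \<kappa> by (intro ln_powr_bound) auto
    then have "ln t \<le> 2 / \<kappa> * t powr (\<kappa> / 2)" by (simp add: mult.commute)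
    then have "(ln t)\<^sup>2 \<le> (2 / \<kappa> * t powr (\<kappa> / 2))\<^sup>2" using False t by (intro power_mono) auto
    also have "\<dots> = 4 / \<kappa>\<^sup>2 * t powr \<kappa>" using t by (simp add: power_mult_distrib power_divide) (simp add: power2_eq_square flip: powr_add)
    finally have l2: "(ln t)\<^sup>2 \<le> 4 / \<kappa>\<^sup>2 * t powr \<kappa>" .
    have "(ln t)\<^sup>2 * m\<^sup>2 \<le> (4 / \<kappa>\<^sup>2 * t powr \<kappa>) * t powr (- 2 * \<kappa> - 2)"
      using l2 m2 t by (intro mult_mono) auto
    also have "\<dots> = 4 / \<kappa>\<^sup>2 * t powr (\<kappa> + (- 2 * \<kappa> - 2))" unfolding powr_add by simp
    finally have "(ln t)\<^sup>2 * m\<^sup>2 \<le> 4 / \<kappa>\<^sup>2 * radial_weight \<kappa> t" using False by (simp add: radial_weight_def)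
    moreover have "min 1 (t\<^sup>2) = 1" using False by (simp add: min_absorb1 one_le_power)
    ultimately show ?thesis by simp
  qed
  have "min 1 (t\<^sup>2) * (t powr (- (h + 1)) - t powr (- (h' + 1)))\<^sup>2 \<le> min 1 (t\<^sup>2) * ((h - h')\<^sup>2 * (ln t)\<^sup>2 * m\<^sup>2)"
    using 1 by (intro mult_left_mono) auto
  also have "\<dots> = (h - h')\<^sup>2 * (min 1 (t\<^sup>2) * ((ln t)\<^sup>2 * m\<^sup>2))" by simp
  also have "\<dots> \<le> (h - h')\<^sup>2 * (4 / \<kappa>\<^sup>2 * radial_weight \<kappa> t)" using 2 by (intro mult_left_mono) auto
  finally show ?thesis by (simp add: mult_ac)
qed

lemma cmod_cis_diff_1: "cmod (cis y - 1) \<le> \<bar>y\<bar>" "cmod (cis y - 1) \<le> 2"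
proof -
  have "cmod (cis y - 1) = 2 * \<bar>sin (y / 2)\<bar>" using dist_exp_i_1[of y] by (simp add: cis_conv_exp)
  then show "cmod (cis y - 1) \<le> \<bar>y\<bar>" "cmod (cis y - 1) \<le> 2"
    using abs_sin_x_le_abs_x[of "y / 2"] by auto
qed

text \<open>The first bound depends only on the product of the norms and yields the exact power of
  \<open>norm z\<close> after rescaling; the second separates \<open>z\<close> from \<xi> and serves
  when only the parameters of the kernel vary.\<close>

lemma cmod_cis_inner:
  fixes z \<xi> :: plane
  shows "(cmod (cis (z \<bullet> \<xi>) - 1))\<^sup>2 \<le> 4 * min 1 ((norm z * norm \<xi>)\<^sup>2)"
    and "(cmod (cis (z \<bullet> \<xi>) - 1))\<^sup>2 \<le> (4 + (norm z)\<^sup>2) * min 1 ((norm \<xi>)\<^sup>2)"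
proof -
  have "cmod (cis (z \<bullet> \<xi>) - 1) \<le> norm z * norm \<xi>"
    using cmod_cis_diff_1(1)[of "z \<bullet> \<xi>"] Cauchy_Schwarz_ineq2[of z \<xi>] by linarith
  then have 1: "(cmod (cis (z \<bullet> \<xi>) - 1))\<^sup>2 \<le> (norm z * norm \<xi>)\<^sup>2" by (intro power_mono) auto
  have "(cmod (cis (z \<bullet> \<xi>) - 1))\<^sup>2 \<le> 2\<^sup>2" by (intro power_mono cmod_cis_diff_1) auto
  then have 2: "(cmod (cis (z \<bullet> \<xi>) - 1))\<^sup>2 \<le> 4" by simp
  show "(cmod (cis (z \<bullet> \<xi>) - 1))\<^sup>2 \<le> 4 * min 1 ((norm z * norm \<xi>)\<^sup>2)"
  proof -
    have "A \<le> 4 * min 1 B" if "A \<le> B" "A \<le> 4" "0 \<le> B" for A B :: real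
      using that by (auto simp: min_def)
    from this[OF 1 2] show ?thesis by simp
  qed
  show "(cmod (cis (z \<bullet> \<xi>) - 1))\<^sup>2 \<le> (4 + (norm z)\<^sup>2) * min 1 ((norm \<xi>)\<^sup>2)"
  proof (cases "(norm \<xi>)\<^sup>2 \<le> 1")
    case True
    then show ?thesis using 1 by (simp add: min_def power_mult_distrib distrib_right add_increasing)
  next
    case False
    then show ?thesis using 2 by (simp add: min_def add_increasing2)
  qed
qed

text \<open>Reflection swaps the two opposite sectors of \<open>C\<close>, which makes
  \<open>C\<close> even and the kernels Hermitian.\<close>

lemma arg_in_uminus: "arg_in (- \<xi>) {p..q} \<longleftrightarrow> arg_in \<xi> {p + pi..q + pi}" "arg_in (- \<xi>) {p + pi..q + pi} \<longleftrightarrow> arg_in \<xi> {p..q}"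
proof -
  have eq: "unit_vec (t + pi) = - unit_vec t" for t by (simp add: plane_eq_iff)
  have *: "arg_in (- \<xi>) {p + pi..q + pi}" if a: "arg_in \<xi> {p..q}" for p q \<xi>
  proof -
    obtain t where "t \<in> {p..q}" "\<xi> = norm \<xi> *\<^sub>R unit_vec t" using a unfolding arg_in_iff by blast
    then show ?thesis unfolding arg_in_iff by (intro bexI[of _ "t + pi"]) (auto simp: eq)
  qed
  have **: "arg_in (- \<xi>) {p..q}" if a: "arg_in \<xi> {p + pi..q + pi}" for p q \<xi>
  proof -
    obtain t where t: "t \<in> {p + pi..q + pi}" "\<xi> = norm \<xi> *\<^sub>R unit_vec t" using a unfolding arg_in_iff by blast
    have "unit_vec t = - unit_vec (t - pi)" using eq[of "t - pi"] by simp
    then have "- \<xi> = norm (- \<xi>) *\<^sub>R unit_vec (t - pi)"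
      using arg_cong[OF t(2), of uminus] by simp
    then show ?thesis unfolding arg_in_iff using t(1) by (intro bexI[of _ "t - pi"]) auto
  qed
  show "arg_in (- \<xi>) {p..q} \<longleftrightarrow> arg_in \<xi> {p + pi..q + pi}" using *[of "- \<xi>" p q] **[of \<xi> p q] by auto
  show "arg_in (- \<xi>) {p + pi..q + pi} \<longleftrightarrow> arg_in \<xi> {p..q}" using *[of \<xi> p q] **[of "- \<xi>" p q] by auto
qed

text \<open>Moving an arc by at most \<theta> changes membership only within \<theta> of its end
  points.\<close>

lemma arg_in_change:
  assumes \<theta>: "\<bar>p - p'\<bar> \<le> \<theta>" and ne: "arg_in \<xi> {p - \<delta>..p + \<delta>} \<noteq> arg_in \<xi> {p' - \<delta>..p' + \<delta>}"
  shows "\<xi> \<in> sector (p' + \<delta>) \<theta> \<union> sector (p' - \<delta>) \<theta>"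
proof (cases "arg_in \<xi> {p - \<delta>..p + \<delta>}")
  case True
  then obtain t where t: "t \<in> {p - \<delta>..p + \<delta>}" "\<xi> = norm \<xi> *\<^sub>R unit_vec t" by (auto simp: arg_in_iff)
  with ne True have "t \<notin> {p' - \<delta>..p' + \<delta>}" by (auto simp: arg_in_iff)
  with t(1) \<theta> have "t \<in> {p' + \<delta> - \<theta>..p' + \<delta> + \<theta>} \<or> t \<in> {p' - \<delta> - \<theta>..p' - \<delta> + \<theta>}"
    by (auto simp: abs_le_iff not_le)
  then show ?thesis using t(2) by (auto simp: sector_def arg_in_iff)
next
  case False
  then have "arg_in \<xi> {p' - \<delta>..p' + \<delta>}" using ne by simp
  then obtain t where t: "t \<in> {p' - \<delta>..p' + \<delta>}" "\<xi> = norm \<xi> *\<^sub>R unit_vec t" by (auto simp: arg_in_iff)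
  with False have "t \<notin> {p - \<delta>..p + \<delta>}" by (auto simp: arg_in_iff)
  with t(1) \<theta> have "t \<in> {p' + \<delta> - \<theta>..p' + \<delta> + \<theta>} \<or> t \<in> {p' - \<delta> - \<theta>..p' - \<delta> + \<theta>}"
    by (auto simp: abs_le_iff not_le)
  then show ?thesis using t(2) by (auto simp: sector_def arg_in_iff)
qed

lemma lafbf_C_nonneg: "\<delta> > 0 \<Longrightarrow> 0 \<le> lafbf_C \<alpha> \<delta> x \<xi>"
  by (simp add: lafbf_C_def)

lemma lafbf_C_sq: "\<delta> > 0 \<Longrightarrow> (lafbf_C \<alpha> \<delta> x \<xi>)\<^sup>2 = 1 / (4 * \<delta>) *
     (of_bool (arg_in \<xi> {\<alpha> x - \<delta>..\<alpha> x + \<delta>}) +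
      of_bool (arg_in \<xi> {\<alpha> x + pi - \<delta>..\<alpha> x + pi + \<delta>}))"
  by (simp add: lafbf_C_def)

lemma lafbf_C_sq_le: "\<delta> > 0 \<Longrightarrow> (lafbf_C \<alpha> \<delta> x \<xi>)\<^sup>2 \<le> 1 / (2 * \<delta>)"
  by (simp add: lafbf_C_sq field_simps)

lemma lafbf_C_uminus: "lafbf_C \<alpha> \<delta> x (- \<xi>) = lafbf_C \<alpha> \<delta> x \<xi>"
  using arg_in_uminus[of \<xi> "\<alpha> x - \<delta>" "\<alpha> x + \<delta>"]
  by (simp add: lafbf_C_def add.commute add.left_commute add_diff_eq diff_add_eq)

lemma lafbf_C_scale: "c > 0 \<Longrightarrow> lafbf_C \<alpha> \<delta> x (c *\<^sub>R \<xi>) = lafbf_C \<alpha> \<delta> x \<xi>"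
  by (simp add: lafbf_C_def arg_in_scale)

lemma measurable_lafbf_C [measurable]: "lafbf_C \<alpha> \<delta> x \<in> borel_measurable borel"
proof -
  have "(\<lambda>\<xi>. of_bool (arg_in \<xi> {p..q}) :: real) = indicator {\<xi>. arg_in \<xi> {p..q}}" for p q
    by (auto simp: fun_eq_iff indicator_def)
  then have [measurable]: "(\<lambda>\<xi>. of_bool (arg_in \<xi> {p..q}) :: real) \<in> borel_measurable borel" for p q by simp
  show ?thesis unfolding lafbf_C_def[abs_def] by measurable
qed

text \<open>For nonnegative numbers the square of the difference is at most the absolute difference
  of the squares, and the squares of \<open>C\<close> are sums of indicators, to which
  \<open>arg_in_change\<close> applies.\<close>

lemma lafbf_C_diff_sq:
  assumes \<delta>: "\<delta> > 0" and \<theta>: "\<bar>\<alpha> x - \<alpha> y\<bar> \<le> \<theta>"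
  shows "(lafbf_C \<alpha> \<delta> x \<xi> - lafbf_C \<alpha> \<delta> y \<xi>)\<^sup>2 \<le> 1 / (4 * \<delta>) *
    (\<Sum>s\<in>{\<alpha> y + \<delta>, \<alpha> y - \<delta>}. indicator (sector s \<theta>) \<xi> + indicator (sector (s + pi) \<theta>) \<xi>)"
proof -
  define c where "c z = lafbf_C \<alpha> \<delta> z \<xi>" for z
  define P Q where "P z = (of_bool (arg_in \<xi> {\<alpha> z - \<delta>..\<alpha> z + \<delta>}) :: real)"
    and "Q z = (of_bool (arg_in \<xi> {\<alpha> z + pi - \<delta>..\<alpha> z + pi + \<delta>}) :: real)" for z
  have c: "0 \<le> c z" "(c z)\<^sup>2 = 1 / (4 * \<delta>) * (P z + Q z)" for z
    using \<delta> by (simp_all add: c_def lafbf_C_nonneg lafbf_C_sq P_def Q_def)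
  have "(c x - c y)\<^sup>2 \<le> \<bar>(c x)\<^sup>2 - (c y)\<^sup>2\<bar>"
  proof -
    have "(c x - c y)\<^sup>2 = \<bar>c x - c y\<bar> * \<bar>c x - c y\<bar>" by (simp add: power2_eq_square)
    also have "\<dots> \<le> \<bar>c x - c y\<bar> * \<bar>c x + c y\<bar>" using c(1)[of x] c(1)[of y] by (intro mult_left_mono) auto
    also have "\<dots> = \<bar>(c x)\<^sup>2 - (c y)\<^sup>2\<bar>" by (simp add: power2_eq_square algebra_simps flip: abs_mult)
    finally show ?thesis .
  qed
  also have "\<dots> \<le> 1 / (4 * \<delta>) * (\<bar>P x - P y\<bar> + \<bar>Q x - Q y\<bar>)"
    unfolding c using \<delta> abs_triangle_ineq[of "P x - P y" "Q x - Q y"]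
    by (simp add: abs_divide field_simps flip: diff_divide_distrib)
  also have "\<dots> \<le> 1 / (4 * \<delta>) * (\<Sum>s\<in>{\<alpha> y + \<delta>, \<alpha> y - \<delta>}. indicator (sector s \<theta>) \<xi> + indicator (sector (s + pi) \<theta>) \<xi>)"
  proof (rule mult_left_mono)
    have P: "\<bar>P x - P y\<bar> \<le> indicator (sector (\<alpha> y + \<delta>) \<theta>) \<xi> + indicator (sector (\<alpha> y - \<delta>) \<theta>) \<xi>"
      using arg_in_change[OF \<theta>, of \<xi> \<delta>] by (auto simp: P_def indicator_def)
    have Q: "\<bar>Q x - Q y\<bar> \<le> indicator (sector (\<alpha> y + pi + \<delta>) \<theta>) \<xi> + indicator (sector (\<alpha> y + pi - \<delta>) \<theta>) \<xi>"
      using arg_in_change[of "\<alpha> x + pi" "\<alpha> y + pi" \<theta> \<xi> \<delta>] \<theta> by (auto simp: Q_def indicator_def)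
    have e: "\<alpha> y + pi + \<delta> = \<alpha> y + \<delta> + pi" "\<alpha> y + pi - \<delta> = \<alpha> y - \<delta> + pi" by simp_all
    have "\<alpha> y + \<delta> \<noteq> \<alpha> y - \<delta>" using \<delta> by simp
    then show "\<bar>P x - P y\<bar> + \<bar>Q x - Q y\<bar> \<le> (\<Sum>s\<in>{\<alpha> y + \<delta>, \<alpha> y - \<delta>}. indicator (sector s \<theta>) \<xi> + indicator (sector (s + pi) \<theta>) \<xi>)"
      using P Q[unfolded e] by simp
  qed (use \<delta> in simp)
  finally show ?thesis unfolding c_def .
qed

lemma nn_integral_bound:
  fixes f :: "plane \<Rightarrow> real"
  assumes [measurable]: "f \<in> borel_measurable borel" and f0: "\<And>\<xi>. 0 \<le> f \<xi>" and c: "0 \<le> c"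
    and le: "(\<integral>\<^sup>+\<xi>. ennreal (f \<xi>) \<partial>lborel) \<le> ennreal c"
  shows "integrable lborel f" "(\<integral>\<xi>. f \<xi> \<partial>lborel) \<le> c"
proof -
  show i: "integrable lborel f"
    using le f0 by (intro integrableI_nonneg) (auto intro: order_le_less_trans)
  have "ennreal (\<integral>\<xi>. f \<xi> \<partial>lborel) \<le> ennreal c"
    using le f0 by (subst nn_integral_eq_integral[symmetric]) (auto simp: i)
  then show "(\<integral>\<xi>. f \<xi> \<partial>lborel) \<le> c" using c by simp
qed

text \<open>In \<open>kernel x y\<close> the oscillating factor is taken at \<open>x\<close>, the Hurst index and the orientation at \<open>y\<close>:
  \<open>kernel x x\<close> is the kernel of the field at \<open>x\<close>, and \<open>kernel u x0\<close> that of the tangent field.\<close>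

locale lafbf_params =
  fixes h \<alpha> :: "plane \<Rightarrow> real" and a b \<beta> \<eta> \<delta> \<Lambda> :: real
  assumes a: "0 < a" and h: "\<And>x. a \<le> h x" "\<And>x. h x \<le> b" and b: "b < 1" "b < \<beta>" "\<beta> \<le> 1"
    and \<eta>: "b < \<eta>" "\<eta> \<le> 1 / 2" and \<delta>: "0 < \<delta>" and \<Lambda>: "1 \<le> \<Lambda>"
    and h_holder: "\<And>x y. \<bar>h x - h y\<bar> \<le> \<Lambda> * norm (x - y) powr \<beta>"
    and \<alpha>_holder: "\<And>x y. \<bar>\<alpha> x - \<alpha> y\<bar> \<le> \<Lambda> * norm (x - y) powr (2 * \<eta>)"
begin

text \<open>The distance of the interval from \<open>a\<close> to \<open>b\<close> to the excluded
  Hurst indices 0 and 1.\<close>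

definition "\<kappa> = min a (1 - b)"

lemma \<kappa>: "0 < \<kappa>" "\<kappa> \<le> a" "\<kappa> \<le> 1 - b" "\<kappa> \<le> 1"
  using a b(1) h[of 0] by (auto simp: \<kappa>_def)

definition amplitude :: "plane \<Rightarrow> plane \<Rightarrow> real" where
  "amplitude y \<xi> = lafbf_C \<alpha> \<delta> y \<xi> / norm \<xi> powr (h y + 1)"

definition kernel :: "plane \<Rightarrow> plane \<Rightarrow> plane \<Rightarrow> complex" where
  "kernel x y \<xi> = (cis (x \<bullet> \<xi>) - 1) * complex_of_real (amplitude y \<xi>)"

lemma measurable_cis_inner [measurable]: "(\<lambda>\<xi>. cis (x \<bullet> \<xi>)) \<in> borel_measurable borel"
  by (intro borel_measurable_continuous_onI continuous_intros)

lemma measurable_amplitude [measurable]: "amplitude y \<in> borel_measurable borel"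
  unfolding amplitude_def[abs_def] by measurable

lemma measurable_kernel [measurable]: "kernel x y \<in> borel_measurable borel"
  unfolding kernel_def[abs_def] by measurable

lemma amplitude_sq_le: "\<xi> \<noteq> 0 \<Longrightarrow> (amplitude y \<xi>)\<^sup>2 \<le> 1 / (2 * \<delta>) * (norm \<xi> powr (- (h y + 1)))\<^sup>2"
proof -
  have "(amplitude y \<xi>)\<^sup>2 = (lafbf_C \<alpha> \<delta> y \<xi>)\<^sup>2 * (norm \<xi> powr (- (h y + 1)))\<^sup>2"
    unfolding amplitude_def powr_minus by (simp add: power_mult_distrib divide_inverse)
  also have "\<dots> \<le> 1 / (2 * \<delta>) * (norm \<xi> powr (- (h y + 1)))\<^sup>2"
    by (intro mult_right_mono lafbf_C_sq_le \<delta>) auto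
  finally show ?thesis .
qed

text \<open>The factor \<open>2 / \<delta>\<close> is the 4 of \<open>cmod_cis_inner\<close> times
  the bound \<open>1 / (2 * \<delta>)\<close> on the square of \<open>C\<close>.\<close>

definition "scale_const = 2 / \<delta> * weight_total \<kappa>"

lemma scale_const_nonneg: "0 \<le> scale_const"
  using \<delta> weight_total_nonneg[OF \<kappa>(1)] by (simp add: scale_const_def)

text \<open>Dilating \<xi> by \<open>norm z\<close> brings the integrand to unit scale, which yields
  exactly the power \<open>2 * h y\<close> expected of a field with constant Hurst index
  \<open>h y\<close>.\<close>

lemma amplitude_cis_bound:
  shows "integrable lborel (\<lambda>\<xi>. (cmod (cis (z \<bullet> \<xi>) - 1))\<^sup>2 * (amplitude y \<xi>)\<^sup>2)"
    and "(\<integral>\<xi>. (cmod (cis (z \<bullet> \<xi>) - 1))\<^sup>2 * (amplitude y \<xi>)\<^sup>2 \<partial>lborel) \<le> scale_const * norm z powr (2 * h y)"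
proof -
  define f where "f \<xi> = (cmod (cis (z \<bullet> \<xi>) - 1))\<^sup>2 * (amplitude y \<xi>)\<^sup>2" for \<xi>
  have "integrable lborel f \<and> (\<integral>\<xi>. f \<xi> \<partial>lborel) \<le> scale_const * norm z powr (2 * h y)"
  proof (cases "z = 0")
    case False
    define r where "r = norm z"
    have r: "r > 0" using False by (simp add: r_def)
    have pw: "f \<xi> \<le> 2 / \<delta> * r powr (2 * h y + 2) * radial_weight \<kappa> (norm (r *\<^sub>R \<xi>))" for \<xi>
    proof (cases "\<xi> = 0")
      case False
      define t where "t = r * norm \<xi>"
      have t: "t > 0" using r False by (simp add: t_def)
      have "norm \<xi> = t / r" using r by (simp add: t_def)
      then have nx: "(norm \<xi> powr (- (h y + 1)))\<^sup>2 = r powr (2 * h y + 2) * (t powr (- (h y + 1)))\<^sup>2"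
      proof -
        assume "norm \<xi> = t / r"
        then have "norm \<xi> powr (- (h y + 1)) = r powr (h y + 1) * t powr (- (h y + 1))"
          using r t by (simp only: powr_divide powr_minus) (simp add: divide_inverse)
        moreover have "(r powr (h y + 1))\<^sup>2 = r powr (2 * h y + 2)"
          by (simp add: power2_eq_square flip: powr_add)
        ultimately show ?thesis by (simp only: power_mult_distrib)
      qed
      have "f \<xi> \<le> (4 * min 1 (t\<^sup>2)) * (1 / (2 * \<delta>) * (norm \<xi> powr (- (h y + 1)))\<^sup>2)"
        unfolding f_def t_def r_def using cmod_cis_inner(1)[of z \<xi>] amplitude_sq_le[OF False, of y] \<delta>
        by (intro mult_mono) auto
      also have "\<dots> = 2 / \<delta> * r powr (2 * h y + 2) * (min 1 (t\<^sup>2) * (t powr (- (h y + 1)))\<^sup>2)"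
        unfolding nx by simp
      also have "\<dots> \<le> 2 / \<delta> * r powr (2 * h y + 2) * radial_weight \<kappa> t"
        using \<delta> by (intro mult_left_mono radial_weight_bound[OF \<kappa>(1-3) h t]) auto
      finally show ?thesis using r by (simp add: t_def)
    qed (use \<delta> in \<open>simp add: f_def\<close>)
    have fm: "f \<in> borel_measurable borel" unfolding f_def by measurable
    have f0: "0 \<le> f \<xi>" for \<xi> by (simp add: f_def)
    have c0: "0 \<le> 2 / \<delta> * r powr (2 * h y + 2)" using \<delta> by simp
    have "(\<integral>\<^sup>+\<xi>. ennreal (f \<xi>) \<partial>lborel) \<le> (\<integral>\<^sup>+\<xi>. ennreal (2 / \<delta> * r powr (2 * h y + 2)) * ennreal (radial_weight \<kappa> (norm (r *\<^sub>R (\<xi>::plane)))) \<partial>lborel)"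
      using pw c0 by (intro nn_integral_mono) (simp add: ennreal_leI flip: ennreal_mult)
    also have "\<dots> = ennreal (2 / \<delta> * r powr (2 * h y + 2)) * (\<integral>\<^sup>+\<xi>. ennreal (radial_weight \<kappa> (norm (r *\<^sub>R (\<xi>::plane)))) \<partial>lborel)"
      by (intro nn_integral_cmult) measurable
    \<comment> \<open>The factor \<open>r\<^sup>2\<close> is split off as the Jacobian of the
      dilation in the plane.\<close>
    also have "\<dots> = ennreal (2 / \<delta> * r powr (2 * h y) * r\<^sup>2) * (\<integral>\<^sup>+\<xi>. ennreal (radial_weight \<kappa> (norm (r *\<^sub>R (\<xi>::plane)))) \<partial>lborel)"
      using r by (simp add: powr_add mult.assoc)
    also have "\<dots> = ennreal (2 / \<delta> * r powr (2 * h y)) * (\<integral>\<^sup>+\<xi>. ennreal (radial_weight \<kappa> (norm (\<xi>::plane))) \<partial>lborel)"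
    proof -
      have "ennreal (2 / \<delta> * r powr (2 * h y) * r\<^sup>2) = ennreal (2 / \<delta> * r powr (2 * h y)) * ennreal (r\<^sup>2)"
        using \<delta> by (intro ennreal_mult) auto
      then show ?thesis
        using r nn_integral_plane_scale[of "\<lambda>\<xi>. ennreal (radial_weight \<kappa> (norm \<xi>))" r]
        by (simp only: mult.assoc) simp
    qed
    also have "\<dots> \<le> ennreal (2 / \<delta> * r powr (2 * h y)) * ennreal (weight_total \<kappa>)"
      by (intro mult_left_mono radial_weight_plane \<kappa>) auto
    also have "\<dots> = ennreal (scale_const * norm z powr (2 * h y))"
      using \<delta> weight_total_nonneg[OF \<kappa>(1)] by (simp add: scale_const_def r_def mult_ac flip: ennreal_mult)
    finally have le: "(\<integral>\<^sup>+\<xi>. ennreal (f \<xi>) \<partial>lborel) \<le> ennreal (scale_const * norm z powr (2 * h y))" .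
    have "0 \<le> scale_const * norm z powr (2 * h y)" using scale_const_nonneg by simp
    from nn_integral_bound[OF fm f0 this le] show ?thesis by blast
  next
    case True
    then have "f = (\<lambda>_. 0)" by (simp add: f_def fun_eq_iff)
    then show ?thesis using True by simp
  qed
  then show "integrable lborel (\<lambda>\<xi>. (cmod (cis (z \<bullet> \<xi>) - 1))\<^sup>2 * (amplitude y \<xi>)\<^sup>2)"
    and "(\<integral>\<xi>. (cmod (cis (z \<bullet> \<xi>) - 1))\<^sup>2 * (amplitude y \<xi>)\<^sup>2 \<partial>lborel) \<le> scale_const * norm z powr (2 * h y)"
    unfolding f_def by auto
qed

lemma kernel_hermitian_L2: "kernel x y \<in> hermitian_L2"
proof -
  have "(cmod (kernel x y \<xi>))\<^sup>2 = (cmod (cis (x \<bullet> \<xi>) - 1))\<^sup>2 * (amplitude y \<xi>)\<^sup>2" for \<xi>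
    by (simp add: kernel_def norm_mult power_mult_distrib)
  then have "integrable lborel (\<lambda>\<xi>. (cmod (kernel x y \<xi>))\<^sup>2)" using amplitude_cis_bound(1) by simp
  moreover have "kernel x y (- \<xi>) = cnj (kernel x y \<xi>)" for \<xi>
    by (simp add: kernel_def amplitude_def lafbf_C_uminus cis_cnj)
  ultimately show ?thesis by (simp add: hermitian_L2_def)
qed

text \<open>With the same parameter \<open>y\<close>, the difference of two kernels is a unimodular
  factor times the kernel at \<open>x - x'\<close>.\<close>

lemma sqdist_kernel_phase: "sqdist (kernel x y) (kernel x' y) \<le> scale_const * norm (x - x') powr (2 * h y)"
proof -
  have "(cmod (kernel x y \<xi> - kernel x' y \<xi>))\<^sup>2 = (cmod (cis ((x - x') \<bullet> \<xi>) - 1))\<^sup>2 * (amplitude y \<xi>)\<^sup>2" for \<xi>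
  proof -
    have "kernel x y \<xi> - kernel x' y \<xi> = cis (x' \<bullet> \<xi>) * ((cis ((x - x') \<bullet> \<xi>) - 1) * complex_of_real (amplitude y \<xi>))"
      by (simp add: kernel_def inner_diff_left algebra_simps cis_mult flip: cis_divide)
    then show ?thesis by (simp add: norm_mult power_mult_distrib)
  qed
  then show ?thesis using amplitude_cis_bound(2) by (simp add: sqdist_def)
qed

text \<open>The first summand comes from \<open>h\<close>, whose variation enters squared, the
  second from \<alpha>, whose variation enters linearly; hence \<open>\<Lambda>\<^sup>2\<close> in
  one and \<Lambda> in the other.\<close>

definition "param_const = 4 / (\<delta> * \<kappa>\<^sup>2) * \<Lambda>\<^sup>2 * weight_total \<kappa> + 2 / \<delta> * weight_total \<kappa> * \<Lambda>"

lemma param_const_nonneg: "0 \<le> param_const"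
  using \<delta> \<kappa>(1) \<Lambda> weight_total_nonneg[OF \<kappa>(1)] by (simp add: param_const_def)

lemma sqdist_kernel_param:
  "sqdist (kernel z x) (kernel z y) \<le> param_const * (4 + (norm z)\<^sup>2) * (norm (x - y) powr (2 * \<beta>) + norm (x - y) powr (2 * \<eta>))"
proof (cases "x = y")
  case False
  define d where "d = norm (x - y)"
  have d: "d > 0" using False by (simp add: d_def)
  define \<theta> where "\<theta> = \<Lambda> * d powr (2 * \<eta>)"
  have \<theta>: "\<theta> > 0" "\<bar>\<alpha> x - \<alpha> y\<bar> \<le> \<theta>" using \<Lambda> d \<alpha>_holder[of x y] by (auto simp: \<theta>_def d_def)
  define D where "D = 4 / \<kappa>\<^sup>2 * (h x - h y)\<^sup>2"
  define Z where "Z = 4 + (norm z)\<^sup>2"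
  have Z: "Z > 0" unfolding Z_def by (simp add: add_pos_nonneg)
  define S where "S = {\<alpha> y + \<delta>, \<alpha> y - \<delta>}"
  define I where "I \<xi> = (\<Sum>s\<in>S. indicator (sector s \<theta>) \<xi> + indicator (sector (s + pi) \<theta>) \<xi> :: real)" for \<xi>
  have I0: "0 \<le> I \<xi>" for \<xi> unfolding I_def by (intro sum_nonneg) auto
  define f where "f \<xi> = (cmod (kernel z x \<xi> - kernel z y \<xi>))\<^sup>2" for \<xi>
  have f_eq: "f \<xi> = (cmod (cis (z \<bullet> \<xi>) - 1))\<^sup>2 * (amplitude x \<xi> - amplitude y \<xi>)\<^sup>2" for \<xi>
  proof -
    have "kernel z x \<xi> - kernel z y \<xi> = (cis (z \<bullet> \<xi>) - 1) * complex_of_real (amplitude x \<xi> - amplitude y \<xi>)"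
      by (simp add: kernel_def algebra_simps)
    then show ?thesis by (simp only: f_def norm_mult power_mult_distrib norm_of_real power2_abs)
  qed
  have pw: "f \<xi> \<le> Z / \<delta> * D * radial_weight \<kappa> (norm \<xi>) + Z / (2 * \<delta>) * (radial_weight \<kappa> (norm \<xi>) * I \<xi>)" for \<xi>
  proof (cases "\<xi> = 0")
    case False
    define t where "t = norm \<xi>"
    have t: "t > 0" using False by (simp add: t_def)
    define p q where "p = t powr (- (h x + 1))" and "q = t powr (- (h y + 1))"
    define u v where "u = lafbf_C \<alpha> \<delta> x \<xi>" and "v = lafbf_C \<alpha> \<delta> y \<xi>"
    define m where "m = min 1 (t\<^sup>2)"
    have m: "0 \<le> m" by (simp add: m_def)
    \<comment> \<open>A discrete product rule separates the change of the exponent from the change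
      of the sectors.\<close>
    have "amplitude x \<xi> - amplitude y \<xi> = u * (p - q) + (u - v) * q"
    proof -
      have "amplitude x \<xi> = u * p" "amplitude y \<xi> = v * q"
        by (simp_all only: amplitude_def u_def v_def p_def q_def t_def powr_minus divide_inverse)
      then show ?thesis by (simp add: algebra_simps)
    qed
    moreover have "(s + s')\<^sup>2 \<le> 2 * s\<^sup>2 + 2 * s'\<^sup>2" for s s' :: real
      using sum_squares_bound[of s s'] by (simp add: power2_sum)
    ultimately have "(amplitude x \<xi> - amplitude y \<xi>)\<^sup>2 \<le> 2 * (u\<^sup>2 * (p - q)\<^sup>2) + 2 * ((u - v)\<^sup>2 * q\<^sup>2)"
      by (metis power_mult_distrib)
    also have "\<dots> \<le> 2 * (1 / (2 * \<delta>) * (p - q)\<^sup>2) + 2 * (1 / (4 * \<delta>) * I \<xi> * q\<^sup>2)"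
      unfolding u_def v_def I_def S_def using \<delta>
      by (intro add_mono mult_left_mono mult_right_mono lafbf_C_sq_le lafbf_C_diff_sq \<theta>) auto
    finally have "f \<xi> \<le> (Z * m) * (2 * (1 / (2 * \<delta>) * (p - q)\<^sup>2) + 2 * (1 / (4 * \<delta>) * I \<xi> * q\<^sup>2))"
      unfolding f_eq Z_def m_def t_def using cmod_cis_inner(2)[of z \<xi>] by (intro mult_mono) auto
    also have "\<dots> = Z / \<delta> * (m * (p - q)\<^sup>2) + Z / (2 * \<delta>) * ((m * q\<^sup>2) * I \<xi>)"
      using \<delta> by (simp add: field_simps)
    also have "\<dots> \<le> Z / \<delta> * (D * radial_weight \<kappa> t) + Z / (2 * \<delta>) * (radial_weight \<kappa> t * I \<xi>)"
      unfolding m_def p_def q_def D_def using Z \<delta> I0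
      by (intro add_mono mult_left_mono mult_right_mono radial_weight_bound[OF \<kappa>(1-3) h t] radial_weight_bound_diff[OF \<kappa>(1-3) h h t]) auto
    finally show ?thesis by (simp add: t_def mult.assoc)
  qed (use Z \<delta> I0 in \<open>auto simp: f_eq D_def intro!: add_nonneg_nonneg mult_nonneg_nonneg divide_nonneg_nonneg\<close>)
  have fm: "f \<in> borel_measurable borel" unfolding f_def by measurable
  have f0: "0 \<le> f \<xi>" for \<xi> by (simp add: f_def)
  have D0: "0 \<le> D" by (simp add: D_def)
  define w where "w \<xi> = ennreal (radial_weight \<kappa> (norm \<xi>))" for \<xi> :: plane
  have wm[measurable]: "w \<in> borel_measurable borel" unfolding w_def by measurable
  define T where "T = weight_total \<kappa>"
  have T: "0 \<le> T" unfolding T_def by (rule weight_total_nonneg[OF \<kappa>(1)])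
  \<comment> \<open>Four thin sectors contribute, one around each edge of the two opposite sectors
    of \<open>C\<close>.\<close>
  have wI: "(\<integral>\<^sup>+\<xi>. w \<xi> * ennreal (I \<xi>) \<partial>lborel) \<le> ennreal (4 * (T * \<theta>))"
  proof -
    have "w \<xi> * ennreal (I \<xi>) = (\<Sum>s\<in>S. w \<xi> * indicator (sector s \<theta>) \<xi> + w \<xi> * indicator (sector (s + pi) \<theta>) \<xi>)" for \<xi>
    proof -
      have "ennreal (I \<xi>) = (\<Sum>s\<in>S. indicator (sector s \<theta>) \<xi> + indicator (sector (s + pi) \<theta>) \<xi>)"
        unfolding I_def by (subst sum_ennreal[symmetric]) (auto simp: ennreal_plus ennreal_indicator)
      then show ?thesis by (simp add: sum_distrib_left distrib_left)
    qed
    then have "(\<integral>\<^sup>+\<xi>. w \<xi> * ennreal (I \<xi>) \<partial>lborel) =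
       (\<Sum>s\<in>S. (\<integral>\<^sup>+\<xi>. w \<xi> * indicator (sector s \<theta>) \<xi> \<partial>lborel) + (\<integral>\<^sup>+\<xi>. w \<xi> * indicator (sector (s + pi) \<theta>) \<xi> \<partial>lborel))"
      by (simp add: nn_integral_sum nn_integral_add)
    also have "\<dots> \<le> (\<Sum>s\<in>S. ennreal (T * \<theta>) + ennreal (T * \<theta>))"
      unfolding w_def T_def by (intro sum_mono add_mono radial_weight_sector \<kappa> \<theta>)
    also have "\<dots> = ennreal (4 * (T * \<theta>))"
    proof -
      have "card S = 2" using \<delta> by (simp add: S_def)
      moreover have "ennreal (T * \<theta>) + ennreal (T * \<theta>) = ennreal (2 * (T * \<theta>))"
        using T \<theta> by (simp flip: ennreal_plus)
      ultimately have "(\<Sum>s\<in>S. ennreal (T * \<theta>) + ennreal (T * \<theta>)) = ennreal 2 * ennreal (2 * (T * \<theta>))"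
        by simp
      also have "\<dots> = ennreal (4 * (T * \<theta>))" using T \<theta> by (subst ennreal_mult[symmetric]) auto
      finally show ?thesis .
    qed
    finally show ?thesis .
  qed
  have "(\<integral>\<^sup>+\<xi>. ennreal (f \<xi>) \<partial>lborel) \<le> (\<integral>\<^sup>+\<xi>. ennreal (Z / \<delta> * D) * w \<xi> + ennreal (Z / (2 * \<delta>)) * (w \<xi> * ennreal (I \<xi>)) \<partial>lborel)"
  proof (rule nn_integral_mono)
    fix \<xi>
    have "ennreal (f \<xi>) \<le> ennreal (Z / \<delta> * D * radial_weight \<kappa> (norm \<xi>) + Z / (2 * \<delta>) * (radial_weight \<kappa> (norm \<xi>) * I \<xi>))"
      by (intro ennreal_leI pw)
    also have "\<dots> = ennreal (Z / \<delta> * D) * w \<xi> + ennreal (Z / (2 * \<delta>)) * (w \<xi> * ennreal (I \<xi>))"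
    proof -
      have n: "0 \<le> Z / \<delta> * D" "0 \<le> Z / (2 * \<delta>)" "0 \<le> radial_weight \<kappa> (norm \<xi>) * I \<xi>" using Z \<delta> D0 I0[of \<xi>] by auto
      show ?thesis unfolding w_def using n I0[of \<xi>]
        by (subst ennreal_plus) (auto simp only: ennreal_mult radial_weight_nonneg mult_nonneg_nonneg)
    qed
    finally show "ennreal (f \<xi>) \<le> ennreal (Z / \<delta> * D) * w \<xi> + ennreal (Z / (2 * \<delta>)) * (w \<xi> * ennreal (I \<xi>))" .
  qed
  also have "\<dots> = ennreal (Z / \<delta> * D) * (\<integral>\<^sup>+\<xi>. w \<xi> \<partial>lborel) + ennreal (Z / (2 * \<delta>)) * (\<integral>\<^sup>+\<xi>. w \<xi> * ennreal (I \<xi>) \<partial>lborel)"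
  proof -
    have [measurable]: "I \<in> borel_measurable borel" unfolding I_def by measurable
    show ?thesis by (simp add: nn_integral_add nn_integral_cmult)
  qed
  also have "\<dots> \<le> ennreal (Z / \<delta> * D) * ennreal T + ennreal (Z / (2 * \<delta>)) * ennreal (4 * (T * \<theta>))"
    unfolding T_def by (intro add_mono mult_left_mono wI[unfolded T_def] radial_weight_plane[OF \<kappa>(1,4), folded w_def]) auto
  also have "\<dots> = ennreal (Z / \<delta> * D * T + Z / (2 * \<delta>) * (4 * (T * \<theta>)))"
  proof -
    have "ennreal A * ennreal T + ennreal B * ennreal C = ennreal (A * T + B * C)" if "0 \<le> A" "0 \<le> B" "0 \<le> C" for A B C
      using that T by (simp add: ennreal_mult ennreal_plus)
    then show ?thesis using Z \<delta> D0 T \<theta> by simp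
  qed
  finally have le: "(\<integral>\<^sup>+\<xi>. ennreal (f \<xi>) \<partial>lborel) \<le> ennreal (Z / \<delta> * D * T + Z / (2 * \<delta>) * (4 * (T * \<theta>)))" .
  have "(\<integral>\<xi>. f \<xi> \<partial>lborel) \<le> Z / \<delta> * D * T + Z / (2 * \<delta>) * (4 * (T * \<theta>))"
    using Z \<delta> D0 T \<theta> by (intro nn_integral_bound(2)[OF fm f0 _ le]) auto
  also have "\<dots> \<le> param_const * Z * (d powr (2 * \<beta>) + d powr (2 * \<eta>))"
  proof -
    have "(h x - h y)\<^sup>2 = \<bar>h x - h y\<bar>\<^sup>2" by simp
    also have "\<dots> \<le> (\<Lambda> * d powr \<beta>)\<^sup>2" unfolding d_def by (intro power_mono h_holder) auto
    also have "\<dots> = \<Lambda>\<^sup>2 * d powr (2 * \<beta>)" using d by (simp add: power_mult_distrib power2_eq_square flip: powr_add)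
    finally have "D \<le> 4 / \<kappa>\<^sup>2 * (\<Lambda>\<^sup>2 * d powr (2 * \<beta>))" unfolding D_def by (intro mult_left_mono) auto
    then have "Z / \<delta> * D * T \<le> Z / \<delta> * (4 / \<kappa>\<^sup>2 * (\<Lambda>\<^sup>2 * d powr (2 * \<beta>))) * T"
      using Z \<delta> T by (intro mult_left_mono mult_right_mono) auto
    also have "\<dots> = (4 / (\<delta> * \<kappa>\<^sup>2) * \<Lambda>\<^sup>2 * T) * Z * d powr (2 * \<beta>)" by simp
    also have "\<dots> \<le> param_const * Z * d powr (2 * \<beta>)"
      unfolding param_const_def T_def[symmetric] using Z \<delta> \<Lambda> T by (intro mult_right_mono) auto
    finally have 1: "Z / \<delta> * D * T \<le> param_const * Z * d powr (2 * \<beta>)" .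
    have "Z / (2 * \<delta>) * (4 * (T * \<theta>)) = (2 / \<delta> * T * \<Lambda>) * Z * d powr (2 * \<eta>)"
      by (simp add: \<theta>_def)
    also have "\<dots> \<le> param_const * Z * d powr (2 * \<eta>)"
      unfolding param_const_def T_def[symmetric] using Z \<delta> \<Lambda> T \<kappa>(1) by (intro mult_right_mono) auto
    finally show ?thesis using 1 by (simp add: distrib_left)
  qed
  finally show ?thesis by (simp add: sqdist_def f_def Z_def d_def)
qed (simp add: sqdist_def)

end

section \<open>Rescaled kernels and the structure tensor\<close>

text \<open>A unitary operator on Hermitian kernels: \<open>c\<close> is the square root of the
  Jacobian of the dilation, and the phase is unimodular.\<close>

definition rescale :: "real \<Rightarrow> plane \<Rightarrow> (plane \<Rightarrow> complex) \<Rightarrow> plane \<Rightarrow> complex" where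
  "rescale c z g \<xi> = complex_of_real c * cis (- (z \<bullet> \<xi>)) * g (c *\<^sub>R \<xi>)"

lemma rescale_hermitian_L2:
  assumes g: "g \<in> hermitian_L2" and c: "0 < c"
  shows "rescale c z g \<in> hermitian_L2"
proof -
  have [measurable]: "g \<in> borel_measurable borel" by (rule hermitian_L2_measurable[OF g])
  have [measurable]: "(\<lambda>\<xi>. cis (- (z \<bullet> \<xi>))) \<in> borel_measurable borel"
    by (intro borel_measurable_continuous_onI continuous_intros)
  have "(cmod (rescale c z g \<xi>))\<^sup>2 = c\<^sup>2 * (cmod (g (c *\<^sub>R \<xi>)))\<^sup>2" for \<xi>
    by (simp add: rescale_def norm_mult power_mult_distrib)
  moreover have "integrable lborel (\<lambda>\<xi>. (cmod (g (c *\<^sub>R \<xi>)))\<^sup>2)"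
    using g by (intro integrable_plane_scale[OF _ c, of "\<lambda>\<xi>. (cmod (g \<xi>))\<^sup>2"]) (auto simp: hermitian_L2_def)
  ultimately have "integrable lborel (\<lambda>\<xi>. (cmod (rescale c z g \<xi>))\<^sup>2)" by simp
  moreover have "rescale c z g (- \<xi>) = cnj (rescale c z g \<xi>)" for \<xi>
    using g by (simp add: rescale_def hermitian_L2_def cis_cnj)
  moreover have "rescale c z g \<in> borel_measurable borel" unfolding rescale_def[abs_def] by measurable
  ultimately show ?thesis by (simp add: hermitian_L2_def)
qed

lemma noise_ip_rescale:
  assumes f: "f \<in> hermitian_L2" and g: "g \<in> hermitian_L2" and c: "0 < c"
  shows "noise_ip (rescale c z f) (rescale c z g) = noise_ip f g"
proof -
  have [measurable]: "f \<in> borel_measurable borel" "g \<in> borel_measurable borel"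
    by (intro hermitian_L2_measurable f g)+
  have [measurable]: "cnj \<in> borel_measurable borel" by (intro borel_measurable_continuous_onI continuous_intros)
  have "Re (rescale c z f \<xi> * cnj (rescale c z g \<xi>)) = c\<^sup>2 * Re (f (c *\<^sub>R \<xi>) * cnj (g (c *\<^sub>R \<xi>)))" for \<xi>
  proof -
    have "rescale c z f \<xi> * cnj (rescale c z g \<xi>) = complex_of_real (c\<^sup>2) * (cis (- (z \<bullet> \<xi>)) * cis (z \<bullet> \<xi>)) * (f (c *\<^sub>R \<xi>) * cnj (g (c *\<^sub>R \<xi>)))"
      by (simp add: rescale_def cis_cnj power2_eq_square mult_ac)
    also have "\<dots> = complex_of_real (c\<^sup>2) * (f (c *\<^sub>R \<xi>) * cnj (g (c *\<^sub>R \<xi>)))" by (simp add: cis_mult)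
    finally show ?thesis by (simp only: Re_complex_of_real Im_complex_of_real times_complex.sel)
  qed
  then have "noise_ip (rescale c z f) (rescale c z g) = c\<^sup>2 * (\<integral>\<xi>. Re (f (c *\<^sub>R \<xi>) * cnj (g (c *\<^sub>R \<xi>))) \<partial>lborel)"
    by (simp add: noise_ip_def)
  also have "\<dots> = noise_ip f g"
    unfolding noise_ip_def by (subst integral_plane_scale[OF _ c, of "\<lambda>\<xi>. Re (f \<xi> * cnj (g \<xi>))"]) auto
  finally show ?thesis .
qed

lemma sqdist_rescale:
  assumes f: "f \<in> hermitian_L2" and g: "g \<in> hermitian_L2" and c: "0 < c"
  shows "sqdist (rescale c z f) (rescale c z g) = sqdist f g"
proof -
  have [measurable]: "f \<in> borel_measurable borel" "g \<in> borel_measurable borel"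
    by (intro hermitian_L2_measurable f g)+
  have "(cmod (rescale c z f \<xi> - rescale c z g \<xi>))\<^sup>2 = c\<^sup>2 * (cmod (f (c *\<^sub>R \<xi>) - g (c *\<^sub>R \<xi>)))\<^sup>2" for \<xi>
  proof -
    have "rescale c z f \<xi> - rescale c z g \<xi> = complex_of_real c * cis (- (z \<bullet> \<xi>)) * (f (c *\<^sub>R \<xi>) - g (c *\<^sub>R \<xi>))"
      by (simp add: rescale_def right_diff_distrib)
    then show ?thesis by (simp add: norm_mult power_mult_distrib)
  qed
  then have "sqdist (rescale c z f) (rescale c z g) = c\<^sup>2 * (\<integral>\<xi>. (cmod (f (c *\<^sub>R \<xi>) - g (c *\<^sub>R \<xi>)))\<^sup>2 \<partial>lborel)"
    by (simp add: sqdist_def)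
  also have "\<dots> = sqdist f g"
    unfolding sqdist_def by (subst integral_plane_scale[OF _ c, of "\<lambda>\<xi>. (cmod (f \<xi> - g \<xi>))\<^sup>2"]) auto
  finally show ?thesis .
qed

lemma sqdist_triangle:
  assumes f: "f \<in> hermitian_L2" and g: "g \<in> hermitian_L2" and k: "k \<in> hermitian_L2"
  shows "sqdist f k \<le> 2 * sqdist f g + 2 * sqdist g k"
proof -
  have i: "integrable lborel (\<lambda>\<xi>. (cmod (p \<xi> - q \<xi>))\<^sup>2)" if "p \<in> hermitian_L2" "q \<in> hermitian_L2" for p q
    using hermitian_L2_lincomb[OF that, of 1 "-1"] by (simp add: hermitian_L2_def)
  have "sqdist f k \<le> (\<integral>\<xi>. 2 * (cmod (f \<xi> - g \<xi>))\<^sup>2 + 2 * (cmod (g \<xi> - k \<xi>))\<^sup>2 \<partial>lborel)"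
    unfolding sqdist_def
  proof (rule integral_mono)
    fix \<xi>
    have "cmod (f \<xi> - k \<xi>) \<le> cmod (f \<xi> - g \<xi>) + cmod (g \<xi> - k \<xi>)"
      using norm_triangle_ineq[of "f \<xi> - g \<xi>" "g \<xi> - k \<xi>"] by simp
    then have "(cmod (f \<xi> - k \<xi>))\<^sup>2 \<le> (cmod (f \<xi> - g \<xi>) + cmod (g \<xi> - k \<xi>))\<^sup>2" by (intro power_mono) auto
    also have "\<dots> \<le> 2 * (cmod (f \<xi> - g \<xi>))\<^sup>2 + 2 * (cmod (g \<xi> - k \<xi>))\<^sup>2"
      using sum_squares_bound[of "cmod (f \<xi> - g \<xi>)" "cmod (g \<xi> - k \<xi>)"] by (simp add: power2_sum)
    finally show "(cmod (f \<xi> - k \<xi>))\<^sup>2 \<le> 2 * (cmod (f \<xi> - g \<xi>))\<^sup>2 + 2 * (cmod (g \<xi> - k \<xi>))\<^sup>2" .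
  qed (auto intro!: i f g k)
  also have "\<dots> = 2 * sqdist f g + 2 * sqdist g k"
    unfolding sqdist_def by (simp add: i f g k)
  finally show ?thesis .
qed

section \<open>Arc length and the structure tensor of the anisotropy function\<close>

lemma unit_vec_periodic: "unit_vec (t + 2 * pi) = unit_vec t"
  by (simp add: plane_eq_iff)

lemma measurable_unit_vec [measurable]: "unit_vec \<in> borel_measurable borel"
  unfolding unit_vec_axis[abs_def] by (intro borel_measurable_continuous_onI continuous_intros)

lemma integral_arc_length:
  fixes F :: "plane \<Rightarrow> real"
  assumes [measurable]: "F \<in> borel_measurable borel"
  shows "(\<integral>\<Theta>. F \<Theta> \<partial>arc_length) = (\<integral>t. F (unit_vec t) * indicator {0..<2 * pi} t \<partial>lborel)"
  unfolding arc_length_def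
  by (subst integral_distr) (auto simp: integral_restrict_space mult.commute intro!: measurable_restrict_space1)

lemma finite_measure_arc_length: "finite_measure arc_length"
proof -
  have "finite_measure (restrict_space lborel {0..<2 * pi})"
    by (intro finite_measureI) (simp add: emeasure_restrict_space space_restrict_space)
  then show ?thesis
    unfolding arc_length_def by (intro finite_measure.finite_measure_distr) (auto intro!: measurable_restrict_space1)
qed

text \<open>Allows the circle to be cut at a direction that lies on neither arc of the anisotropy
  function.\<close>

lemma integral_shift_periodic:
  fixes G :: "real \<Rightarrow> real"
  assumes [measurable]: "G \<in> borel_measurable borel" and B: "\<And>t. \<bar>G t\<bar> \<le> B" and per: "\<And>t. G (t + 2 * pi) = G t"
    and c: "0 \<le> c" "c \<le> 2 * pi"
  shows "(\<integral>t. G t * indicator {0..<2 * pi} t \<partial>lborel) = (\<integral>t. G t * indicator {c..<c + 2 * pi} t \<partial>lborel)"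
proof -
  have i: "integrable lborel (\<lambda>t. G t * indicator {p..<q} t)" for p q
  proof (rule Bochner_Integration.integrable_bound)
    show "integrable lborel (\<lambda>t. B * indicator {p..<q} t :: real)"
      by (intro integrable_mult_right integrable_real_indicator) (cases "p \<le> q"; auto)+
    show "AE t in lborel. norm (G t * indicator {p..<q} t) \<le> norm (B * indicator {p..<q} t)"
      using order_trans[OF B abs_ge_self] by (intro AE_I2) (auto simp: indicator_def)
  qed measurable
  have "(\<integral>t. G t * indicator {0..<2 * pi} t \<partial>lborel) = (\<integral>t. G t * indicator {0..<c} t + G t * indicator {c..<2 * pi} t \<partial>lborel)"
    using c by (intro Bochner_Integration.integral_cong refl) (auto simp: indicator_def)
  also have "\<dots> = (\<integral>t. G t * indicator {0..<c} t \<partial>lborel) + (\<integral>t. G t * indicator {c..<2 * pi} t \<partial>lborel)"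
    by (intro Bochner_Integration.integral_add i)
  also have "(\<integral>t. G t * indicator {0..<c} t \<partial>lborel) = (\<integral>t. G t * indicator {2 * pi..<c + 2 * pi} t \<partial>lborel)"
  proof -
    have "(\<integral>t. G t * indicator {2 * pi..<c + 2 * pi} t \<partial>lborel) = (\<integral>t. G (2 * pi + 1 * t) * indicator {2 * pi..<c + 2 * pi} (2 * pi + 1 * t) \<partial>lborel)"
      by (subst lborel_integral_real_affine[where c=1 and t="2 * pi"]) auto
    also have "\<dots> = (\<integral>t. G t * indicator {0..<c} t \<partial>lborel)"
      by (intro Bochner_Integration.integral_cong refl) (auto simp: indicator_def add.commute[of "2 * pi"] per)
    finally show ?thesis by simp
  qed
  also have "\<dots> + (\<integral>t. G t * indicator {c..<2 * pi} t \<partial>lborel) = (\<integral>t. G t * indicator {2 * pi..<c + 2 * pi} t + G t * indicator {c..<2 * pi} t \<partial>lborel)"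
    by (intro Bochner_Integration.integral_add[symmetric] i)
  also have "\<dots> = (\<integral>t. G t * indicator {c..<c + 2 * pi} t \<partial>lborel)"
    using c by (intro Bochner_Integration.integral_cong refl) (auto simp: indicator_def)
  finally show ?thesis .
qed

lemma unit_vec_eq_iff: "unit_vec s = unit_vec t \<longleftrightarrow> (\<exists>n::int. s = t + 2 * pi * of_int n)"
  using sin_cos_eq_iff[of s t] by (auto simp: plane_eq_iff mult_ac)

text \<open>Two arguments of one direction differ by a multiple of \<open>2 * pi\<close>, and a
  half-open window of that length contains only one of them; so inside a window the reduction modulo
  \<open>2 * pi\<close> disappears.\<close>

lemma arg_in_unit_vec:
  assumes "q < c + 2 * pi" "c \<le> t" "t < c + 2 * pi" "c \<le> p"
  shows "arg_in (unit_vec t) {p..q} \<longleftrightarrow> t \<in> {p..q}"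
proof
  assume "arg_in (unit_vec t) {p..q}"
  then obtain s where s: "s \<in> {p..q}" "unit_vec t = unit_vec s" by (auto simp: arg_in_iff)
  then obtain n :: int where n: "t = s + 2 * pi * of_int n" by (auto simp: unit_vec_eq_iff)
  have "2 * pi * of_int n < 2 * pi * 1" and "2 * pi * (- 1) < 2 * pi * of_int n"
    using s(1) assms n unfolding atLeastAtMost_iff by linarith+
  then have "of_int n < (1::real)" "-1 < (of_int n::real)"
    using mult_left_less_imp_less[of "2 * pi" _ "1"] mult_left_less_imp_less[of "2 * pi" "-1"] pi_ge_zero by (metis mult_nonneg_nonneg zero_le_numeral)+
  then have "n = 0" by linarith
  then show "t \<in> {p..q}" using n s by simp
qed (auto simp: arg_in_iff)

text \<open>Brings the arc around \<alpha> into the window of \<open>tensor_asymp\<close>, which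
  starts a quarter turn after \<alpha>.\<close>

lemma arg_in_shift: "arg_in \<xi> {p..q} \<longleftrightarrow> arg_in \<xi> {p + 2 * pi..q + 2 * pi}"
proof
  assume "arg_in \<xi> {p..q}"
  then obtain t where "t \<in> {p..q}" "\<xi> = norm \<xi> *\<^sub>R unit_vec t" unfolding arg_in_iff by blast
  then show "arg_in \<xi> {p + 2 * pi..q + 2 * pi}"
    unfolding arg_in_iff by (intro bexI[of _ "t + 2 * pi"]) (auto simp: unit_vec_periodic)
next
  assume "arg_in \<xi> {p + 2 * pi..q + 2 * pi}"
  then obtain t where "t \<in> {p + 2 * pi..q + 2 * pi}" "\<xi> = norm \<xi> *\<^sub>R unit_vec t" unfolding arg_in_iff by blast
  then show "arg_in \<xi> {p..q}"
    unfolding arg_in_iff using unit_vec_periodic[of "t - 2 * pi"] by (intro bexI[of _ "t - 2 * pi"]) auto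
qed

definition tensor_of :: "(plane \<Rightarrow> real) \<Rightarrow> real^2^2" where
  "tensor_of C = (\<chi> i j. \<integral>\<Theta>. \<Theta> $ i * \<Theta> $ j * C \<Theta> \<partial>arc_length)"

text \<open>Double-angle formulas. Averaging such a polynomial over a symmetric arc only damps the
  terms of frequency 2; the bounds on \<open>B\<close> and \<open>D\<close> enter the error
  constant.\<close>

lemma unit_vec_mult_trig:
  fixes i j :: 2
  shows "\<exists>A B D. (\<forall>t. unit_vec t $ i * unit_vec t $ j = A + B * cos (2 * t) + D * sin (2 * t)) \<and> \<bar>B\<bar> \<le> 1 \<and> \<bar>D\<bar> \<le> 1"
proof -
  have trig: "cos t * cos t = 1/2 + 1/2 * cos (2 * t)" "sin t * sin t = 1/2 - 1/2 * cos (2 * t)" "sin t * cos t = 1/2 * sin (2 * t)" for t :: real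
  proof -
    have "sin t * sin t + cos t * cos t = 1" using sin_cos_squared_add[of t] by (simp add: power2_eq_square)
    moreover have "cos (2 * t) = cos t * cos t - sin t * sin t" by (simp add: cos_double power2_eq_square)
    moreover have "sin (2 * t) = 2 * (sin t * cos t)" by (simp add: sin_double)
    ultimately show "cos t * cos t = 1/2 + 1/2 * cos (2 * t)" "sin t * sin t = 1/2 - 1/2 * cos (2 * t)" "sin t * cos t = 1/2 * sin (2 * t)"
      by linarith+
  qed
  consider "i = 1 \<and> j = 1" | "i = 2 \<and> j = 2" | "(i = 1 \<and> j = 2) \<or> (i = 2 \<and> j = 1)" using exhaust_2[of i] exhaust_2[of j] by blast
  then show ?thesis
  proof cases
    case 1 then show ?thesis using trig(1) by (intro exI[of _ "1/2"] exI[of _ "1/2"] exI[of _ 0]) auto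
  next
    case 2 then show ?thesis using trig(2) by (intro exI[of _ "1/2"] exI[of _ "-1/2"] exI[of _ 0]) auto
  next
    case 3 then show ?thesis using trig(3) by (intro exI[of _ 0] exI[of _ 0] exI[of _ "1/2"]) (auto simp: mult.commute)
  qed
qed

lemma tensor_asymp:
  assumes \<alpha>: "- pi / 2 < \<alpha> x" "\<alpha> x < pi / 2" and \<delta>: "0 < \<delta>" "\<delta> < pi / 2"
  shows "\<bar>tensor_of (\<lambda>\<Theta>. (lafbf_C \<alpha> \<delta> x \<Theta>)\<^sup>2) $ i $ j - unit_vec (\<alpha> x) $ i * unit_vec (\<alpha> x) $ j\<bar> \<le> 2 * \<delta>\<^sup>2"
proof -
  define \<alpha>0 where "\<alpha>0 = \<alpha> x"
  define C where "C = (\<lambda>\<Theta>. (lafbf_C \<alpha> \<delta> x \<Theta>)\<^sup>2)"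
  have C_m[measurable]: "C \<in> borel_measurable borel" unfolding C_def by measurable
  obtain A B D where P: "\<And>t. unit_vec t $ i * unit_vec t $ j = A + B * cos (2 * t) + D * sin (2 * t)" and BD: "\<bar>B\<bar> \<le> 1" "\<bar>D\<bar> \<le> 1"
    using unit_vec_mult_trig[of i j] by blast
  define p where "p t = A + B * cos (2 * t) + D * sin (2 * t)" for t :: real
  \<comment> \<open>Since \<open>\<delta> < pi / 2\<close>, the arcs centred at
    \<open>\<alpha>0 + pi\<close> and \<open>\<alpha>0 + 2 * pi\<close> both lie in the window from
    \<open>c\<close> to \<open>c + 2 * pi\<close>.\<close>
  define c where "c = \<alpha>0 + pi / 2"
  have c: "0 \<le> c" "c \<le> 2 * pi" using \<alpha> by (auto simp: c_def \<alpha>0_def)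
  define G where "G t = p t * C (unit_vec t)" for t
  have pm[measurable]: "p \<in> borel_measurable borel" unfolding p_def by measurable
  have [measurable]: "G \<in> borel_measurable borel" unfolding G_def by measurable
  have "tensor_of C $ i $ j = (\<integral>t. G t * indicator {0..<2 * pi} t \<partial>lborel)"
    unfolding tensor_of_def vec_lambda_beta
    by (subst integral_arc_length) (auto simp: G_def P p_def)
  also have "\<dots> = (\<integral>t. G t * indicator {c..<c + 2 * pi} t \<partial>lborel)"
  proof (rule integral_shift_periodic[where B="1 * (1 / (2 * \<delta>))"])
    fix t
    have "\<bar>p t\<bar> \<le> 1"
      unfolding p_def P[symmetric] using component_le_norm_cart[of "unit_vec t"] by (simp add: abs_mult mult_le_one)
    then show "\<bar>G t\<bar> \<le> 1 * (1 / (2 * \<delta>))"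
      unfolding G_def abs_mult C_def using lafbf_C_sq_le[OF \<delta>(1), of \<alpha> x "unit_vec t"] \<delta> by (intro mult_mono) auto
    show "G (t + 2 * pi) = G t" unfolding G_def p_def P[symmetric] by (simp add: unit_vec_periodic)
  qed (use c in auto)
  also have "\<dots> = (\<integral>t. 1 / (4 * \<delta>) * (p t * indicator {\<alpha>0 + pi - \<delta>..\<alpha>0 + pi + \<delta>} t + p t * indicator {\<alpha>0 + 2 * pi - \<delta>..\<alpha>0 + 2 * pi + \<delta>} t) \<partial>lborel)"
  proof (rule Bochner_Integration.integral_cong[OF refl])
    fix t :: real
    show "G t * indicator {c..<c + 2 * pi} t = 1 / (4 * \<delta>) * (p t * indicator {\<alpha>0 + pi - \<delta>..\<alpha>0 + pi + \<delta>} t + p t * indicator {\<alpha>0 + 2 * pi - \<delta>..\<alpha>0 + 2 * pi + \<delta>} t)"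
    proof (cases "t \<in> {c..<c + 2 * pi}")
      case True
      then have t: "c \<le> t" "t < c + 2 * pi" by auto
      have 1: "arg_in (unit_vec t) {\<alpha>0 + pi - \<delta>..\<alpha>0 + pi + \<delta>} \<longleftrightarrow> t \<in> {\<alpha>0 + pi - \<delta>..\<alpha>0 + pi + \<delta>}"
        using \<delta> t by (intro arg_in_unit_vec[where c=c]) (auto simp: c_def)
      have 2: "arg_in (unit_vec t) {\<alpha>0 + 2 * pi - \<delta>..\<alpha>0 + 2 * pi + \<delta>} \<longleftrightarrow> t \<in> {\<alpha>0 + 2 * pi - \<delta>..\<alpha>0 + 2 * pi + \<delta>}"
        using \<delta> t by (intro arg_in_unit_vec[where c=c]) (auto simp: c_def)
      have 3: "arg_in (unit_vec t) {\<alpha>0 - \<delta>..\<alpha>0 + \<delta>} \<longleftrightarrow> t \<in> {\<alpha>0 + 2 * pi - \<delta>..\<alpha>0 + 2 * pi + \<delta>}"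
      proof -
        have "\<alpha>0 - \<delta> + 2 * pi = \<alpha>0 + 2 * pi - \<delta>" "\<alpha>0 + \<delta> + 2 * pi = \<alpha>0 + 2 * pi + \<delta>" by simp_all
        then show ?thesis unfolding 2[symmetric] arg_in_shift[of _ "\<alpha>0 - \<delta>"] by (simp only:)
      qed
      have "C (unit_vec t) = 1 / (4 * \<delta>) * (indicator {\<alpha>0 + 2 * pi - \<delta>..\<alpha>0 + 2 * pi + \<delta>} t + indicator {\<alpha>0 + pi - \<delta>..\<alpha>0 + pi + \<delta>} t)"
        unfolding C_def lafbf_C_sq[OF \<delta>(1)] \<alpha>0_def[symmetric] 1 3 by (simp add: indicator_def)
      then show ?thesis using True by (simp add: G_def algebra_simps add_divide_distrib)
    next
      case False
      then show ?thesis using \<delta> by (auto simp: indicator_def c_def)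
    qed
  qed
  also have "\<dots> = A + (B * cos (2 * \<alpha>0) + D * sin (2 * \<alpha>0)) * (sin (2 * \<delta>) / (2 * \<delta>))"
  proof -
    define F where "F t = A * t + B * sin (2 * t) / 2 - D * cos (2 * t) / 2" for t :: real
    have F: "has_bochner_integral lborel (\<lambda>t. p t * indicator {s - \<delta>..s + \<delta>} t) (F (s + \<delta>) - F (s - \<delta>))" for s
    proof (rule has_bochner_integral_FTC_Icc_real)
      show "(F has_real_derivative p t) (at t)" for t
        unfolding F_def[abs_def] p_def by (auto intro!: derivative_eq_intros)
      show "isCont p t" for t unfolding p_def[abs_def] by (intro continuous_intros)
    qed (use \<delta> in auto)
    have Fv: "F (s + \<delta>) - F (s - \<delta>) = 2 * A * \<delta> + (B * cos (2 * s) + D * sin (2 * s)) * sin (2 * \<delta>)" for s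
      by (simp add: F_def distrib_left right_diff_distrib sin_add sin_diff cos_add cos_diff) (simp add: field_simps)
    \<comment> \<open>Both arcs contribute the same amount, because double angles do not see a half
      turn.\<close>
    have cs: "cos (2 * (\<alpha>0 + pi)) = cos (2 * \<alpha>0)" "sin (2 * (\<alpha>0 + pi)) = sin (2 * \<alpha>0)"
        "cos (2 * (\<alpha>0 + 2 * pi)) = cos (2 * \<alpha>0)" "sin (2 * (\<alpha>0 + 2 * pi)) = sin (2 * \<alpha>0)"
      using cos_periodic[of "2 * \<alpha>0"] sin_periodic[of "2 * \<alpha>0"] cos_periodic[of "2 * \<alpha>0 + 2 * pi"] sin_periodic[of "2 * \<alpha>0 + 2 * pi"]
      by (simp_all add: algebra_simps)
    have "(\<integral>t. 1 / (4 * \<delta>) * (p t * indicator {\<alpha>0 + pi - \<delta>..\<alpha>0 + pi + \<delta>} t + p t * indicator {\<alpha>0 + 2 * pi - \<delta>..\<alpha>0 + 2 * pi + \<delta>} t) \<partial>lborel)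
       = 1 / (4 * \<delta>) * ((F (\<alpha>0 + pi + \<delta>) - F (\<alpha>0 + pi - \<delta>)) + (F (\<alpha>0 + 2 * pi + \<delta>) - F (\<alpha>0 + 2 * pi - \<delta>)))"
      by (rule has_bochner_integral_integral_eq[OF has_bochner_integral_mult_right[OF has_bochner_integral_add[OF F F]]])
    also have "\<dots> = 1 / (4 * \<delta>) * (2 * (2 * A * \<delta> + (B * cos (2 * \<alpha>0) + D * sin (2 * \<alpha>0)) * sin (2 * \<delta>)))"
      unfolding Fv cs by simp
    also have "\<dots> = A + (B * cos (2 * \<alpha>0) + D * sin (2 * \<alpha>0)) * (sin (2 * \<delta>) / (2 * \<delta>))"
      using \<delta> by (simp add: field_simps)
    finally show ?thesis .
  qed
  finally have J: "tensor_of C $ i $ j = A + (B * cos (2 * \<alpha>0) + D * sin (2 * \<alpha>0)) * (sin (2 * \<delta>) / (2 * \<delta>))" .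
  have "tensor_of C $ i $ j - unit_vec \<alpha>0 $ i * unit_vec \<alpha>0 $ j = (B * cos (2 * \<alpha>0) + D * sin (2 * \<alpha>0)) * (sin (2 * \<delta>) / (2 * \<delta>) - 1)"
    unfolding J P by (simp add: algebra_simps)
  also have "\<bar>\<dots>\<bar> \<le> 2 * \<delta>\<^sup>2"
  proof -
    have "\<bar>B * cos (2 * \<alpha>0) + D * sin (2 * \<alpha>0)\<bar> \<le> \<bar>B\<bar> * \<bar>cos (2 * \<alpha>0)\<bar> + \<bar>D\<bar> * \<bar>sin (2 * \<alpha>0)\<bar>"
      using abs_triangle_ineq[of "B * cos (2 * \<alpha>0)" "D * sin (2 * \<alpha>0)"] by (simp add: abs_mult)
    also have "\<dots> \<le> 1 * 1 + 1 * 1" using BD by (intro add_mono mult_mono) auto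
    finally have 1: "\<bar>B * cos (2 * \<alpha>0) + D * sin (2 * \<alpha>0)\<bar> \<le> 2" by simp
    \<comment> \<open>The cubic remainder of the sine, divided by \<open>2 * \<delta>\<close>,
      leaves \<open>2 / 3 * \<delta>\<^sup>2\<close>. Rounded up to \<open>\<delta>\<^sup>2\<close>
      and multiplied by the bound 2 above, it gives the final constant.\<close>
    have "\<bar>sin (2 * \<delta>) - (\<Sum>m<3. sin_coeff m * (2 * \<delta>) ^ m)\<bar> \<le> inverse (fact 3) * \<bar>2 * \<delta>\<bar> ^ 3"
      by (rule Maclaurin_sin_bound)
    then have "\<bar>sin (2 * \<delta>) - 2 * \<delta>\<bar> \<le> (2 * \<delta>) ^ 3 / 6"
      using \<delta> by (simp add: numeral_3_eq_3 sin_coeff_def fact_numeral)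
    then have "\<bar>sin (2 * \<delta>) - 2 * \<delta>\<bar> / (2 * \<delta>) \<le> ((2 * \<delta>) ^ 3 / 6) / (2 * \<delta>)"
      using \<delta> by (intro divide_right_mono) auto
    also have "\<dots> \<le> \<delta>\<^sup>2" using \<delta> by (simp add: power2_eq_square power3_eq_cube)
    also have "\<bar>sin (2 * \<delta>) - 2 * \<delta>\<bar> / (2 * \<delta>) = \<bar>sin (2 * \<delta>) / (2 * \<delta>) - 1\<bar>"
    proof -
      have "sin (2 * \<delta>) / (2 * \<delta>) - 1 = (sin (2 * \<delta>) - 2 * \<delta>) / (2 * \<delta>)" using \<delta> by (simp add: field_simps)
      then have "\<bar>sin (2 * \<delta>) / (2 * \<delta>) - 1\<bar> = \<bar>sin (2 * \<delta>) - 2 * \<delta>\<bar> / \<bar>2 * \<delta>\<bar>" by (simp only: abs_divide)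
      moreover have "\<bar>2 * \<delta>\<bar> = 2 * \<delta>" using \<delta> by simp
      ultimately show ?thesis by simp
    qed
    finally have 2: "\<bar>sin (2 * \<delta>) / (2 * \<delta>) - 1\<bar> \<le> \<delta>\<^sup>2" .
    show ?thesis unfolding abs_mult using 1 2 by (intro mult_mono) auto
  qed
  finally show ?thesis unfolding C_def \<alpha>0_def .
qed

section \<open>The tangent field\<close>

text \<open>Lowers an exponent on a bounded set at the price \<open>D\<^sup>2\<close>; this brings
  all Hurst exponents down to the common value \<open>2 * a\<close>.\<close>

lemma powr_le_square_mult:
  fixes d D e s :: real
  assumes "0 \<le> d" "d \<le> D" "1 \<le> D" "0 \<le> e" "e \<le> s" "s \<le> e + 2"
  shows "d powr s \<le> D\<^sup>2 * d powr e"
proof -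
  have "d powr s = d powr (s - e) * d powr e" by (simp flip: powr_add)
  also have "\<dots> \<le> D powr 2 * d powr e"
  proof (rule mult_right_mono)
    have "d powr (s - e) \<le> D powr (s - e)" using assms by (intro powr_mono2) auto
    also have "\<dots> \<le> D powr 2" using assms by (intro powr_mono) auto
    finally show "d powr (s - e) \<le> D powr 2" .
  qed simp
  finally show ?thesis using assms by simp
qed

lemma sqdist_lincomb:
  "sqdist (\<lambda>\<xi>. complex_of_real c * f \<xi> + complex_of_real d * k \<xi>) (\<lambda>\<xi>. complex_of_real c * g \<xi> + complex_of_real d * k \<xi>) = c\<^sup>2 * sqdist f g"
proof -
  have "complex_of_real c * f \<xi> + complex_of_real d * k \<xi> - (complex_of_real c * g \<xi> + complex_of_real d * k \<xi>) = complex_of_real c * (f \<xi> - g \<xi>)" for \<xi>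
    by (simp add: algebra_simps)
  then show ?thesis by (simp add: sqdist_def norm_mult power_mult_distrib)
qed

context lafbf_params begin

lemma amplitude_scale:
  assumes "0 < c" shows "amplitude y (c *\<^sub>R \<xi>) = c powr (- (h y + 1)) * amplitude y \<xi>"
  unfolding amplitude_def powr_minus using assms by (simp add: lafbf_C_scale powr_mult divide_inverse)

text \<open>With the parameters frozen at \<open>y\<close> the amplitude is homogeneous of degree
  \<open>- (h y + 1)\<close>. This is the self-similarity of the tangent field on the level of
  kernels.\<close>

lemma kernel_scale:
  assumes c: "0 < c"
  shows "kernel (c *\<^sub>R x) y \<xi> = rescale c 0 (\<lambda>\<xi>. complex_of_real (c powr h y) * kernel x y \<xi>) \<xi>"
proof -
  have "c * (c powr h y * c powr (- (h y + 1))) = 1"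
    unfolding powr_minus using c powr_add[of c "h y" 1] by (simp add: field_simps)
  then have *: "complex_of_real c * (complex_of_real (c powr h y) * complex_of_real (c powr (- (h y + 1)))) = 1"
    by (metis of_real_1 of_real_mult)
  have "rescale c 0 (\<lambda>\<xi>. complex_of_real (c powr h y) * kernel x y \<xi>) \<xi>
     = (complex_of_real c * (complex_of_real (c powr h y) * complex_of_real (c powr (- (h y + 1))))) * ((cis (c *\<^sub>R x \<bullet> \<xi>) - 1) * complex_of_real (amplitude y \<xi>))"
    by (simp only: rescale_def kernel_def amplitude_scale[OF c] of_real_mult) (simp add: mult_ac)
  then show ?thesis unfolding * by (simp add: kernel_def)
qed

text \<open>A translation acts on increments of frozen kernels by a phase, whence the stationary
  increments of the tangent field.\<close>

lemma kernel_shift: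
  "kernel (x + z) y \<xi> - kernel z y \<xi> = rescale 1 (- z) (\<lambda>\<xi>. kernel x y \<xi> - kernel 0 y \<xi>) \<xi>"
  by (simp add: kernel_def rescale_def inner_add_left algebra_simps cis_mult)

text \<open>The kernel of the normalised increment at \<open>x0\<close>, written as a two-term
  combination so that \<open>W_lincomb\<close> applies.\<close>

definition increment :: "plane \<Rightarrow> real \<Rightarrow> (plane \<Rightarrow> complex) \<Rightarrow> plane \<Rightarrow> complex" where
  "increment x0 \<rho> f = (\<lambda>\<xi>. complex_of_real (\<rho> powr (- h x0)) * f \<xi> + complex_of_real (- (\<rho> powr (- h x0))) * kernel x0 x0 \<xi>)"

text \<open>Rescaling produces the phase $e^{\mathrm{j}\langle x_0,\xi\rangle/\rho}$, which has no limit; \<^term>\<open>rescale\<close>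
  removes it without changing the covariance.\<close>

lemma kernel_tangent:
  assumes \<rho>: "0 < \<rho>"
  shows "rescale (1 / \<rho>) (x0 /\<^sub>R \<rho>) (increment x0 \<rho> (kernel (x0 + \<rho> *\<^sub>R u) x0)) \<xi> = kernel u x0 \<xi>"
proof -
  define A where "A = complex_of_real (amplitude x0 \<xi>)"
  define s where "s = complex_of_real (1 / \<rho>) * complex_of_real (\<rho> powr (- h x0)) * complex_of_real ((1 / \<rho>) powr (- (h x0 + 1)))"
  have "(1 / \<rho>) powr (- (h x0 + 1)) = \<rho> powr (h x0 + 1)"
    unfolding powr_minus using \<rho> by (simp add: powr_divide)
  then have "1 / \<rho> * \<rho> powr (- h x0) * (1 / \<rho>) powr (- (h x0 + 1)) = 1"
    using \<rho> by (simp add: powr_add powr_minus field_simps)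
  then have s: "s = 1" unfolding s_def by (metis of_real_1 of_real_mult)
  define E where "E = cis (x0 \<bullet> \<xi> / \<rho>)"
  have inner: "(x0 /\<^sub>R \<rho>) \<bullet> \<xi> = x0 \<bullet> \<xi> / \<rho>" "x0 \<bullet> ((1 / \<rho>) *\<^sub>R \<xi>) = x0 \<bullet> \<xi> / \<rho>"
     "(x0 + \<rho> *\<^sub>R u) \<bullet> ((1 / \<rho>) *\<^sub>R \<xi>) = x0 \<bullet> \<xi> / \<rho> + u \<bullet> \<xi>"
    using \<rho> by (simp_all add: inner_add_left divide_inverse mult.commute distrib_left)
  have E: "cis (- (x0 \<bullet> \<xi> / \<rho>)) * E = 1" by (simp add: E_def cis_mult)
  have "rescale (1 / \<rho>) (x0 /\<^sub>R \<rho>) (increment x0 \<rho> (kernel (x0 + \<rho> *\<^sub>R u) x0)) \<xi>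
    = s * (cis (- (x0 \<bullet> \<xi> / \<rho>)) * (E * cis (u \<bullet> \<xi>) - E)) * A"
    using \<rho> unfolding rescale_def increment_def kernel_def inner A_def s_def E_def
    by (simp only: amplitude_scale[of "1 / \<rho>"] zero_less_divide_1_iff of_real_mult of_real_minus cis_mult[symmetric]) (simp add: algebra_simps)
  also have "cis (- (x0 \<bullet> \<xi> / \<rho>)) * (E * cis (u \<bullet> \<xi>) - E) = (cis (- (x0 \<bullet> \<xi> / \<rho>)) * E) * (cis (u \<bullet> \<xi>) - 1)"
    by (simp add: algebra_simps)
  finally show ?thesis by (simp only: E s kernel_def[of u x0 \<xi>] A_def mult_1_left)
qed

lemma increment_hermitian_L2: "f \<in> hermitian_L2 \<Longrightarrow> increment x0 \<rho> f \<in> hermitian_L2"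
  unfolding increment_def by (intro hermitian_L2_lincomb kernel_hermitian_L2)

lemma sqdist_increment: "sqdist (increment x0 \<rho> f) (increment x0 \<rho> g) = \<rho> powr (- 2 * h x0) * sqdist f g"
proof -
  have "(\<rho> powr (- h x0))\<^sup>2 = \<rho> powr (- 2 * h x0)" by (simp add: power2_eq_square flip: powr_add)
  then show ?thesis unfolding increment_def sqdist_lincomb by simp
qed

lemma powr_rho_bound:
  assumes \<rho>: "0 < \<rho>" "\<rho> \<le> 1" and d: "0 \<le> d"
  shows "\<rho> powr (- 2 * h x0) * (\<rho> * d) powr (2 * s) = \<rho> powr (2 * s - 2 * h x0) * d powr (2 * s)"
  using \<rho> d by (simp add: powr_mult powr_diff powr_minus divide_inverse)

text \<open>The exponential bounds \<open>\<rho> powr (2 * h x - 2 * h x0)\<close>, the factor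
  \<open>(2 * R + 1)\<^sup>2\<close> comes from \<open>powr_le_square_mult\<close>, and the 4 is the
  2 of \<open>sqdist_triangle\<close> times the two exponents \<beta> and \<eta>.\<close>

definition incr_const :: "plane \<Rightarrow> real \<Rightarrow> real" where
  "incr_const x0 R = (2 * scale_const * exp (2 * \<Lambda> * R powr \<beta> / \<beta>) + 4 * param_const * (4 + (norm x0 + R)\<^sup>2)) * (2 * R + 1)\<^sup>2"

lemma incr_const_nonneg: "0 \<le> incr_const x0 R"
  using scale_const_nonneg param_const_nonneg by (simp add: incr_const_def)

lemma \<beta>_pos: "0 < \<beta>"
  using a b(2) h[of 0] by linarith

text \<open>The point enters the kernel twice, through the oscillation and through the parameters;
  passing through \<open>kernel y x\<close> separates the two. The parameter part has exponents
  above \<open>h x0\<close>, so there the powers of \<rho> are at most 1.\<close>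

lemma sqdist_increment_le:
  assumes \<rho>: "0 < \<rho>" "\<rho> \<le> 1" and R: "0 \<le> R" "norm u \<le> R" "norm v \<le> R"
  shows "\<rho> powr (- 2 * h x0) * sqdist (kernel (x0 + \<rho> *\<^sub>R u) (x0 + \<rho> *\<^sub>R u)) (kernel (x0 + \<rho> *\<^sub>R v) (x0 + \<rho> *\<^sub>R v))
     \<le> incr_const x0 R * norm (u - v) powr (2 * a)"
proof -
  define x y d where "x = x0 + \<rho> *\<^sub>R u" and "y = x0 + \<rho> *\<^sub>R v" and "d = norm (u - v)"
  define r where "r = \<rho> powr (- 2 * h x0)"
  define P where "P = param_const * (4 + (norm x0 + R)\<^sup>2)"
  define B where "B = (2 * R + 1)\<^sup>2 * d powr (2 * a)"
  have P: "0 \<le> P" using param_const_nonneg by (simp add: P_def)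
  have r: "0 \<le> r" by (simp add: r_def)
  have d: "0 \<le> d" "d \<le> 2 * R + 1" using norm_triangle_ineq4[of u v] R by (auto simp: d_def)
  have ab: "a \<le> b" using h[of 0] by linarith
  have xy: "norm (x - y) = \<rho> * d"
  proof -
    have "x - y = \<rho> *\<^sub>R (u - v)" by (simp add: x_def y_def algebra_simps)
    then show ?thesis using \<rho> by (simp add: d_def)
  qed
  have ny: "norm y \<le> norm x0 + R"
  proof -
    have "norm y \<le> norm x0 + \<rho> * norm v" unfolding y_def using norm_triangle_ineq[of x0 "\<rho> *\<^sub>R v"] \<rho> by simp
    also have "\<rho> * norm v \<le> 1 * R" using \<rho> R by (intro mult_mono) auto
    finally show ?thesis by simp
  qed
  \<comment> \<open>Here \<open>h x\<close> may lie below \<open>h x0\<close>. The Hoelder condition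
    bounds the difference by a multiple of \<open>\<rho> powr \<beta>\<close>, and
    \<open>\<rho> powr \<beta> * (- ln \<rho>)\<close> is at most
    \<open>1 / \<beta>\<close>.\<close>
  have 1: "r * (\<rho> * d) powr (2 * h x) \<le> exp (2 * \<Lambda> * R powr \<beta> / \<beta>) * B"
  proof -
    have "\<bar>h x - h x0\<bar> \<le> \<Lambda> * norm (x - x0) powr \<beta>" by (rule h_holder)
    also have "norm (x - x0) = \<rho> * norm u" using \<rho> by (simp add: x_def)
    also have "(\<rho> * norm u) powr \<beta> \<le> (\<rho> * R) powr \<beta>" using \<rho> R \<beta>_pos by (intro powr_mono2 mult_left_mono) auto
    also have "(\<rho> * R) powr \<beta> = \<rho> powr \<beta> * R powr \<beta>" using \<rho> R by (simp add: powr_mult)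
    finally have hh: "\<bar>h x - h x0\<bar> \<le> \<Lambda> * (\<rho> powr \<beta> * R powr \<beta>)" using \<Lambda> by (simp add: mult_left_mono)
    have l0: "0 \<le> - ln \<rho>" using \<rho> by simp
    have "- ln \<rho> = ln (1 / \<rho>)" using \<rho> by (simp add: ln_div)
    also have "\<dots> \<le> (1 / \<rho>) powr \<beta> / \<beta>" using \<rho> \<beta>_pos by (intro ln_powr_bound) auto
    also have "\<dots> = 1 / (\<rho> powr \<beta> * \<beta>)" using \<rho> by (simp add: powr_divide)
    finally have "\<rho> powr \<beta> * (- ln \<rho>) \<le> 1 / \<beta>" using \<rho> \<beta>_pos by (simp add: field_simps)
    then have rl: "\<Lambda> * R powr \<beta> * (\<rho> powr \<beta> * (- ln \<rho>)) \<le> \<Lambda> * R powr \<beta> * (1 / \<beta>)"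
      using \<Lambda> by (intro mult_left_mono) auto
    have "(2 * h x - 2 * h x0) * ln \<rho> \<le> 2 * (\<bar>h x - h x0\<bar> * (- ln \<rho>))"
    proof -
      have "- (h x - h x0) * (- ln \<rho>) \<le> \<bar>h x - h x0\<bar> * (- ln \<rho>)" using l0 by (intro mult_right_mono) auto
      then show ?thesis by (simp add: algebra_simps)
    qed
    also have "\<bar>h x - h x0\<bar> * (- ln \<rho>) \<le> \<Lambda> * (\<rho> powr \<beta> * R powr \<beta>) * (- ln \<rho>)"
      using hh l0 by (rule mult_right_mono)
    also have "\<dots> \<le> \<Lambda> * R powr \<beta> * (1 / \<beta>)" using rl by (simp add: mult_ac)
    finally have "(2 * h x - 2 * h x0) * ln \<rho> \<le> 2 * \<Lambda> * R powr \<beta> / \<beta>" by simp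
    then have e: "\<rho> powr (2 * h x - 2 * h x0) \<le> exp (2 * \<Lambda> * R powr \<beta> / \<beta>)" using \<rho> by (simp add: powr_def)
    have "d powr (2 * h x) \<le> B" unfolding B_def
      using d R a h[of x] b(1) by (intro powr_le_square_mult) auto
    then have "\<rho> powr (2 * h x - 2 * h x0) * d powr (2 * h x) \<le> exp (2 * \<Lambda> * R powr \<beta> / \<beta>) * B"
      using e by (intro mult_mono) auto
    moreover have "r * (\<rho> * d) powr (2 * h x) = \<rho> powr (2 * h x - 2 * h x0) * d powr (2 * h x)"
      unfolding r_def using \<rho> d by (simp add: powr_mult powr_diff powr_minus divide_inverse)
    ultimately show ?thesis by simp
  qed
  have 2: "r * (\<rho> * d) powr (2 * s) \<le> B" if s: "b \<le> s" "s \<le> 1" for s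
  proof -
    have hs: "h x0 \<le> s" using h(2)[of x0] s by linarith
    have "r * (\<rho> * d) powr (2 * s) = \<rho> powr (2 * s - 2 * h x0) * d powr (2 * s)"
      unfolding r_def by (rule powr_rho_bound[OF \<rho> d(1)])
    also have "\<dots> \<le> 1 * d powr (2 * s)"
      using \<rho> hs by (intro mult_right_mono powr_le1) auto
    also have "d powr (2 * s) \<le> B" unfolding B_def
      using d R a ab s by (intro powr_le_square_mult) auto
    finally show ?thesis by simp
  qed
  have "sqdist (kernel x x) (kernel y y) \<le> 2 * sqdist (kernel x x) (kernel y x) + 2 * sqdist (kernel y x) (kernel y y)"
    by (intro sqdist_triangle kernel_hermitian_L2)
  also have "\<dots> \<le> 2 * (scale_const * (\<rho> * d) powr (2 * h x)) + 2 * (P * ((\<rho> * d) powr (2 * \<beta>) + (\<rho> * d) powr (2 * \<eta>)))"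
  proof (intro add_mono mult_left_mono)
    show "sqdist (kernel x x) (kernel y x) \<le> scale_const * (\<rho> * d) powr (2 * h x)"
      using sqdist_kernel_phase[of x x y] by (simp add: xy)
    have "sqdist (kernel y x) (kernel y y) \<le> param_const * (4 + (norm y)\<^sup>2) * ((\<rho> * d) powr (2 * \<beta>) + (\<rho> * d) powr (2 * \<eta>))"
      using sqdist_kernel_param[of y x y] by (simp add: xy)
    also have "\<dots> \<le> P * ((\<rho> * d) powr (2 * \<beta>) + (\<rho> * d) powr (2 * \<eta>))"
      unfolding P_def using ny param_const_nonneg by (intro mult_right_mono mult_left_mono add_left_mono power_mono) auto
    finally show "sqdist (kernel y x) (kernel y y) \<le> P * ((\<rho> * d) powr (2 * \<beta>) + (\<rho> * d) powr (2 * \<eta>))" .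
  qed auto
  finally have "r * sqdist (kernel x x) (kernel y y) \<le> r * (2 * (scale_const * (\<rho> * d) powr (2 * h x)) + 2 * (P * ((\<rho> * d) powr (2 * \<beta>) + (\<rho> * d) powr (2 * \<eta>))))"
    using r by (rule mult_left_mono)
  also have "\<dots> = 2 * scale_const * (r * (\<rho> * d) powr (2 * h x)) + 2 * P * (r * (\<rho> * d) powr (2 * \<beta>) + r * (\<rho> * d) powr (2 * \<eta>))"
    by (simp add: algebra_simps)
  also have "\<dots> \<le> 2 * scale_const * (exp (2 * \<Lambda> * R powr \<beta> / \<beta>) * B) + 2 * P * (B + B)"
    using scale_const_nonneg P b \<eta> by (intro add_mono mult_left_mono 1 2) auto
  also have "\<dots> = incr_const x0 R * d powr (2 * a)"
    by (simp add: incr_const_def B_def P_def algebra_simps)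
  finally show ?thesis unfolding r_def x_def y_def d_def .
qed

lemma sqdist_tangent_increment:
  assumes R: "0 \<le> R" "norm u \<le> R" "norm v \<le> R"
  shows "sqdist (kernel u y) (kernel v y) \<le> scale_const * (2 * R + 1)\<^sup>2 * norm (u - v) powr (2 * a)"
proof -
  have "sqdist (kernel u y) (kernel v y) \<le> scale_const * norm (u - v) powr (2 * h y)" by (rule sqdist_kernel_phase)
  also have "\<dots> \<le> scale_const * ((2 * R + 1)\<^sup>2 * norm (u - v) powr (2 * a))"
    using R a h[of y] b(1) scale_const_nonneg norm_triangle_ineq4[of u v]
    by (intro mult_left_mono powr_le_square_mult) auto
  finally show ?thesis by simp
qed

text \<open>By \<open>kernel_tangent\<close> the limit is, for every \<rho>, the rescaled increment
  with parameters frozen at \<open>x0\<close>. Only the variation of the parameters is left, and it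
  carries positive powers of \<rho>.\<close>

lemma sqdist_tangent_limit:
  "((\<lambda>\<rho>. sqdist (rescale (1 / \<rho>) (x0 /\<^sub>R \<rho>) (increment x0 \<rho> (kernel (x0 + \<rho> *\<^sub>R u) (x0 + \<rho> *\<^sub>R u)))) (kernel u x0)) \<longlongrightarrow> 0) (at_right 0)"
proof -
  define P where "P = param_const * (4 + (norm x0 + norm u)\<^sup>2)"
  define S where "S \<rho> = sqdist (rescale (1 / \<rho>) (x0 /\<^sub>R \<rho>) (increment x0 \<rho> (kernel (x0 + \<rho> *\<^sub>R u) (x0 + \<rho> *\<^sub>R u)))) (kernel u x0)" for \<rho>
  define U where "U \<rho> = P * (\<rho> powr (2 * \<beta> - 2 * h x0) * norm u powr (2 * \<beta>) + \<rho> powr (2 * \<eta> - 2 * h x0) * norm u powr (2 * \<eta>))" for \<rho>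
  have hs: "h x0 < \<beta>" "h x0 < \<eta>" using h(2)[of x0] b \<eta> by linarith+
  have le: "S \<rho> \<le> U \<rho>" if \<rho>: "0 < \<rho>" "\<rho> \<le> 1" for \<rho>
  proof -
    define x where "x = x0 + \<rho> *\<^sub>R u"
    have "kernel u x0 = rescale (1 / \<rho>) (x0 /\<^sub>R \<rho>) (increment x0 \<rho> (kernel x x0))"
      unfolding x_def using kernel_tangent[OF \<rho>(1)] by (simp add: fun_eq_iff)
    then have "S \<rho> = sqdist (rescale (1 / \<rho>) (x0 /\<^sub>R \<rho>) (increment x0 \<rho> (kernel x x))) (rescale (1 / \<rho>) (x0 /\<^sub>R \<rho>) (increment x0 \<rho> (kernel x x0)))"
      by (simp add: S_def x_def)
    also have "\<dots> = \<rho> powr (- 2 * h x0) * sqdist (kernel x x) (kernel x x0)"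
      using \<rho> by (simp add: sqdist_rescale increment_hermitian_L2 kernel_hermitian_L2 sqdist_increment)
    also have "\<dots> \<le> \<rho> powr (- 2 * h x0) * (param_const * (4 + (norm x)\<^sup>2) * ((\<rho> * norm u) powr (2 * \<beta>) + (\<rho> * norm u) powr (2 * \<eta>)))"
      using sqdist_kernel_param[of x x x0] \<rho> by (intro mult_left_mono) (auto simp: x_def)
    also have "\<dots> \<le> \<rho> powr (- 2 * h x0) * (P * ((\<rho> * norm u) powr (2 * \<beta>) + (\<rho> * norm u) powr (2 * \<eta>)))"
    proof -
      have "norm x \<le> norm x0 + \<rho> * norm u" unfolding x_def using norm_triangle_ineq[of x0 "\<rho> *\<^sub>R u"] \<rho> by simp
      also have "\<rho> * norm u \<le> 1 * norm u" using \<rho> by (intro mult_right_mono) auto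
      finally show ?thesis unfolding P_def using param_const_nonneg
        by (intro mult_right_mono mult_left_mono add_left_mono power_mono) auto
    qed
    also have "\<dots> = P * (\<rho> powr (- 2 * h x0) * (\<rho> * norm u) powr (2 * \<beta>) + \<rho> powr (- 2 * h x0) * (\<rho> * norm u) powr (2 * \<eta>))"
      by (simp add: algebra_simps)
    also have "\<dots> = U \<rho>"
      unfolding U_def using hs by (subst (1 2) powr_rho_bound[OF \<rho>]) auto
    finally show ?thesis .
  qed
  have p0: "((\<lambda>\<rho>. \<rho> powr s) \<longlongrightarrow> 0) (at_right 0)" if "0 < s" for s :: real
    using that by (intro tendsto_zero_powrI[where b=s]) (auto simp: eventually_at_filter)
  have "(U \<longlongrightarrow> P * (0 * norm u powr (2 * \<beta>) + 0 * norm u powr (2 * \<eta>))) (at_right 0)"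
    unfolding U_def using hs by (intro tendsto_intros p0) auto
  then have U0: "(U \<longlongrightarrow> 0) (at_right 0)" by simp
  have "\<forall>\<^sub>F \<rho> in at_right 0. S \<rho> \<le> U \<rho>"
    by (rule eventually_mono[OF eventually_at_right_real[OF zero_less_one]]) (auto intro: le)
  moreover have "\<forall>\<^sub>F \<rho> in at_right 0. 0 \<le> S \<rho>" by (simp add: S_def sqdist_def)
  ultimately have "(S \<longlongrightarrow> 0) (at_right 0)"
    using tendsto_sandwich[OF _ _ tendsto_const U0, of S] by blast
  then show ?thesis unfolding S_def .
qed

end

section \<open>Versions and uniform closeness on balls\<close>

lemma gaussian_increments_version:
  assumes "prob_space M" and V: "continuous_version M Z Z'" and Z: "gaussian_increments M Z \<gamma> K r"
  shows "gaussian_increments M Z' \<gamma> K r"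
proof -
  have m[measurable]: "Z' u \<in> borel_measurable M" "Z u \<in> borel_measurable M" for u
    using V Z by (auto simp: continuous_version_def continuous_field_def gaussian_increments_def)
  have ae: "AE \<omega> in M. Z' u \<omega> = Z u \<omega>" for u using V by (auto simp: continuous_version_def)
  have d: "AE \<omega> in M. Z' u \<omega> - Z' v \<omega> = Z u \<omega> - Z v \<omega>" for u v using ae[of u] ae[of v] by eventually_elim simp
  have "(\<integral>\<omega>. (Z' u \<omega> - Z' v \<omega>)\<^sup>2 \<partial>M) = (\<integral>\<omega>. (Z u \<omega> - Z v \<omega>)\<^sup>2 \<partial>M)" for u v
    using d[of u v] by (intro integral_cong_AE) auto
  moreover have "centered_gaussian M (\<lambda>\<omega>. Z' u \<omega> - Z' v \<omega>)" for u v
    using Z by (intro centered_gaussian_cong_AE[OF _ d]) (auto simp: gaussian_increments_def)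
  ultimately show ?thesis using Z by (simp add: gaussian_increments_def)
qed

context white_noise begin

lemma gaussian_increments_W:
  assumes g: "\<And>u. g u \<in> hermitian_L2"
    and le: "\<And>u v. norm u \<le> r \<Longrightarrow> norm v \<le> r \<Longrightarrow> sqdist (g u) (g v) \<le> K * norm (u - v) powr (2 * \<gamma>)"
  shows "gaussian_increments M (\<lambda>u. W (g u)) \<gamma> K r"
  unfolding gaussian_increments_def using measurable_W[OF g] gaussian_W_diff[OF g g] variance_diff[OF g g] le by simp

lemma continuous_version_W:
  assumes g: "\<And>u. g u \<in> hermitian_L2" and \<gamma>: "0 < \<gamma>"
    and K: "\<And>r. 0 \<le> r \<Longrightarrow> 0 \<le> K r"
    and le: "\<And>r u v. 0 \<le> r \<Longrightarrow> norm u \<le> r \<Longrightarrow> norm v \<le> r \<Longrightarrow> sqdist (g u) (g v) \<le> K r * norm (u - v) powr (2 * \<gamma>)"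
  shows "\<exists>Z. continuous_version M (\<lambda>u. W (g u)) Z"
proof (rule continuous_version_exists[OF _ \<gamma>])
  fix m
  show "\<exists>K\<ge>0. gaussian_increments M (\<lambda>u. W (g u)) \<gamma> K (real m)"
    using K[of "real m"] by (intro exI[of _ "K (real m)"] conjI gaussian_increments_W g le) auto
qed

end

lemma interp_diff_le: "\<bar>interp n f x - interp n g x\<bar> \<le> (\<Sum>a\<in>grid_box n. \<bar>f (grid_pt n a) - g (grid_pt n a)\<bar>)"
proof -
  have "\<bar>interp n f x - interp n g x\<bar> = \<bar>\<Sum>a\<in>grid_box n. (f (grid_pt n a) - g (grid_pt n a)) * grid_wt n a x\<bar>"
    by (simp add: interp_def sum_subtractf left_diff_distrib)
  also have "\<dots> \<le> (\<Sum>a\<in>grid_box n. \<bar>f (grid_pt n a) - g (grid_pt n a)\<bar>)"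
    by (rule order_trans[OF sum_abs sum_mono]) (simp add: abs_mult mult_left_le grid_wt_le_1)
  finally show ?thesis .
qed

text \<open>The chaining bound controls both fields away from a fixed grid, uniformly in the parameter; on the
  grid, mean square convergence suffices.\<close>

lemma (in prob_space) uniform_close:
  fixes Zt :: "'r \<Rightarrow> plane \<Rightarrow> 'a \<Rightarrow> real"
  assumes \<gamma>: "0 < \<gamma>" and K: "0 \<le> K" "0 \<le> K'"
    and Y: "continuous_field M Y" "gaussian_increments M Y \<gamma> K (real m + 2)"
    and Zt: "\<forall>\<^sub>F r in F. continuous_field M (Zt r) \<and> gaussian_increments M (Zt r) \<gamma> K' (real m + 2) \<and>
      (\<forall>u. (\<integral>\<^sup>+\<omega>. ennreal ((Zt r u \<omega> - Y u \<omega>)\<^sup>2) \<partial>M) \<le> ennreal (S r u))"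
    and S: "\<And>u. ((\<lambda>r. S r u) \<longlongrightarrow> 0) F" and S0: "\<And>r u. 0 \<le> S r u" and e: "0 < e"
  shows "\<forall>\<^sub>F r in F. \<exists>D. D \<in> borel_measurable M \<and> (\<integral>\<^sup>+\<omega>. D \<omega> \<partial>M) \<le> ennreal e \<and>
        (\<forall>\<omega>\<in>space M. \<forall>x. norm x \<le> real m \<longrightarrow> ennreal \<bar>Zt r x \<omega> - Y x \<omega>\<bar> \<le> D \<omega>)"
proof -
  have tail: "(\<lambda>n. \<Sum>j. chain_bound \<gamma> k (j + n)) \<longlonglongrightarrow> 0" for k
    by (rule suminf_exist_split2) (rule summable_chain_bound[OF \<gamma>])
  have "\<forall>\<^sub>F n in sequentially. (\<Sum>j. chain_bound \<gamma> K (j + n)) < e / 4 \<and> (\<Sum>j. chain_bound \<gamma> K' (j + n)) < e / 4 \<and> m \<le> n"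
    using e by (intro eventually_conj order_tendstoD(2)[OF tail] eventually_ge_at_top) auto
  then obtain n where n: "(\<Sum>j. chain_bound \<gamma> K (j + n)) < e / 4" "(\<Sum>j. chain_bound \<gamma> K' (j + n)) < e / 4" "m \<le> n"
    by (auto dest: eventually_happens)
  obtain D1 where D1[measurable]: "D1 \<in> borel_measurable M" and D1i: "(\<integral>\<^sup>+\<omega>. D1 \<omega> \<partial>M) \<le> ennreal (\<Sum>j. chain_bound \<gamma> K (j + n))"
    and D1b: "\<And>\<omega> x. \<omega> \<in> space M \<Longrightarrow> norm x \<le> real m \<Longrightarrow> ennreal \<bar>Y x \<omega> - interp n (\<lambda>u. Y u \<omega>) x\<bar> \<le> D1 \<omega>"
    using chain_tail[OF Y(2) \<gamma> K(1) n(3)] Y(1) by (auto simp: continuous_field_def)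
  \<comment> \<open>The budget: the two chaining tails take \<open>e / 4\<close> each. On the grid
    the constants \<open>d\<close> add up to at most \<open>N * d = e / 4\<close>, and the squares
    to \<open>e / 4\<close> once the sum of \<open>S\<close> is below \<open>d * e / 4\<close>. The
    extra 1 makes \<open>N\<close> positive.\<close>
  define N where "N = real (card (grid_box n)) + 1"
  have N: "N > 0" by (simp add: N_def)
  define d where "d = e / (4 * N)"
  have d: "d > 0" using e N by (simp add: d_def)
  have "((\<lambda>r. \<Sum>a\<in>grid_box n. S r (grid_pt n a)) \<longlongrightarrow> 0) F"
    by (intro tendsto_null_sum S)
  then have "\<forall>\<^sub>F r in F. (\<Sum>a\<in>grid_box n. S r (grid_pt n a)) < d * e / 4"
    using d e by (intro order_tendstoD(2)) auto
  then show ?thesis using Zt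
  proof eventually_elim
    case (elim r)
    have Zr: "continuous_field M (Zt r)" "gaussian_increments M (Zt r) \<gamma> K' (real m + 2)"
      and Sr: "\<And>u. (\<integral>\<^sup>+\<omega>. ennreal ((Zt r u \<omega> - Y u \<omega>)\<^sup>2) \<partial>M) \<le> ennreal (S r u)" using elim by auto
    have [measurable]: "Zt r u \<in> borel_measurable M" "Y u \<in> borel_measurable M" for u
      using Zr(1) Y(1) by (auto simp: continuous_field_def)
    obtain D2 where D2[measurable]: "D2 \<in> borel_measurable M" and D2i: "(\<integral>\<^sup>+\<omega>. D2 \<omega> \<partial>M) \<le> ennreal (\<Sum>j. chain_bound \<gamma> K' (j + n))"
      and D2b: "\<And>\<omega> x. \<omega> \<in> space M \<Longrightarrow> norm x \<le> real m \<Longrightarrow> ennreal \<bar>Zt r x \<omega> - interp n (\<lambda>u. Zt r u \<omega>) x\<bar> \<le> D2 \<omega>"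
      using chain_tail[OF Zr(2) \<gamma> K(2) n(3)] Zr(1) by (auto simp: continuous_field_def)
    define V where "V a \<omega> = (Zt r (grid_pt n a) \<omega> - Y (grid_pt n a) \<omega>)" for a \<omega>
    have Vm[measurable]: "V a \<in> borel_measurable M" for a unfolding V_def by measurable
    define D3 where "D3 \<omega> = (\<Sum>a\<in>grid_box n. ennreal d + ennreal (1 / d) * ennreal ((V a \<omega>)\<^sup>2))" for \<omega>
    have [measurable]: "D3 \<in> borel_measurable M" unfolding D3_def by measurable
    have abs_le: "\<bar>t\<bar> \<le> d + 1 / d * t\<^sup>2" for t
    proof -
      have "(\<bar>t\<bar> - d)\<^sup>2 = t\<^sup>2 - 2 * (\<bar>t\<bar> * d) + d\<^sup>2" by (simp add: power2_diff)
      then have "2 * (\<bar>t\<bar> * d) \<le> d\<^sup>2 + t\<^sup>2" using zero_le_power2[of "\<bar>t\<bar> - d"] by linarith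
      moreover have "0 \<le> \<bar>t\<bar> * d" using d by simp
      ultimately have "\<bar>t\<bar> * d \<le> d\<^sup>2 + t\<^sup>2" by linarith
      then show ?thesis using d by (simp add: field_simps power2_eq_square)
    qed
    have D3b: "ennreal \<bar>interp n (\<lambda>u. Zt r u \<omega>) x - interp n (\<lambda>u. Y u \<omega>) x\<bar> \<le> D3 \<omega>" for \<omega> x
    proof -
      have "ennreal \<bar>interp n (\<lambda>u. Zt r u \<omega>) x - interp n (\<lambda>u. Y u \<omega>) x\<bar> \<le> ennreal (\<Sum>a\<in>grid_box n. \<bar>V a \<omega>\<bar>)"
        unfolding V_def by (intro ennreal_leI interp_diff_le)
      also have "\<dots> = (\<Sum>a\<in>grid_box n. ennreal \<bar>V a \<omega>\<bar>)" by (rule sum_ennreal[symmetric]) simp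
      also have "\<dots> \<le> D3 \<omega>"
        unfolding D3_def
      proof (rule sum_mono)
        fix a
        have "ennreal \<bar>V a \<omega>\<bar> \<le> ennreal (d + 1 / d * (V a \<omega>)\<^sup>2)" by (intro ennreal_leI abs_le)
        also have "\<dots> = ennreal d + ennreal (1 / d) * ennreal ((V a \<omega>)\<^sup>2)"
          using d by (subst ennreal_plus) (auto simp: ennreal_mult[symmetric])
        finally show "ennreal \<bar>V a \<omega>\<bar> \<le> ennreal d + ennreal (1 / d) * ennreal ((V a \<omega>)\<^sup>2)" .
      qed
      finally show ?thesis .
    qed
    have D3i: "(\<integral>\<^sup>+\<omega>. D3 \<omega> \<partial>M) \<le> ennreal (e / 2)"
    proof -
      have "(\<integral>\<^sup>+\<omega>. D3 \<omega> \<partial>M) = (\<Sum>a\<in>grid_box n. ennreal d + ennreal (1 / d) * (\<integral>\<^sup>+\<omega>. ennreal ((V a \<omega>)\<^sup>2) \<partial>M))"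
        unfolding D3_def by (simp add: nn_integral_sum nn_integral_add nn_integral_cmult emeasure_space_1)
      also have "\<dots> \<le> (\<Sum>a\<in>grid_box n. ennreal (d + 1 / d * S r (grid_pt n a)))"
      proof (rule sum_mono)
        fix a
        have "(\<integral>\<^sup>+\<omega>. ennreal ((V a \<omega>)\<^sup>2) \<partial>M) \<le> ennreal (S r (grid_pt n a))"
          unfolding V_def by (rule Sr)
        then have "ennreal d + ennreal (1 / d) * (\<integral>\<^sup>+\<omega>. ennreal ((V a \<omega>)\<^sup>2) \<partial>M) \<le> ennreal d + ennreal (1 / d) * ennreal (S r (grid_pt n a))"
          by (intro add_left_mono mult_left_mono) auto
        also have "\<dots> = ennreal (d + 1 / d * S r (grid_pt n a))"
          using d S0[of r "grid_pt n a"] by (subst ennreal_plus) (auto simp: ennreal_mult[symmetric])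
        finally show "ennreal d + ennreal (1 / d) * (\<integral>\<^sup>+\<omega>. ennreal ((V a \<omega>)\<^sup>2) \<partial>M) \<le> ennreal (d + 1 / d * S r (grid_pt n a))" .
      qed
      also have "\<dots> = ennreal (\<Sum>a\<in>grid_box n. d + 1 / d * S r (grid_pt n a))"
        using d S0 by (intro sum_ennreal) auto
      also have "\<dots> \<le> ennreal (e / 2)"
      proof (rule ennreal_leI)
        have "(\<Sum>a\<in>grid_box n. d + 1 / d * S r (grid_pt n a)) = (N - 1) * d + 1 / d * (\<Sum>a\<in>grid_box n. S r (grid_pt n a))"
          by (simp add: sum.distrib sum_distrib_left N_def)
        also have "\<dots> \<le> N * d + 1 / d * (d * e / 4)"
          using elim(1) d by (intro add_mono mult_left_mono mult_right_mono) auto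
        also have "\<dots> = e / 2" using d N by (simp add: d_def field_simps)
        finally show "(\<Sum>a\<in>grid_box n. d + 1 / d * S r (grid_pt n a)) \<le> e / 2" .
      qed
      finally show ?thesis .
    qed
    define D where "D \<omega> = D1 \<omega> + D2 \<omega> + D3 \<omega>" for \<omega>
    have "(\<integral>\<^sup>+\<omega>. D \<omega> \<partial>M) = (\<integral>\<^sup>+\<omega>. D1 \<omega> \<partial>M) + (\<integral>\<^sup>+\<omega>. D2 \<omega> \<partial>M) + (\<integral>\<^sup>+\<omega>. D3 \<omega> \<partial>M)"
      unfolding D_def by (simp add: nn_integral_add)
    also have "\<dots> \<le> ennreal (e / 4) + ennreal (e / 4) + ennreal (e / 2)"
      using n(1,2) by (intro add_mono order_trans[OF D1i] order_trans[OF D2i] D3i ennreal_leI) auto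
    also have "\<dots> = ennreal e" using e by (simp flip: ennreal_plus)
    finally have "(\<integral>\<^sup>+\<omega>. D \<omega> \<partial>M) \<le> ennreal e" .
    moreover have "ennreal \<bar>Zt r x \<omega> - Y x \<omega>\<bar> \<le> D \<omega>" if "\<omega> \<in> space M" "norm x \<le> real m" for \<omega> x
    proof -
      let ?i = "interp n (\<lambda>u. Zt r u \<omega>) x" and ?j = "interp n (\<lambda>u. Y u \<omega>) x"
      have "ennreal \<bar>Zt r x \<omega> - Y x \<omega>\<bar> \<le> ennreal (\<bar>Y x \<omega> - ?j\<bar> + \<bar>Zt r x \<omega> - ?i\<bar> + \<bar>?i - ?j\<bar>)"
        by (intro ennreal_leI) linarith
      also have "\<dots> = ennreal \<bar>Y x \<omega> - ?j\<bar> + ennreal \<bar>Zt r x \<omega> - ?i\<bar> + ennreal \<bar>?i - ?j\<bar>"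
        by (simp add: ennreal_plus)
      also have "\<dots> \<le> D \<omega>" unfolding D_def by (intro add_mono D1b D2b D3b that)
      finally show ?thesis .
    qed
    moreover have "D \<in> borel_measurable M" unfolding D_def by measurable
    ultimately show ?case by blast
  qed
qed

section \<open>The random field and its tangent field\<close>

locale lafbf_field = white_noise M W + lafbf_params h \<alpha> a b \<beta> \<eta> \<delta> \<Lambda>
  for M :: "'a measure" and W and h \<alpha> a b \<beta> \<eta> \<delta> \<Lambda>
begin

lemma lafbf_kernel: "lafbf W h \<alpha> \<delta> x = W (kernel x x)"
  by (simp add: lafbf_def kernel_def[abs_def] amplitude_def)

lemma lafbf_continuous_version: "\<exists>X. continuous_version M (lafbf W h \<alpha> \<delta>) X"
proof -
  have "\<exists>X. continuous_version M (\<lambda>x. W (kernel x x)) X"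
  proof (rule continuous_version_W[OF kernel_hermitian_L2 a, of "incr_const 0"])
    fix r :: real and u v :: plane assume "0 \<le> r" "norm u \<le> r" "norm v \<le> r"
    \<comment> \<open>With \<open>\<rho> = 1\<close> and base point 0 the rescaled field is the
      field itself.\<close>
    from sqdist_increment_le[OF zero_less_one order_refl this, of 0]
    show "sqdist (kernel u u) (kernel v v) \<le> incr_const 0 r * norm (u - v) powr (2 * a)" by simp
  qed (rule incr_const_nonneg)
  then show ?thesis by (simp add: lafbf_kernel[abs_def])
qed

lemma tangent_continuous_version: "\<exists>Y. continuous_version M (\<lambda>u. W (kernel u x0)) Y"
  by (rule continuous_version_W[OF kernel_hermitian_L2 a, of "\<lambda>r. scale_const * (2 * r + 1)\<^sup>2"])
     (auto intro: sqdist_tangent_increment mult_nonneg_nonneg scale_const_nonneg)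

text \<open>Has the covariances of the normalised increments but, unlike their kernels, converges in
  L2 to \<open>kernel u x0\<close>.\<close>

definition coupling_kernel :: "plane \<Rightarrow> real \<Rightarrow> plane \<Rightarrow> plane \<Rightarrow> complex" where
  "coupling_kernel x0 \<rho> u = rescale (1 / \<rho>) (x0 /\<^sub>R \<rho>) (increment x0 \<rho> (kernel (x0 + \<rho> *\<^sub>R u) (x0 + \<rho> *\<^sub>R u)))"

lemma coupling_kernel_hermitian_L2: "0 < \<rho> \<Longrightarrow> coupling_kernel x0 \<rho> u \<in> hermitian_L2"
  unfolding coupling_kernel_def by (intro rescale_hermitian_L2 increment_hermitian_L2 kernel_hermitian_L2) auto

lemma sqdist_coupling_kernel:
  assumes \<rho>: "0 < \<rho>" "\<rho> \<le> 1" and R: "0 \<le> R" "norm u \<le> R" "norm v \<le> R"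
  shows "sqdist (coupling_kernel x0 \<rho> u) (coupling_kernel x0 \<rho> v) \<le> incr_const x0 R * norm (u - v) powr (2 * a)"
  using sqdist_increment_le[OF \<rho> R, of x0] \<rho>
  by (simp add: coupling_kernel_def sqdist_rescale increment_hermitian_L2 kernel_hermitian_L2 sqdist_increment)

lemma coupling_continuous_version:
  assumes \<rho>: "0 < \<rho>" "\<rho> \<le> 1"
  shows "\<exists>Z. continuous_version M (\<lambda>u. W (coupling_kernel x0 \<rho> u)) Z"
  by (rule continuous_version_W[OF coupling_kernel_hermitian_L2[OF \<rho>(1)] a, of "incr_const x0"])
     (auto intro: sqdist_coupling_kernel[OF \<rho>] incr_const_nonneg)

lemma tangent_converges:
  assumes X: "continuous_version M (lafbf W h \<alpha> \<delta>) X" and Y: "continuous_version M (\<lambda>u. W (kernel u x0)) Y"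
  shows "converges_weakly M (\<lambda>\<rho> u \<omega>. \<rho> powr (- h x0) * (X (x0 + \<rho> *\<^sub>R u) \<omega> - X x0 \<omega>)) M Y (at_right 0)"
proof -
  \<comment> \<open>A version is chosen separately for each \<rho>, since weak convergence compares
    the fields at one \<rho> at a time.\<close>
  define Zt where "Zt \<rho> = (SOME Z. continuous_version M (\<lambda>u. W (coupling_kernel x0 \<rho> u)) Z)" for \<rho>
  have Zt: "continuous_version M (\<lambda>u. W (coupling_kernel x0 \<rho> u)) (Zt \<rho>)" if "0 < \<rho>" "\<rho> \<le> 1" for \<rho>
    unfolding Zt_def by (rule someI_ex[OF coupling_continuous_version[OF that]])
  have ev: "\<forall>\<^sub>F \<rho> in at_right 0. 0 < \<rho> \<and> \<rho> \<le> (1::real)"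
    by (rule eventually_mono[OF eventually_at_right_real[OF zero_less_one]]) auto
  have Xf: "continuous_field M X" and Xae: "AE \<omega> in M. X x \<omega> = W (kernel x x) \<omega>" for x
    using X by (auto simp: continuous_version_def lafbf_kernel)
  have Yf: "continuous_field M Y" and Yae: "AE \<omega> in M. Y u \<omega> = W (kernel u x0) \<omega>" for u
    using Y by (auto simp: continuous_version_def)
  show ?thesis
  proof (rule converges_weakly_coupling[OF prob_space_axioms Yf])
    show "\<forall>\<^sub>F \<rho> in at_right 0. continuous_field M (\<lambda>u \<omega>. \<rho> powr (- h x0) * (X (x0 + \<rho> *\<^sub>R u) \<omega> - X x0 \<omega>)) \<and>
       continuous_field M (Zt \<rho>) \<and> same_fdd M (\<lambda>u \<omega>. \<rho> powr (- h x0) * (X (x0 + \<rho> *\<^sub>R u) \<omega> - X x0 \<omega>)) M (Zt \<rho>)"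
      using ev
    proof eventually_elim
      case (elim \<rho>)
      have [measurable]: "X x \<in> borel_measurable M" for x using Xf by (simp add: continuous_field_def)
      have "continuous_on UNIV (\<lambda>u. \<rho> powr (- h x0) * (X (x0 + \<rho> *\<^sub>R u) \<omega> - X x0 \<omega>))" if "\<omega> \<in> space M" for \<omega>
      proof -
        have c: "continuous_on UNIV (\<lambda>x. X x \<omega>)" using Xf that by (simp add: continuous_field_def)
        show ?thesis by (intro continuous_intros continuous_on_compose2[OF c]) auto
      qed
      then have f1: "continuous_field M (\<lambda>u \<omega>. \<rho> powr (- h x0) * (X (x0 + \<rho> *\<^sub>R u) \<omega> - X x0 \<omega>))"
        by (simp add: continuous_field_def)
      have f2: "continuous_field M (Zt \<rho>)" using Zt elim by (simp add: continuous_version_def)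
      have "same_fdd M (\<lambda>u \<omega>. \<rho> powr (- h x0) * (X (x0 + \<rho> *\<^sub>R u) \<omega> - X x0 \<omega>)) M (Zt \<rho>)"
      proof (rule noise_same_fdd)
        let ?g = "\<lambda>u. increment x0 \<rho> (kernel (x0 + \<rho> *\<^sub>R u) (x0 + \<rho> *\<^sub>R u))"
        show g: "?g u \<in> hermitian_L2" for u by (intro increment_hermitian_L2 kernel_hermitian_L2)
        show "coupling_kernel x0 \<rho> u \<in> hermitian_L2" for u using elim by (intro coupling_kernel_hermitian_L2) auto
        show "noise_ip (?g u) (?g v) = noise_ip (coupling_kernel x0 \<rho> u) (coupling_kernel x0 \<rho> v)" for u v
          unfolding coupling_kernel_def using elim by (intro noise_ip_rescale[symmetric] g) auto
        show "AE \<omega> in M. \<rho> powr (- h x0) * (X (x0 + \<rho> *\<^sub>R u) \<omega> - X x0 \<omega>) = W (?g u) \<omega>" for u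
          using Xae[of "x0 + \<rho> *\<^sub>R u"] Xae[of x0]
             W_lincomb[OF kernel_hermitian_L2 kernel_hermitian_L2, of "\<rho> powr (- h x0)" "x0 + \<rho> *\<^sub>R u" "x0 + \<rho> *\<^sub>R u" "- (\<rho> powr (- h x0))" x0 x0]
          by eventually_elim (simp add: increment_def algebra_simps)
        show "AE \<omega> in M. Zt \<rho> u \<omega> = W (coupling_kernel x0 \<rho> u) \<omega>" for u
          using Zt elim by (simp add: continuous_version_def)
      qed (use f1 f2 in \<open>auto simp: continuous_field_def\<close>)
      then show ?case using f1 f2 by blast
    qed
    fix m :: nat and e :: real assume e: "0 < e"
    define S where "S \<rho> u = sqdist (coupling_kernel x0 \<rho> u) (kernel u x0)" for \<rho> u
    define R where "R = real m + 2"
    have R: "0 \<le> R" by (simp add: R_def)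
    show "\<forall>\<^sub>F \<rho> in at_right 0. \<exists>D. D \<in> borel_measurable M \<and> (\<integral>\<^sup>+\<omega>. D \<omega> \<partial>M) \<le> ennreal e \<and>
        (\<forall>\<omega>\<in>space M. \<forall>x. norm x \<le> real m \<longrightarrow> ennreal \<bar>Zt \<rho> x \<omega> - Y x \<omega>\<bar> \<le> D \<omega>)"
    proof (rule uniform_close[OF a _ _ Yf _ _ _ _ e, where S=S and K="scale_const * (2 * R + 1)\<^sup>2" and K'="incr_const x0 R"])
      show "0 \<le> scale_const * (2 * R + 1)\<^sup>2" using scale_const_nonneg by simp
      show "0 \<le> incr_const x0 R" by (rule incr_const_nonneg)
      show "gaussian_increments M Y a (scale_const * (2 * R + 1)\<^sup>2) (real m + 2)"
        using sqdist_tangent_increment[OF R]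
        by (intro gaussian_increments_version[OF prob_space_axioms Y] gaussian_increments_W kernel_hermitian_L2) (auto simp: R_def)
      show "((\<lambda>\<rho>. S \<rho> u) \<longlongrightarrow> 0) (at_right 0)" for u
        unfolding S_def coupling_kernel_def by (rule sqdist_tangent_limit)
      show "0 \<le> S \<rho> u" for \<rho> u by (simp add: S_def sqdist_def)
      show "\<forall>\<^sub>F \<rho> in at_right 0. continuous_field M (Zt \<rho>) \<and> gaussian_increments M (Zt \<rho>) a (incr_const x0 R) (real m + 2) \<and>
        (\<forall>u. (\<integral>\<^sup>+\<omega>. ennreal ((Zt \<rho> u \<omega> - Y u \<omega>)\<^sup>2) \<partial>M) \<le> ennreal (S \<rho> u))"
        using ev
      proof eventually_elim
        case (elim \<rho>)
        then have \<rho>: "0 < \<rho>" "\<rho> \<le> 1" by auto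
        have g: "gaussian_increments M (Zt \<rho>) a (incr_const x0 R) (real m + 2)"
          using sqdist_coupling_kernel[OF \<rho> R]
          by (intro gaussian_increments_version[OF prob_space_axioms Zt[OF \<rho>]] gaussian_increments_W coupling_kernel_hermitian_L2 \<rho>) (auto simp: R_def)
        have "(\<integral>\<^sup>+\<omega>. ennreal ((Zt \<rho> u \<omega> - Y u \<omega>)\<^sup>2) \<partial>M) \<le> ennreal (S \<rho> u)" for u
        proof -
          have h1: "coupling_kernel x0 \<rho> u \<in> hermitian_L2" "kernel u x0 \<in> hermitian_L2"
            by (intro coupling_kernel_hermitian_L2 kernel_hermitian_L2 \<rho>)+
          have "AE \<omega> in M. Zt \<rho> u \<omega> = W (coupling_kernel x0 \<rho> u) \<omega>"
            using Zt[OF \<rho>] by (simp add: continuous_version_def)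
          then have "AE \<omega> in M. ennreal ((Zt \<rho> u \<omega> - Y u \<omega>)\<^sup>2) = ennreal ((W (coupling_kernel x0 \<rho> u) \<omega> - W (kernel u x0) \<omega>)\<^sup>2)"
            using Yae[of u] by eventually_elim simp
          then have "(\<integral>\<^sup>+\<omega>. ennreal ((Zt \<rho> u \<omega> - Y u \<omega>)\<^sup>2) \<partial>M) = (\<integral>\<^sup>+\<omega>. ennreal ((W (coupling_kernel x0 \<rho> u) \<omega> - W (kernel u x0) \<omega>)\<^sup>2) \<partial>M)"
            by (rule nn_integral_cong_AE)
          also have "\<dots> = ennreal (S \<rho> u)"
            unfolding S_def variance_diff[OF h1, symmetric]
            by (intro nn_integral_eq_integral centered_gaussian_square_integrable gaussian_W_diff h1) auto
          finally show ?thesis by simp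
        qed
        then show ?case using g Zt[OF \<rho>] by (simp add: continuous_version_def)
      qed
    qed
  qed
qed

end

context lafbf_field begin

text \<open>The squared amplitude off the origin, written as a radial power times a function of the
  direction so that the anisotropy function can be read off.\<close>

definition spectral :: "plane \<Rightarrow> plane \<Rightarrow> real" where
  "spectral x0 \<xi> = norm \<xi> powr (- 2 * h x0 - 2) * (lafbf_C \<alpha> \<delta> x0 (\<xi> /\<^sub>R norm \<xi>))\<^sup>2"

lemma spectral_amplitude: "\<xi> \<noteq> 0 \<Longrightarrow> spectral x0 \<xi> = (amplitude x0 \<xi>)\<^sup>2"
proof -
  assume \<xi>: "\<xi> \<noteq> 0"
  have "(inverse (norm \<xi> powr (h x0 + 1)))\<^sup>2 = norm \<xi> powr (- 2 * h x0 - 2)"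
    unfolding powr_minus[symmetric] by (simp add: power2_eq_square flip: powr_add)
  then show ?thesis using \<xi>
    by (simp add: spectral_def amplitude_def lafbf_C_scale divide_inverse power_mult_distrib mult.commute)
qed

lemma spectral_kernel:
  "(cis (x \<bullet> \<xi>) - 1) * (cis (- (y \<bullet> \<xi>)) - 1) * complex_of_real (spectral x0 \<xi>) = kernel x x0 \<xi> * cnj (kernel y x0 \<xi>)"
proof (cases "\<xi> = 0")
  case False
  then show ?thesis
    by (simp add: kernel_def spectral_amplitude cis_cnj power2_eq_square mult_ac)
qed (simp add: kernel_def)

lemma tangent_spectral_density:
  assumes Y: "continuous_version M (\<lambda>u. W (kernel u x0)) Y"
  shows "spectral_density M Y (spectral x0)"
  unfolding spectral_density_def Let_def spectral_kernel
proof (intro conjI allI)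
  show "spectral x0 \<in> borel_measurable lborel"
    unfolding spectral_def[abs_def] by measurable
  fix x y
  have [measurable]: "Y u \<in> borel_measurable M" "W (kernel u x0) \<in> borel_measurable M" for u
    using Y measurable_W[OF kernel_hermitian_L2] by (auto simp: continuous_version_def continuous_field_def)
  have ae: "AE \<omega> in M. Y u \<omega> = W (kernel u x0) \<omega>" for u using Y by (simp add: continuous_version_def)
  have "expectation (\<lambda>\<omega>. Y x \<omega> * Y y \<omega>) = expectation (\<lambda>\<omega>. W (kernel x x0) \<omega> * W (kernel y x0) \<omega>)"
  proof (rule integral_cong_AE)
    show "AE \<omega> in M. Y x \<omega> * Y y \<omega> = W (kernel x x0) \<omega> * W (kernel y x0) \<omega>"
      using ae[of x] ae[of y] by eventually_elim simp
  qed measurable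
  then show "complex_of_real (expectation (\<lambda>\<omega>. Y x \<omega> * Y y \<omega>)) = (\<integral>\<xi>. kernel x x0 \<xi> * cnj (kernel y x0 \<xi>) \<partial>lborel)"
    using noise kernel_hermitian_L2 by (simp add: complex_white_noise_def)
  show "integrable lborel (\<lambda>\<xi>. kernel x x0 \<xi> * cnj (kernel y x0 \<xi>))"
    by (intro hermitian_L2_integrable_mult kernel_hermitian_L2)
qed (simp add: spectral_def)

lemma tangent_structure_tensor:
  assumes Y: "continuous_version M (\<lambda>u. W (kernel u x0)) Y"
  shows "has_structure_tensor M (h x0) Y (tensor_of (\<lambda>\<Theta>. (lafbf_C \<alpha> \<delta> x0 \<Theta>)\<^sup>2))"
  unfolding has_structure_tensor_def
proof (intro conjI exI)
  have Ym[measurable]: "Y u \<in> borel_measurable M" for u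
    using Y by (auto simp: continuous_version_def continuous_field_def)
  have ae: "AE \<omega> in M. Y u \<omega> = W (kernel u x0) \<omega>" for u using Y by (simp add: continuous_version_def)
  show "jointly_centered_gaussian M UNIV Y"
    unfolding jointly_centered_gaussian_def
  proof (intro allI impI)
    fix J :: "plane set" and c :: "plane \<Rightarrow> real" assume "finite J \<and> J \<subseteq> UNIV"
    then have J: "finite J" by simp
    have "AE \<omega> in M. \<forall>u\<in>J. Y u \<omega> = W (kernel u x0) \<omega>" using J ae by (intro AE_finite_allI) auto
    then have "AE \<omega> in M. (\<Sum>u\<in>J. c u * Y u \<omega>) = (\<Sum>u\<in>J. c u * W (kernel u x0) \<omega>)"
      by eventually_elim (auto intro: sum.cong)
    then show "centered_gaussian M (\<lambda>\<omega>. \<Sum>u\<in>J. c u * Y u \<omega>)"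
      by (rule centered_gaussian_cong_AE[OF gaussian_sum[OF J kernel_hermitian_L2]]) measurable
  qed
  have W0: "AE \<omega> in M. W (\<lambda>\<xi>. complex_of_real c * kernel x x0 \<xi> + complex_of_real d * kernel y x0 \<xi>) \<omega> = c * Y x \<omega> + d * Y y \<omega>" for c d x y
    using W_lincomb[OF kernel_hermitian_L2 kernel_hermitian_L2, of c x x0 d y x0] ae[of x] ae[of y] by eventually_elim simp
  have H: "(\<lambda>\<xi>. complex_of_real c * kernel x x0 \<xi> + complex_of_real d * kernel y x0 \<xi>) \<in> hermitian_L2" for c d x y
    by (intro hermitian_L2_lincomb kernel_hermitian_L2)
  show "self_similar M (h x0) Y"
    unfolding self_similar_def
  proof (intro allI impI)
    fix c :: real assume c: "0 < c"
    \<comment> \<open>The vanishing second term puts the kernel into the two-term form of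
      \<open>W_lincomb\<close>.\<close>
    let ?g = "\<lambda>x \<xi>. complex_of_real (c powr h x0) * kernel x x0 \<xi> + complex_of_real 0 * kernel x x0 \<xi>"
    have eq: "kernel (c *\<^sub>R x) x0 = rescale c 0 (?g x)" for x
      using kernel_scale[OF c, of x x0] by (simp add: fun_eq_iff)
    show "same_fdd M (\<lambda>x. Y (c *\<^sub>R x)) M (\<lambda>x \<omega>. c powr h x0 * Y x \<omega>)"
    proof (rule noise_same_fdd)
      show "kernel (c *\<^sub>R x) x0 \<in> hermitian_L2" for x by (rule kernel_hermitian_L2)
      show "?g x \<in> hermitian_L2" for x by (rule H)
      show "noise_ip (kernel (c *\<^sub>R x) x0) (kernel (c *\<^sub>R y) x0) = noise_ip (?g x) (?g y)" for x y
        unfolding eq by (intro noise_ip_rescale H c)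
      show "AE \<omega> in M. c powr h x0 * Y x \<omega> = W (?g x) \<omega>" for x
        using W0[of "c powr h x0" x 0 x] by eventually_elim simp
    qed (use ae in auto)
  qed
  show "stationary_increments M Y"
    unfolding stationary_increments_def
  proof (intro allI)
    fix z
    let ?g = "\<lambda>x \<xi>. complex_of_real 1 * kernel (x + z) x0 \<xi> + complex_of_real (- 1) * kernel z x0 \<xi>"
    let ?k = "\<lambda>x \<xi>. complex_of_real 1 * kernel x x0 \<xi> + complex_of_real (- 1) * kernel 0 x0 \<xi>"
    have eq: "?g x = rescale 1 (- z) (?k x)" for x
      using kernel_shift[of x z x0] by (simp add: fun_eq_iff)
    show "same_fdd M (\<lambda>x \<omega>. Y (x + z) \<omega> - Y z \<omega>) M (\<lambda>x \<omega>. Y x \<omega> - Y 0 \<omega>)"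
    proof (rule noise_same_fdd)
      show "?g x \<in> hermitian_L2" "?k x \<in> hermitian_L2" for x by (rule H)+
      show "noise_ip (?g x) (?g y) = noise_ip (?k x) (?k y)" for x y
        unfolding eq by (intro noise_ip_rescale H zero_less_one)
      show "AE \<omega> in M. Y (x + z) \<omega> - Y z \<omega> = W (?g x) \<omega>" for x
        using W0[of 1 "x + z" "-1" z] by eventually_elim simp
      show "AE \<omega> in M. Y x \<omega> - Y 0 \<omega> = W (?k x) \<omega>" for x
        using W0[of 1 x "-1" 0] by eventually_elim simp
    qed measurable
  qed
  show "anisotropy_function M (h x0) Y (\<lambda>\<Theta>. (lafbf_C \<alpha> \<delta> x0 \<Theta>)\<^sup>2)"
    unfolding anisotropy_function_def
  proof (intro conjI exI)
    show Cm: "(\<lambda>\<Theta>. (lafbf_C \<alpha> \<delta> x0 \<Theta>)\<^sup>2) \<in> borel_measurable borel" by measurable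
    show "integrable arc_length (\<lambda>\<Theta>. (lafbf_C \<alpha> \<delta> x0 \<Theta>)\<^sup>2)"
    proof (rule finite_measure.integrable_const_bound[OF finite_measure_arc_length])
      show "AE \<Theta> in arc_length. norm ((lafbf_C \<alpha> \<delta> x0 \<Theta>)\<^sup>2) \<le> 1 / (2 * \<delta>)"
        using lafbf_C_sq_le[OF \<delta>] by (intro AE_I2) simp
    qed (use Cm in \<open>simp add: arc_length_def\<close>)
    show "spectral_density M Y (spectral x0)" by (rule tangent_spectral_density[OF Y])
    show "AE \<xi> in lborel. spectral x0 \<xi> = norm \<xi> powr (- 2 * h x0 - 2) * (lafbf_C \<alpha> \<delta> x0 (\<xi> /\<^sub>R norm \<xi>))\<^sup>2"
      by (simp add: spectral_def)
  qed
  show "tensor_of (\<lambda>\<Theta>. (lafbf_C \<alpha> \<delta> x0 \<Theta>)\<^sup>2) = (\<chi> i j. \<integral>\<Theta>. \<Theta> $ i * \<Theta> $ j * (lafbf_C \<alpha> \<delta> x0 \<Theta>)\<^sup>2 \<partial>arc_length)"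
    by (simp add: tensor_of_def)
qed

text \<open>The range of \<alpha> keeps the direction \<open>unit_vec (\<alpha> x0)\<close> off the
  negative axis, where the principal argument jumps; by continuity of \<open>Arg\<close>, nearby
  points remain in the sector.\<close>

lemma amplitude_pos_near:
  assumes \<alpha>0: "- pi / 2 < \<alpha> x0" "\<alpha> x0 < pi / 2"
  obtains r where "0 < r" "r \<le> 1 / 2" "\<And>\<xi>. \<xi> \<in> ball (unit_vec (\<alpha> x0)) r \<Longrightarrow> amplitude x0 \<xi> \<noteq> 0"
proof -
  define z where "z = cis (\<alpha> x0)"
  have "Re z > 0" using \<alpha>0 by (simp add: z_def cos_gt_zero_pi)
  then have "z \<notin> \<real>\<^sub>\<le>\<^sub>0" by (auto simp: complex_nonpos_Reals_iff)
  then have "isCont Arg z" by (rule continuous_at_Arg)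
  then obtain s where s: "s > 0" "\<And>w. dist w z < s \<Longrightarrow> dist (Arg w) (Arg z) < \<delta>"
    using \<delta> unfolding continuous_at_eps_delta by blast
  have Argz: "Arg z = \<alpha> x0" unfolding z_def using \<alpha>0 by (intro Arg_cis) auto
  \<comment> \<open>The cap 1/2 keeps the ball away from the origin and, in
    \<open>tangent_nontrivial\<close>, keeps \<open>n \<bullet> \<xi>\<close> between 1/2 and
    3/2.\<close>
  define r where "r = min s (1 / 2)"
  have "amplitude x0 \<xi> \<noteq> 0" if \<xi>: "\<xi> \<in> ball (unit_vec (\<alpha> x0)) r" for \<xi>
  proof -
    define w where "w = Complex (\<xi> $ 1) (\<xi> $ 2)"
    have d: "norm (\<xi> - unit_vec (\<alpha> x0)) < r" using \<xi> by (simp add: dist_norm norm_minus_commute)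
    have "dist w z = norm (\<xi> - unit_vec (\<alpha> x0))"
      by (simp add: dist_norm w_def z_def cmod_def norm_plane)
    then have "dist (Arg w) (Arg z) < \<delta>" using d by (intro s(2)) (simp add: r_def)
    then have "Arg w \<in> {\<alpha> x0 - \<delta>..\<alpha> x0 + \<delta>}" unfolding Argz by (auto simp: dist_real_def abs_if split: if_splits)
    moreover have "is_Arg w (Arg w)" by (simp add: is_Arg_def Arg_eq[symmetric]) (metis Arg_eq mult_zero_left norm_zero of_real_0)
    ultimately have "arg_in \<xi> {\<alpha> x0 - \<delta>..\<alpha> x0 + \<delta>}" by (auto simp: arg_in_def w_def)
    then have "(lafbf_C \<alpha> \<delta> x0 \<xi>)\<^sup>2 > 0" unfolding lafbf_C_sq[OF \<delta>] using \<delta> by (simp add: add_pos_nonneg)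
    moreover have "\<xi> \<noteq> 0" using d by (auto simp: r_def)
    ultimately show ?thesis by (simp add: amplitude_def)
  qed
  then show ?thesis using s(1) by (intro that[of r]) (auto simp: r_def)
qed

text \<open>The variance at \<open>n\<close> is the squared norm of the kernel, which vanishes
  nowhere on a ball around \<open>n\<close>: the amplitude is nonzero there and the phase lies
  strictly between 0 and \<open>pi\<close>.\<close>

lemma tangent_nontrivial:
  assumes Y: "continuous_version M (\<lambda>u. W (kernel u x0)) Y" and \<alpha>0: "- pi / 2 < \<alpha> x0" "\<alpha> x0 < pi / 2"
  shows "nontrivial_field M Y"
  unfolding nontrivial_field_def
proof
  assume 0: "\<forall>x. AE \<omega> in M. Y x \<omega> = 0"
  define n where "n = unit_vec (\<alpha> x0)"
  have k: "kernel n x0 \<in> hermitian_L2" by (rule kernel_hermitian_L2)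
  have "AE \<omega> in M. Y n \<omega> = W (kernel n x0) \<omega>" using Y by (simp add: continuous_version_def)
  then have "AE \<omega> in M. W (kernel n x0) \<omega> * W (kernel n x0) \<omega> = 0"
    using 0[rule_format, of n] by eventually_elim simp
  then have "expectation (\<lambda>\<omega>. W (kernel n x0) \<omega> * W (kernel n x0) \<omega>) = expectation (\<lambda>\<omega>. 0)"
    using measurable_W[OF k] by (intro integral_cong_AE) auto
  then have "noise_ip (kernel n x0) (kernel n x0) = 0" by (simp add: covariance[OF k k])
  then have "(\<integral>\<xi>. (cmod (kernel n x0 \<xi>))\<^sup>2 \<partial>lborel) = 0"
    by (simp add: noise_ip_def complex_mult_cnj cmod_power2)
  moreover have "integrable lborel (\<lambda>\<xi>. (cmod (kernel n x0 \<xi>))\<^sup>2)" using k by (simp add: hermitian_L2_def)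
  ultimately have ae: "AE \<xi> in lborel. (cmod (kernel n x0 \<xi>))\<^sup>2 = 0"
    by (subst (asm) integral_nonneg_eq_0_iff_AE) auto
  obtain r where r: "0 < r" "r \<le> 1 / 2" "\<And>\<xi>. \<xi> \<in> ball n r \<Longrightarrow> amplitude x0 \<xi> \<noteq> 0"
    using amplitude_pos_near[OF \<alpha>0] unfolding n_def by metis
  have "kernel n x0 \<xi> \<noteq> 0" if \<xi>: "\<xi> \<in> ball n r" for \<xi>
  proof -
    have d: "norm (\<xi> - n) < 1 / 2" using \<xi> r(2) by (simp add: dist_norm norm_minus_commute)
    have nn: "norm n = 1" "n \<bullet> n = 1" by (simp_all add: n_def dot_square_norm)
    have "\<bar>n \<bullet> (\<xi> - n)\<bar> \<le> norm n * norm (\<xi> - n)" by (rule Cauchy_Schwarz_ineq2)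
    then have "\<bar>n \<bullet> \<xi> - 1\<bar> < 1 / 2" using d nn by (simp add: inner_diff_right)
    then have t: "0 < n \<bullet> \<xi>" "n \<bullet> \<xi> < pi" using pi_gt3 by (auto simp: abs_if split: if_splits)
    have "Im (cis (n \<bullet> \<xi>)) > 0" using t by (simp add: sin_gt_zero)
    then have "cis (n \<bullet> \<xi>) - 1 \<noteq> 0" by (metis Im_complex_of_real diff_eq_diff_eq diff_self eq_iff_diff_eq_0 less_irrefl of_real_1)
    then show ?thesis using r(3)[OF \<xi>] by (simp add: kernel_def)
  qed
  then have "AE \<xi> in lborel. \<xi> \<notin> ball n r" using ae by (auto elim!: eventually_mono)
  then have "emeasure lborel (ball n r) = 0"
    by (subst (asm) AE_iff_measurable[of "ball n r"]) auto
  then show False using r(1) unit_ball_vol_pos[of 2] by (simp add: emeasure_ball)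
qed

lemma local_structure_tensor:
  assumes \<alpha>0: "- pi / 2 < \<alpha> x0" "\<alpha> x0 < pi / 2"
  shows "has_local_structure_tensor M (lafbf W h \<alpha> \<delta>) x0 (tensor_of (\<lambda>\<Theta>. (lafbf_C \<alpha> \<delta> x0 \<Theta>)\<^sup>2))"
proof -
  obtain X where X: "continuous_version M (lafbf W h \<alpha> \<delta>) X" using lafbf_continuous_version by blast
  obtain Y where Y: "continuous_version M (\<lambda>u. W (kernel u x0)) Y" using tangent_continuous_version by blast
  have "localizable_at M (lafbf W h \<alpha> \<delta>) (h x0) x0 M Y"
    unfolding localizable_at_def
    using a h[of x0] b(1) prob_space_axioms Y tangent_nontrivial[OF Y \<alpha>0] X tangent_converges[OF X Y]
    by (auto simp: continuous_version_def intro!: exI[of _ X])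
  then show ?thesis
    using tangent_structure_tensor[OF Y] unfolding has_local_structure_tensor_def by blast
qed

end

text \<open>Allows every larger constant, so that a single \<Lambda> serves both \<open>h\<close>
  and \<alpha>.\<close>

lemma holder_const_ge_1:
  fixes g :: "plane \<Rightarrow> real"
  assumes "holder s g"
  obtains \<Lambda> where "1 \<le> \<Lambda>" "\<And>\<Lambda>' x y. \<Lambda> \<le> \<Lambda>' \<Longrightarrow> \<bar>g x - g y\<bar> \<le> \<Lambda>' * norm (x - y) powr s"
proof -
  obtain L where L: "\<And>x y. norm (g x - g y) \<le> L * norm (x - y) powr s" using assms by (auto simp: holder_def)
  show ?thesis
  proof (rule that[of "max 1 L"])
    fix \<Lambda>' and x y :: plane assume "max 1 L \<le> \<Lambda>'"
    then have "L * norm (x - y) powr s \<le> \<Lambda>' * norm (x - y) powr s" by (intro mult_right_mono) auto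
    then show "\<bar>g x - g y\<bar> \<le> \<Lambda>' * norm (x - y) powr s" using L[of x y] by simp
  qed simp
qed

theorem proposition8:
  fixes M :: "'a measure"
    and W :: "(plane \<Rightarrow> complex) \<Rightarrow> 'a \<Rightarrow> real"
    and h \<alpha> :: "plane \<Rightarrow> real"
    and b \<beta> \<eta> :: real
  assumes "complex_white_noise M W"
    and "\<forall>x. h x \<in> {0..1}"
    and "holder \<beta> h"
    and "(INF x. h x) > 0"
    and "b = (SUP x. h x)"
    and "b < 1"
    and "b < \<beta>" and "\<beta> \<le> 1"
    and "\<forall>x. \<alpha> x \<in> {- pi / 2<..<pi / 2}"
    and "C1 \<alpha>"
    and "holder (2 * \<eta>) \<alpha>"
    and "b < \<eta>" and "\<eta> \<le> 1 / 2"
  shows "\<forall>x0. approx_local_orientation M (lafbf W h \<alpha>) x0 (vector [cos (\<alpha> x0), sin (\<alpha> x0)])"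
proof
  fix x0
  define a where "a = (INF x. h x)"
  have bdd: "bdd_below (range h)" "bdd_above (range h)"
    using assms(2) by (auto intro!: bdd_belowI[of _ 0] bdd_aboveI[of _ 1])
  have h: "a \<le> h x" "h x \<le> b" for x
    unfolding a_def assms(5) by (intro cINF_lower cSUP_upper bdd UNIV_I)+
  obtain L1 where L1: "1 \<le> L1" "\<And>\<Lambda>' x y. L1 \<le> \<Lambda>' \<Longrightarrow> \<bar>h x - h y\<bar> \<le> \<Lambda>' * norm (x - y) powr \<beta>"
    using holder_const_ge_1[OF assms(3)] by metis
  obtain L2 where L2: "1 \<le> L2" "\<And>\<Lambda>' x y. L2 \<le> \<Lambda>' \<Longrightarrow> \<bar>\<alpha> x - \<alpha> y\<bar> \<le> \<Lambda>' * norm (x - y) powr (2 * \<eta>)"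
    using holder_const_ge_1[OF assms(11)] by metis
  define \<Lambda> where "\<Lambda> = max L1 L2"
  have \<alpha>: "- pi / 2 < \<alpha> x0" "\<alpha> x0 < pi / 2" using assms(9) by auto
  define J where "J \<delta> = tensor_of (\<lambda>\<Theta>. (lafbf_C \<alpha> \<delta> x0 \<Theta>)\<^sup>2)" for \<delta>
  have n: "vector [cos (\<alpha> x0), sin (\<alpha> x0)] = unit_vec (\<alpha> x0)" by (simp add: unit_vec_def)
  have "has_local_structure_tensor M (lafbf W h \<alpha> \<delta>) x0 (J \<delta>)" if \<delta>: "0 < \<delta>" for \<delta>
  proof -
    interpret lafbf_field M W h \<alpha> a b \<beta> \<eta> \<delta> \<Lambda>
    proof (unfold lafbf_field_def white_noise_def white_noise_axioms_def lafbf_params_def, intro conjI allI)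
      show "prob_space M" using assms(1) by (simp add: complex_white_noise_def)
      show "\<bar>h x - h y\<bar> \<le> \<Lambda> * norm (x - y) powr \<beta>" "\<bar>\<alpha> x - \<alpha> y\<bar> \<le> \<Lambda> * norm (x - y) powr (2 * \<eta>)" for x y
        by (intro L1 L2; simp add: \<Lambda>_def)+
      show "1 \<le> \<Lambda>" using L1(1) by (simp add: \<Lambda>_def)
      show "0 < a" using assms(4) by (simp add: a_def)
    qed (use assms h \<delta> in auto)
    show ?thesis unfolding J_def by (rule local_structure_tensor[OF \<alpha>])
  qed
  \<comment> \<open>The constant is 1 because, for small \<delta>, the squared \<open>C\<close> is
    \<open>1 / (4 * \<delta>)\<close> on two arcs of total length \<open>4 * \<delta>\<close>, so
    the tensor has trace 1.\<close>
  moreover have "(\<lambda>\<delta>. J \<delta> $ i $ j - 1 * (unit_vec (\<alpha> x0) $ i * unit_vec (\<alpha> x0) $ j)) \<in> O[at_right 0](\<lambda>\<delta>. \<delta>\<^sup>2)" for i j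
  proof (rule bigoI[where c=2])
    \<comment> \<open>Below \<open>pi / 2\<close> the two arcs are disjoint, as the explicit formula
      for the tensor requires.\<close>
    have "\<forall>\<^sub>F \<delta> in at_right 0. \<delta> \<in> {0<..<pi / 2}" by (rule eventually_at_right_real) simp
    then show "\<forall>\<^sub>F \<delta> in at_right 0. norm (J \<delta> $ i $ j - 1 * (unit_vec (\<alpha> x0) $ i * unit_vec (\<alpha> x0) $ j)) \<le> 2 * norm (\<delta>\<^sup>2)"
      by eventually_elim (use tensor_asymp[of \<alpha> x0, OF \<alpha>] in \<open>simp add: J_def\<close>)
  qed
  ultimately show "approx_local_orientation M (lafbf W h \<alpha>) x0 (vector [cos (\<alpha> x0), sin (\<alpha> x0)])"
    unfolding n approx_local_orientation_def using norm_unit_vec by (intro conjI exI[of _ J] exI[of _ 1]) auto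
qed

end
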